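(* Let $(W,S)$ be a finite rank, right-angled Coxeter system, let $\Gamma$ be the finite undirected simplicial graph with vertex set $S$ and edge set $\{(s,t)\in S\times S\mid m_{s,t}=2\}$, and suppose that $\Gamma$ contains no induced square. Let $q\in\mathbb{R}_{>0}^{(W,S)}$. Then the pair $(C^*_{r,q}(W),L_S^{(q)})$, where for self-adjoint $x\in C^*_{r,q}(W)$ $$L_S^{(q)}(x):=\begin{cases}\|[D_S,x]\|, & \text{if } x\in\mathbb{C}_q[W],\\ \infty, & \text{otherwise,}\end{cases}$$ is a compact quantum metric space.
   Context: A Coxeter system $(W,S)$ consists of a group $W=\langle S\mid (st)^{m_{s,t}}=e,\ s,t\in S\rangle$ with $m_{s,s}=1$, $m_{s,t}\in\{2,3,\dots,\infty\}$ for $s\ne t$ (no relation is imposed if $m_{s,t}=\infty$). It has finite rank if $S$ is finite and is right-angled if $m_{s,t}\in\{2,\infty\}$ for all $s\neq t$. $|\cdot|$ denotes the word length on $W$ with respect to $S$. An induced square in $\Gamma$ consists of $s_1,s_2,s_3,s_4\in S$ with $m_{s_1,s_2}=m_{s_2,s_3}=m_{s_3,s_4}=m_{s_4,s_1}=2$ and $m_{s_1,s_3}=m_{s_2,s_4}=\infty$. $\mathbb{R}_{>0}^{(W,S)}$ is the set of tuples $q=(q_s)_{s\in S}$ of positive reals with $q_s=q_t$ whenever $s,t$ are conjugate in $W$. Put $p_s(q):=(q_s-1)/\sqrt{q_s}$. The Iwahori--Hecke algebra $\mathbb{C}_q[W]$ is the unital $*$-algebra with linear basis $(T^{(q)}_{\mathbf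 w})_{\mathbf w\in W}$, unit $T_e^{(q)}$, involution $(T^{(q)}_{\mathbf w})^*=T^{(q)}_{\mathbf w^{-1}}$, and multiplication determined by $T^{(q)}_sT^{(q)}_{\mathbf w}=T^{(q)}_{s\mathbf w}$ if $|s\mathbf w|>|\mathbf w|$ and $T^{(q)}_sT^{(q)}_{\mathbf w}=T^{(q)}_{s\mathbf w}+p_s(q)T^{(q)}_{\mathbf w}$ if $|s\mathbf w|<|\mathbf w|$. It is viewed as a $*$-subalgebra of $\mathcal{B}(\ell^2(W))$ via the faithful representation $T^{(q)}_s\delta_{\mathbf w}=\delta_{s\mathbf w}$ if $|s\mathbf w|>|\mathbf w|$, and $T^{(q)}_s\delta_{\mathbf w}=\delta_{s\mathbf w}+p_s(q)\delta_{\mathbf w}$ if $|s\mathbf w|<|\mathbf w|$, where $(\delta_{\mathbf w})_{\mathbf w\in W}$ is the canonical orthonormal basis. $C^*_{r,q}(W)$ is the operator norm closure of $\mathbb{C}_q[W]$ in $\mathcal{B}(\ell^2(W))$. $D_S:=\sum_{n\in\mathbb{N}}nP_n$ is the unbounded self-adjoint diagonal operator $D_S\delta_{\mathbf w}=|\mathbf w|\delta_{\mathbf w}$ ($P_n$ being the orthogonal projection onto $\mathrm{Span}\{\delta_{\mathbf w}\mid|\mathbf w|=n\}$); for $x\in\mathbb{C}_q[W]$ the commutator $[D_S,x]=D_Sx-xD_S$ extends to a bounded operator. Compact quantum metric space: a pair $(A,L)$ of a unital C$^*$-algebra $A$ and a seminorm $L\colon\mathfrak{sa}(A)\to[0,\infty]$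 on its self-adjoint part such that (i) $L(a)=0$ iff $a\in\mathbb{R}1$; (ii) $\{a\in\mathfrak{sa}(A)\mid L(a)<\infty\}$ is dense in $\mathfrak{sa}(A)$; (iii) the metric $d_L(\varphi,\psi):=\sup\{|\varphi(a)-\psi(a)|\mid a\in\mathfrak{sa}(A),\ L(a)\le1\}$ on the state space $\mathcal{S}(A)$ metrizes the weak$^*$-topology. *)

theory Defs
  imports
    "HOL-Analysis.Analysis"
    "HOL-Algebra.Generated_Groups"
    "HOL-Algebra.Module"
    "HOL-Library.Extended_Nat"
begin

section \<open>Coxeter systems\<close>

definition list_mult :: "('a, 'r) monoid_scheme \<Rightarrow> 'a list \<Rightarrow> 'a" where
  "list_mult G xs = foldr (\<lambda>x y. x \<otimes>\<^bsub>G\<^esub> y) xs \<one>\<^bsub>G\<^esub>"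

text \<open>Words in the letters \<open>s\<close> and \<open>s\<inverse>\<close>, \<open>s \<in> S\<close>, are lists of pairs: \<open>(s, True)\<close> stands
  for \<open>s\<close> and \<open>(s, False)\<close> for \<open>s\<inverse>\<close>. The equivalence closure of one-step rewriting is equality in the
  abstract group with generators \<open>S\<close> and relators \<open>R\<close>.\<close>

definition word_value :: "('a, 'r) monoid_scheme \<Rightarrow> ('a \<times> bool) list \<Rightarrow> 'a" where
  "word_value G u = list_mult G (map (\<lambda>(s, b). if b then s else inv\<^bsub>G\<^esub> s) u)"

inductive presentation_step ::
  "'a set \<Rightarrow> ('a \<times> bool) list set \<Rightarrow> ('a \<times> bool) list \<Rightarrow> ('a \<times> bool) list \<Rightarrow> bool"
  for S :: "'a set" and R :: "('a \<times> bool) list set" where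
  cancel: "\<lbrakk>u \<in> lists (S \<times> UNIV); v \<in> lists (S \<times> UNIV); s \<in> S\<rbrakk>
    \<Longrightarrow> presentation_step S R (u @ [(s, b), (s, \<not> b)] @ v) (u @ v)"
| relator: "\<lbrakk>u \<in> lists (S \<times> UNIV); v \<in> lists (S \<times> UNIV); r \<in> R\<rbrakk>
    \<Longrightarrow> presentation_step S R (u @ r @ v) (u @ v)"

definition has_presentation ::
  "('a, 'r) monoid_scheme \<Rightarrow> 'a set \<Rightarrow> ('a \<times> bool) list set \<Rightarrow> bool" where
  "has_presentation G S R \<longleftrightarrow>
     S \<subseteq> carrier G \<and> generate G S = carrier G \<and> R \<subseteq> lists (S \<times> UNIV) \<and>
     (\<forall>u \<in> lists (S \<times> UNIV).
        word_value G u = \<one>\<^bsub>G\<^esub> \<longleftrightarrow> equivclp (presentation_step S R) u [])"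

definition coxeter_relators :: "'a set \<Rightarrow> ('a \<Rightarrow> 'a \<Rightarrow> enat) \<Rightarrow> ('a \<times> bool) list set" where
  "coxeter_relators S m =
     {concat (replicate n [(s, True), (t, True)]) | s t n. s \<in> S \<and> t \<in> S \<and> m s t = enat n}"

locale coxeter_system = group W
  for W :: "('w, 'r) monoid_scheme" (structure) and S :: "'w set" and m :: "'w \<Rightarrow> 'w \<Rightarrow> enat" +
  assumes m_diag: "s \<in> S \<Longrightarrow> m s s = 1"
    and m_offdiag: "\<lbrakk>s \<in> S; t \<in> S; s \<noteq> t\<rbrakk> \<Longrightarrow> 2 \<le> m s t"
    and m_sym: "\<lbrakk>s \<in> S; t \<in> S\<rbrakk> \<Longrightarrow> m s t = m t s"
    and presentation: "has_presentation W S (coxeter_relators S m)"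

definition right_angled :: "'w set \<Rightarrow> ('w \<Rightarrow> 'w \<Rightarrow> enat) \<Rightarrow> bool" where
  "right_angled S m \<longleftrightarrow> (\<forall>s\<in>S. \<forall>t\<in>S. s \<noteq> t \<longrightarrow> m s t \<in> {2, \<infinity>})"

definition has_induced_square :: "'w set \<Rightarrow> ('w \<Rightarrow> 'w \<Rightarrow> enat) \<Rightarrow> bool" where
  "has_induced_square S m \<longleftrightarrow>
     (\<exists>s1\<in>S. \<exists>s2\<in>S. \<exists>s3\<in>S. \<exists>s4\<in>S.
        m s1 s2 = 2 \<and> m s2 s3 = 2 \<and> m s3 s4 = 2 \<and> m s4 s1 = 2 \<and>
        m s1 s3 = \<infinity> \<and> m s2 s4 = \<infinity>)"

text \<open>Inverse letters can be omitted since the elements of \<open>S\<close> are involutions.\<close>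

definition word_length :: "('w, 'r) monoid_scheme \<Rightarrow> 'w set \<Rightarrow> 'w \<Rightarrow> nat" where
  "word_length W S w = (LEAST n. \<exists>ss \<in> lists S. length ss = n \<and> list_mult W ss = w)"

definition reduced_word :: "('w, 'r) monoid_scheme \<Rightarrow> 'w set \<Rightarrow> 'w \<Rightarrow> 'w list \<Rightarrow> bool" where
  "reduced_word W S w ss \<longleftrightarrow>
     ss \<in> lists S \<and> list_mult W ss = w \<and> length ss = word_length W S w"

definition multi_parameters :: "('w, 'r) monoid_scheme \<Rightarrow> 'w set \<Rightarrow> ('w \<Rightarrow> real) set" where
  "multi_parameters W S =
     {q. (\<forall>s\<in>S. 0 < q s) \<and>
         (\<forall>s\<in>S. \<forall>t\<in>S. (\<exists>g\<in>carrier W. t = g \<otimes>\<^bsub>W\<^esub> s \<otimes>\<^bsub>W\<^esub> inv\<^bsub>W\<^esub> g) \<longrightarrow> q s = q t)}"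


section \<open>Unital C*-algebras and compact quantum metric spaces\<close>

definition complex_ring :: "complex ring" where
  "complex_ring = \<lparr>carrier = UNIV, mult = (*), one = 1, zero = 0, add = (+)\<rparr>"

record 'b star_algebra = "(complex, 'b) module" +
  invol :: "'b \<Rightarrow> 'b"
  nrm :: "'b \<Rightarrow> real"

text \<open>The value off the carrier is irrelevant, but \<^locale>\<open>Metric_space\<close> demands nonnegativity and
  symmetry on the whole type.\<close>

definition nrm_dist :: "('b, 'z) star_algebra_scheme \<Rightarrow> 'b \<Rightarrow> 'b \<Rightarrow> real" where
  "nrm_dist A a b =
     (if a \<in> carrier A \<and> b \<in> carrier A then nrm A (a \<ominus>\<^bsub>A\<^esub> b) else 0)"

definition nrm_topology :: "('b, 'z) star_algebra_scheme \<Rightarrow> 'b topology" where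
  "nrm_topology A = Metric_space.mtopology (carrier A) (nrm_dist A)"

locale unital_cstar_algebra =
  ring A + Module.module complex_ring A
  for A :: "('b, 'z) star_algebra_scheme" (structure) +
  assumes smult_mult_left: "\<lbrakk>a \<in> carrier A; b \<in> carrier A\<rbrakk> \<Longrightarrow> (c \<odot> a) \<otimes> b = c \<odot> (a \<otimes> b)"
    and smult_mult_right: "\<lbrakk>a \<in> carrier A; b \<in> carrier A\<rbrakk> \<Longrightarrow> a \<otimes> (c \<odot> b) = c \<odot> (a \<otimes> b)"
    and invol_closed: "a \<in> carrier A \<Longrightarrow> invol A a \<in> carrier A"
    and invol_invol: "a \<in> carrier A \<Longrightarrow> invol A (invol A a) = a"
    and invol_add: "\<lbrakk>a \<in> carrier A; b \<in> carrier A\<rbrakk> \<Longrightarrow> invol A (a \<oplus> b) = invol A a \<oplus> invol A b"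
    and invol_smult: "a \<in> carrier A \<Longrightarrow> invol A (c \<odot> a) = cnj c \<odot> invol A a"
    and invol_mult: "\<lbrakk>a \<in> carrier A; b \<in> carrier A\<rbrakk> \<Longrightarrow> invol A (a \<otimes> b) = invol A b \<otimes> invol A a"
    and nrm_nonneg: "a \<in> carrier A \<Longrightarrow> 0 \<le> nrm A a"
    and nrm_eq_0: "a \<in> carrier A \<Longrightarrow> nrm A a = 0 \<longleftrightarrow> a = \<zero>"
    and nrm_smult: "a \<in> carrier A \<Longrightarrow> nrm A (c \<odot> a) = cmod c * nrm A a"
    and nrm_triangle: "\<lbrakk>a \<in> carrier A; b \<in> carrier A\<rbrakk> \<Longrightarrow> nrm A (a \<oplus> b) \<le> nrm A a + nrm A b"
    and nrm_mult: "\<lbrakk>a \<in> carrier A; b \<in> carrier A\<rbrakk> \<Longrightarrow> nrm A (a \<otimes> b) \<le> nrm A a * nrm A b"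
    and cstar_identity: "a \<in> carrier A \<Longrightarrow> nrm A (invol A a \<otimes> a) = (nrm A a)\<^sup>2"
    and complete: "Metric_space.mcomplete (carrier A) (nrm_dist A)"

definition self_adjoint_part :: "('b, 'z) star_algebra_scheme \<Rightarrow> 'b set" where
  "self_adjoint_part A = {a \<in> carrier A. invol A a = a}"

text \<open>States are taken to be \<^const>\<open>extensional\<close>, so that equality of states is equality of
  functions and the topology of pointwise convergence is a product topology.\<close>

definition state_space :: "('b, 'z) star_algebra_scheme \<Rightarrow> ('b \<Rightarrow> complex) set" where
  "state_space A =
     {\<phi> \<in> extensional (carrier A).
        (\<forall>a\<in>carrier A. \<forall>b\<in>carrier A. \<phi> (a \<oplus>\<^bsub>A\<^esub> b) = \<phi> a + \<phi> b) \<and>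
        (\<forall>c. \<forall>a\<in>carrier A. \<phi> (c \<odot>\<^bsub>A\<^esub> a) = c * \<phi> a) \<and>
        (\<forall>a\<in>carrier A. \<phi> (invol A a \<otimes>\<^bsub>A\<^esub> a) \<in> \<real>\<^sub>\<ge>\<^sub>0) \<and>
        \<phi> \<one>\<^bsub>A\<^esub> = 1}"

definition weak_star_topology :: "('b, 'z) star_algebra_scheme \<Rightarrow> ('b \<Rightarrow> complex) topology" where
  "weak_star_topology A =
     subtopology (product_topology (\<lambda>_. euclidean) (carrier A)) (state_space A)"

definition state_dist ::
  "('b, 'z) star_algebra_scheme \<Rightarrow> ('b \<Rightarrow> ennreal) \<Rightarrow> ('b \<Rightarrow> complex) \<Rightarrow> ('b \<Rightarrow> complex) \<Rightarrow> ennreal"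
  where
  "state_dist A L \<phi> \<psi> =
     (SUP a \<in> {a \<in> self_adjoint_part A. L a \<le> 1}. ennreal (cmod (\<phi> a - \<psi> a)))"

text \<open>Only the values of \<open>L\<close> on the self-adjoint part matter.\<close>

locale compact_quantum_metric_space = unital_cstar_algebra A
  for A :: "('b, 'z) star_algebra_scheme" (structure) and L :: "'b \<Rightarrow> ennreal" +
  assumes seminorm_scale:
      "a \<in> self_adjoint_part A \<Longrightarrow> L (complex_of_real r \<odot> a) = ennreal \<bar>r\<bar> * L a"
    and seminorm_triangle:
      "\<lbrakk>a \<in> self_adjoint_part A; b \<in> self_adjoint_part A\<rbrakk> \<Longrightarrow> L (a \<oplus> b) \<le> L a + L b"
    and seminorm_kernel:
      "a \<in> self_adjoint_part A \<Longrightarrow> L a = 0 \<longleftrightarrow> (\<exists>r. a = complex_of_real r \<odot> \<one>)"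
    and finite_dense:
      "self_adjoint_part A \<subseteq> nrm_topology A closure_of {a \<in> self_adjoint_part A. L a < \<infinity>}"
    and state_dist_finite:
      "\<lbrakk>\<phi> \<in> state_space A; \<psi> \<in> state_space A\<rbrakk> \<Longrightarrow> state_dist A L \<phi> \<psi> < \<infinity>"
    and state_dist_metric:
      "Metric_space (state_space A) (\<lambda>\<phi> \<psi>. enn2real (state_dist A L \<phi> \<psi>))"
    and state_dist_metrizes:
      "Metric_space.mtopology (state_space A) (\<lambda>\<phi> \<psi>. enn2real (state_dist A L \<phi> \<psi>))
         = weak_star_topology A"


section \<open>Bounded operators on $\ell^2(I)$\<close>

text \<open>Vectors vanish off \<open>I\<close>; operators are \<^const>\<open>extensional\<close> on \<open>ell2 I\<close>.\<close>

definition ell2 :: "'x set \<Rightarrow> ('x \<Rightarrow> complex) set" where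
  "ell2 I = {f. (\<forall>x. x \<notin> I \<longrightarrow> f x = 0) \<and> (\<lambda>x. (cmod (f x))\<^sup>2) summable_on I}"

definition ell2_inner :: "'x set \<Rightarrow> ('x \<Rightarrow> complex) \<Rightarrow> ('x \<Rightarrow> complex) \<Rightarrow> complex" where
  "ell2_inner I f g = (\<Sum>\<^sub>\<infinity>x\<in>I. cnj (f x) * g x)"

definition ell2_norm :: "'x set \<Rightarrow> ('x \<Rightarrow> complex) \<Rightarrow> real" where
  "ell2_norm I f = sqrt (\<Sum>\<^sub>\<infinity>x\<in>I. (cmod (f x))\<^sup>2)"

definition delta :: "'x \<Rightarrow> 'x \<Rightarrow> complex" where
  "delta x = (\<lambda>y. if y = x then 1 else 0)"

type_synonym 'x operator = "('x \<Rightarrow> complex) \<Rightarrow> ('x \<Rightarrow> complex)"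

definition bounded_operators :: "'x set \<Rightarrow> 'x operator set" where
  "bounded_operators I =
     {T \<in> ell2 I \<rightarrow>\<^sub>E ell2 I.
        (\<forall>f\<in>ell2 I. \<forall>g\<in>ell2 I. T (\<lambda>x. f x + g x) = (\<lambda>x. T f x + T g x)) \<and>
        (\<forall>c. \<forall>f\<in>ell2 I. T (\<lambda>x. c * f x) = (\<lambda>x. c * T f x)) \<and>
        (\<exists>K. \<forall>f\<in>ell2 I. ell2_norm I (T f) \<le> K * ell2_norm I f)}"

definition operator_norm :: "'x set \<Rightarrow> 'x operator \<Rightarrow> real" where
  "operator_norm I T = (SUP f \<in> {f \<in> ell2 I. ell2_norm I f \<le> 1}. ell2_norm I (T f))"

definition adjoint_operator :: "'x set \<Rightarrow> 'x operator \<Rightarrow> 'x operator" where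
  "adjoint_operator I T =
     (THE T'. T' \<in> bounded_operators I \<and>
        (\<forall>f\<in>ell2 I. \<forall>g\<in>ell2 I. ell2_inner I (T' f) g = ell2_inner I f (T g)))"

definition operator_algebra :: "'x set \<Rightarrow> 'x operator star_algebra" where
  "operator_algebra I =
     \<lparr>carrier = bounded_operators I,
      mult = compose (ell2 I),
      one = (\<lambda>f\<in>ell2 I. f),
      zero = (\<lambda>f\<in>ell2 I. (\<lambda>x. 0)),
      add = (\<lambda>T U. \<lambda>f\<in>ell2 I. (\<lambda>x. T f x + U f x)),
      smult = (\<lambda>c T. \<lambda>f\<in>ell2 I. (\<lambda>x. c * T f x)),
      invol = adjoint_operator I,
      nrm = operator_norm I\<rparr>"


section \<open>Hecke C*-algebras\<close>

definition hecke_p :: "('w \<Rightarrow> real) \<Rightarrow> 'w \<Rightarrow> real" where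
  "hecke_p q s = (q s - 1) / sqrt (q s)"

text \<open>The formula for a general vector is obtained by linear and continuous extension from the basis
  vectors, see \<open>hecke_generator_delta\<close> below, using \<open>s\<inverse> = s\<close>.\<close>

definition hecke_generator ::
  "('w, 'r) monoid_scheme \<Rightarrow> 'w set \<Rightarrow> ('w \<Rightarrow> real) \<Rightarrow> 'w \<Rightarrow> 'w operator" where
  "hecke_generator W S q s =
     (\<lambda>f\<in>ell2 (carrier W). \<lambda>w.
        if w \<in> carrier W then
          f (s \<otimes>\<^bsub>W\<^esub> w) +
          (if word_length W S (s \<otimes>\<^bsub>W\<^esub> w) < word_length W S w
           then complex_of_real (hecke_p q s) * f w else 0)
        else 0)"

text \<open>The multiplication rule gives $T_{\mathbf w} = T_{s_1} \cdots T_{s_n}$ for every reduced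
  expression $\mathbf w = s_1 \cdots s_n$; the choice does not matter.\<close>

definition hecke_basis ::
  "('w, 'r) monoid_scheme \<Rightarrow> 'w set \<Rightarrow> ('w \<Rightarrow> real) \<Rightarrow> 'w \<Rightarrow> 'w operator" where
  "hecke_basis W S q w =
     list_mult (operator_algebra (carrier W))
       (map (hecke_generator W S q) (SOME ss. reduced_word W S w ss))"

definition hecke_algebra ::
  "('w, 'r) monoid_scheme \<Rightarrow> 'w set \<Rightarrow> ('w \<Rightarrow> real) \<Rightarrow> 'w operator set" where
  "hecke_algebra W S q =
     (let B = operator_algebra (carrier W) in
       {\<Oplus>\<^bsub>B\<^esub>w\<in>F. c w \<odot>\<^bsub>B\<^esub> hecke_basis W S q w | F c. finite F \<and> F \<subseteq> carrier W})"

definition hecke_cstar_algebra ::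
  "('w, 'r) monoid_scheme \<Rightarrow> 'w set \<Rightarrow> ('w \<Rightarrow> real) \<Rightarrow> 'w operator star_algebra" where
  "hecke_cstar_algebra W S q =
     (let B = operator_algebra (carrier W) in
       B\<lparr>carrier := nrm_topology B closure_of hecke_algebra W S q\<rparr>)"

definition length_operator ::
  "('w, 'r) monoid_scheme \<Rightarrow> 'w set \<Rightarrow> 'w operator" where
  "length_operator W S f = (\<lambda>w. of_nat (word_length W S w) * f w)"

definition length_domain ::
  "('w, 'r) monoid_scheme \<Rightarrow> 'w set \<Rightarrow> ('w \<Rightarrow> complex) set" where
  "length_domain W S = {f \<in> ell2 (carrier W). length_operator W S f \<in> ell2 (carrier W)}"

text \<open>The bounded extension of \<open>D x - x D\<close> from its natural domain.\<close>

definition length_commutator ::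
  "('w, 'r) monoid_scheme \<Rightarrow> 'w set \<Rightarrow> 'w operator \<Rightarrow> 'w operator" where
  "length_commutator W S x =
     (THE T. T \<in> bounded_operators (carrier W) \<and>
        (\<forall>f\<in>length_domain W S. x f \<in> length_domain W S \<longrightarrow>
           T f = (\<lambda>w. length_operator W S (x f) w - x (length_operator W S f) w)))"

definition hecke_seminorm ::
  "('w, 'r) monoid_scheme \<Rightarrow> 'w set \<Rightarrow> ('w \<Rightarrow> real) \<Rightarrow> 'w operator \<Rightarrow> ennreal" where
  "hecke_seminorm W S q x =
     (if x \<in> hecke_algebra W S q
      then ennreal (operator_norm (carrier W) (length_commutator W S x)) else \<infinity>)"


subsection \<open>The generators act on the canonical basis as prescribed\<close>

lemma (in coxeter_system) S_closed: "s \<in> S \<Longrightarrow> s \<in> carrier W"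
  using presentation by (auto simp: has_presentation_def)

lemma (in coxeter_system) S_square:
  assumes "s \<in> S" shows "s \<otimes> s = \<one>"
proof -
  have m1: "m s s = enat 1"
    using m_diag[OF assms] by (simp add: one_enat_def)
  have r: "[(s, True), (s, True)] \<in> coxeter_relators S m"
    unfolding coxeter_relators_def
    by (rule CollectI, rule exI[of _ s], rule exI[of _ s], rule exI[of _ 1]) (use m1 assms in simp)
  have "presentation_step S (coxeter_relators S m) ([] @ [(s, True), (s, True)] @ []) ([] @ [])"
    by (rule presentation_step.relator) (use r in auto)
  then have "equivclp (presentation_step S (coxeter_relators S m)) [(s, True), (s, True)] []"
    by (simp add: r_into_equivclp)
  then have "word_value W [(s, True), (s, True)] = \<one>"
    using presentation assms by (auto simp: has_presentation_def)
  then show ?thesis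
    using S_closed[OF assms] by (simp add: word_value_def list_mult_def)
qed

lemma delta_in_ell2: "x \<in> I \<Longrightarrow> delta x \<in> ell2 I"
proof -
  assume "x \<in> I"
  have "(\<lambda>y. (cmod (delta x y))\<^sup>2) summable_on I"
    by (rule finite_nonzero_values_imp_summable_on, rule finite_subset[of _ "{x}"])
       (auto simp: delta_def)
  then show ?thesis
    using \<open>x \<in> I\<close> by (auto simp: ell2_def delta_def)
qed

lemma (in coxeter_system) hecke_generator_delta:
  assumes s: "s \<in> S" and w: "w \<in> carrier W"
  shows "word_length W S w < word_length W S (s \<otimes> w) \<Longrightarrow>
           hecke_generator W S q s (delta w) = delta (s \<otimes> w)"
    and "word_length W S (s \<otimes> w) < word_length W S w \<Longrightarrow>
           hecke_generator W S q s (delta w) =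
             (\<lambda>v. delta (s \<otimes> w) v + complex_of_real (hecke_p q s) * delta w v)"
proof -
  have ss: "s \<otimes> (s \<otimes> v) = v" if "v \<in> carrier W" for v
    using S_square[OF s] S_closed[OF s] that by (metis l_one m_assoc)
  have iff: "s \<otimes> v = w \<longleftrightarrow> v = s \<otimes> w" if "v \<in> carrier W" for v
    using ss w that by metis
  have *: "hecke_generator W S q s (delta w) =
        (\<lambda>v. delta (s \<otimes> w) v +
           (if word_length W S (s \<otimes> w) < word_length W S w
            then complex_of_real (hecke_p q s) * delta w v else 0))"
    using delta_in_ell2[OF w] S_closed[OF s] w iff
    by (auto simp: hecke_generator_def delta_def fun_eq_iff)
  show "word_length W S w < word_length W S (s \<otimes> w) \<Longrightarrow>
           hecke_generator W S q s (delta w) = delta (s \<otimes> w)"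
    by (simp add: *)
  show "word_length W S (s \<otimes> w) < word_length W S w \<Longrightarrow>
           hecke_generator W S q s (delta w) =
             (\<lambda>v. delta (s \<otimes> w) v + complex_of_real (hecke_p q s) * delta w v)"
    by (simp add: *)
qed

lemma (in coxeter_system) hecke_generator_bounded:
  assumes s: "s \<in> S"
  shows "hecke_generator W S q s \<in> bounded_operators (carrier W)"
proof -
  define p where "p = \<bar>hecke_p q s\<bar>"
  define T where "T = hecke_generator W S q s"
  define N where "N f = (\<Sum>\<^sub>\<infinity>w\<in>carrier W. (cmod (f w))\<^sup>2)" for f :: "'w \<Rightarrow> complex"
  have bij: "bij_betw (\<lambda>w. s \<otimes> w) (carrier W) (carrier W)"
  proof (rule bij_betwI[where g = "\<lambda>w. s \<otimes> w"])
    show "s \<otimes> (s \<otimes> w) = w" if "w \<in> carrier W" for w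
      using S_square[OF s] S_closed[OF s] that by (metis l_one m_assoc)
    then show "s \<otimes> (s \<otimes> w) = w" if "w \<in> carrier W" for w
      using that by blast
  qed (use S_closed[OF s] in auto)
  have main: "T f \<in> ell2 (carrier W) \<and> N (T f) \<le> (2 + 2 * p\<^sup>2) * N f"
    if f: "f \<in> ell2 (carrier W)" for f
  proof -
    define g where "g w = 2 * (cmod (f (s \<otimes> w)))\<^sup>2 + 2 * p\<^sup>2 * (cmod (f w))\<^sup>2" for w
    have f1: "(\<lambda>w. (cmod (f w))\<^sup>2) summable_on carrier W"
      using f by (simp add: ell2_def)
    have f2: "(\<lambda>w. (cmod (f (s \<otimes> w)))\<^sup>2) summable_on carrier W"
      using summable_on_reindex_bij_betw[OF bij, of "\<lambda>w. (cmod (f w))\<^sup>2"] f1 by simp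
    have N2: "(\<Sum>\<^sub>\<infinity>w\<in>carrier W. (cmod (f (s \<otimes> w)))\<^sup>2) = N f"
      using infsum_reindex_bij_betw[OF bij, of "\<lambda>w. (cmod (f w))\<^sup>2"] by (simp add: N_def)
    have gs: "g summable_on carrier W"
      unfolding g_def by (intro summable_on_add summable_on_cmult_right f1 f2)
    have Ng: "infsum g (carrier W) = (2 + 2 * p\<^sup>2) * N f"
      unfolding g_def
      by (subst infsum_add) (auto intro!: summable_on_cmult_right f1 f2
          simp: infsum_cmult_right' N2 N_def[symmetric] algebra_simps)
    have le: "(cmod (T f w))\<^sup>2 \<le> g w" if w: "w \<in> carrier W" for w
    proof -
      have "cmod (T f w) \<le> cmod (f (s \<otimes> w)) + p * cmod (f w)"
        using f w unfolding T_def hecke_generator_def p_def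
        by (auto simp: norm_mult intro: order_trans[OF norm_triangle_ineq])
      then have "(cmod (T f w))\<^sup>2 \<le> (cmod (f (s \<otimes> w)) + p * cmod (f w))\<^sup>2"
        by (intro power_mono) auto
      also have "\<dots> \<le> g w"
        using sum_squares_bound[of "cmod (f (s \<otimes> w))" "p * cmod (f w)"]
        by (simp add: g_def power2_sum power_mult_distrib)
      finally show ?thesis .
    qed
    have Ts: "(\<lambda>w. (cmod (T f w))\<^sup>2) summable_on carrier W"
      using summable_on_comparison_test[OF gs le] by simp
    have "N (T f) \<le> infsum g (carrier W)"
      unfolding N_def by (rule infsum_mono[OF Ts gs le])
    moreover have "T f w = 0" if "w \<notin> carrier W" for w
      using f that by (simp add: T_def hecke_generator_def)
    ultimately show ?thesis
      using Ts Ng by (simp add: ell2_def)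
  qed
  have add: "(\<lambda>w. f w + g w) \<in> ell2 (carrier W)"
    if f: "f \<in> ell2 (carrier W)" and g: "g \<in> ell2 (carrier W)" for f g
  proof -
    have "(\<lambda>w. 2 * (cmod (f w))\<^sup>2 + 2 * (cmod (g w))\<^sup>2) summable_on carrier W"
      using f g by (intro summable_on_add summable_on_cmult_right) (auto simp: ell2_def)
    moreover have "(cmod (f w + g w))\<^sup>2 \<le> 2 * (cmod (f w))\<^sup>2 + 2 * (cmod (g w))\<^sup>2" for w
    proof -
      have "(cmod (f w + g w))\<^sup>2 \<le> (cmod (f w) + cmod (g w))\<^sup>2"
        by (intro power_mono norm_triangle_ineq) auto
      then show ?thesis
        using sum_squares_bound[of "cmod (f w)" "cmod (g w)"] by (simp add: power2_sum)
    qed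
    ultimately have "(\<lambda>w. (cmod (f w + g w))\<^sup>2) summable_on carrier W"
      using summable_on_comparison_test by (smt (verit, best) zero_le_power2)
    then show ?thesis
      using f g by (auto simp: ell2_def)
  qed
  have scale: "(\<lambda>w. c * f w) \<in> ell2 (carrier W)" if "f \<in> ell2 (carrier W)" for c f
    using that by (auto simp: ell2_def norm_mult power_mult_distrib intro: summable_on_cmult_right)
  have "\<exists>K. \<forall>f\<in>ell2 (carrier W). ell2_norm (carrier W) (T f) \<le> K * ell2_norm (carrier W) f"
  proof (intro exI ballI)
    fix f assume "f \<in> ell2 (carrier W)"
    then show "ell2_norm (carrier W) (T f) \<le> sqrt (2 + 2 * p\<^sup>2) * ell2_norm (carrier W) f"
      using main[of f] by (simp add: ell2_norm_def N_def flip: real_sqrt_mult)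
  qed
  moreover have "T \<in> extensional (ell2 (carrier W))"
    by (simp add: T_def hecke_generator_def)
  moreover have "T (\<lambda>w. f w + g w) = (\<lambda>w. T f w + T g w)"
    if "f \<in> ell2 (carrier W)" "g \<in> ell2 (carrier W)" for f g
    using that add[OF that] by (simp add: T_def hecke_generator_def fun_eq_iff algebra_simps)
  moreover have "T (\<lambda>w. c * f w) = (\<lambda>w. c * T f w)" if "f \<in> ell2 (carrier W)" for c f
    using that scale[OF that] by (simp add: T_def hecke_generator_def fun_eq_iff algebra_simps)
  ultimately show ?thesis
    unfolding bounded_operators_def T_def[symmetric] PiE_def using main by blast
qed

end

theory Submission
  imports Defs "HOL-Real_Asymp.Real_Asymp"
begin

text \<open>By Rieffel's criterion (\<open>rieffel_criterion\<close>), the seminorm \<open>L(x) = norm [D, x]\<close> induces the weak*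
  topology as soon as its unit ball is totally bounded in norm modulo the scalars. So the task is to
  show that an element \<open>x = \<Sum> c(w) T(w)\<close> of the Hecke algebra with \<open>L(x) \<le> 2\<close> and \<open>c(1) = 0\<close> has small
  norm once finitely many of its coefficients are small (\<open>norm_by_coefficients\<close>).

  This is the argument of Ozawa and Rieffel. The matrix of \<open>[D, x]\<close> arises from that of \<open>x\<close> by
  multiplying the entry at \<open>(u, v)\<close> by \<open>|u| - |v|\<close>. Conversely, far from the diagonal one recovers \<open>x\<close>
  from \<open>[D, x]\<close> by multiplying entries with \<open>1 / (|u| - |v|)\<close>. Multiplication by a function of
  \<open>|u| - |v|\<close> that is a convolution of two square summable functions is bounded by the product of their
  norms; averaging \<open>1 / j\<close> over a long window writes it as such a convolution with small norms, up to
  a summable defect (\<open>schur_avg_recip\<close>, \<open>defect_summable\<close>). Near the diagonal a Haagerup inequality is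
  used: the block of \<open>x\<close> between two spheres has norm at most a constant times
  \<open>\<Sum>k. (\<Sum>|w|=k. |c(w)|\<^sup>2)\<^sup>1\<^sup>/\<^sup>2\<close> (\<open>haagerup\<close>). Since \<open>[D, x]\<close> maps the unit vector at the neutral element to the
  vector with entries \<open>|w| c(w)\<close>, the numbers \<open>k\<^sup>2 (\<Sum>|w|=k. |c(w)|\<^sup>2)\<close> have sum at most \<open>L(x)\<^sup>2\<close>, and
  by the Cauchy-Schwarz inequality large \<open>k\<close> contribute little.

  The Haagerup inequality rests on the geometry of the group. A basis element \<open>T(w)\<close> takes \<open>v\<close> to a
  combination of elements \<open>a b v\<close>, for the reduced factorisations \<open>w = a t b\<close> in which \<open>b\<close> is cancelled
  against \<open>v\<close>, \<open>a\<close> is created, and \<open>t\<close> is a product of pairwise commuting letters on which the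
  deformation acts diagonally (\<open>entry_bound\<close>). With \<open>v = b\<^sup>-\<^sup>1 t g\<close>, for fixed \<open>t\<close> and fixed lengths
  this is a product of three matrices indexed by \<open>(a, b)\<close>, \<open>(b, g)\<close> and \<open>(a, g)\<close>, and the
  inequality is the Cauchy-Schwarz inequality, provided that an element has boundedly many prefixes of
  given length. This is where the absence of induced squares is needed: two prefixes of the same length
  differ by two words that commute letter by letter, and if neither of them consisted of pairwise
  commuting letters then two non-commuting letters of each would form a square (\<open>prefixes_close\<close>).

  The necessary facts on reduced words follow from a solution of the word problem: generators
  act on words, up to exchanges of commuting neighbours, by adding or cancelling a letter, and this
  respects the presentation (\<open>red_unique\<close>). The elementary theory of operators on the sequence space
  and of states is developed as far as it is used; in particular states are bounded on self-adjoint
  elements because \<open>1 - h\<close> is a square if \<open>norm h < 1\<close> (\<open>sqrt_one_minus\<close>).\<close>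

section \<open>The Hilbert space $\ell^2(I)$\<close>

abbreviation L2c :: "('x \<Rightarrow> complex) \<Rightarrow> 'x set \<Rightarrow> real" where
  "L2c f F \<equiv> L2_set (\<lambda>x. cmod (f x)) F"

text \<open>Everything about $\ell^2(I)$ is reduced to finite subsets of \<open>I\<close>, where the
  theory of \<^const>\<open>L2_set\<close> applies: a norm bound is a bound for all finite truncations.\<close>

lemma ell2_normI:
  assumes "\<And>x. x \<notin> I \<Longrightarrow> f x = 0"
    and le: "\<And>F. finite F \<Longrightarrow> F \<subseteq> I \<Longrightarrow> L2c f F \<le> K"
  shows "f \<in> ell2 I" and "ell2_norm I f \<le> K"
proof -
  have K: "0 \<le> K" using le[of "{}"] by simp
  have b: "(\<Sum>x\<in>F. (cmod (f x))\<^sup>2) \<le> K\<^sup>2" if "finite F" "F \<subseteq> I" for F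
  proof -
    have "(L2c f F)\<^sup>2 \<le> K\<^sup>2" using le[OF that] by (intro power_mono) auto
    then show ?thesis by (simp add: L2_set_def sum_nonneg)
  qed
  have s: "(\<lambda>x. (cmod (f x))\<^sup>2) summable_on I"
    by (rule nonneg_bdd_above_summable_on) (auto intro!: bdd_aboveI[of _ "K\<^sup>2"] b)
  then show "f \<in> ell2 I" using assms(1) by (auto simp: ell2_def)
  have "(\<Sum>\<^sub>\<infinity>x\<in>I. (cmod (f x))\<^sup>2) \<le> K\<^sup>2"
    by (rule infsum_le_finite_sums[OF s b])
  then show "ell2_norm I f \<le> K"
    unfolding ell2_norm_def using K by (simp add: real_le_lsqrt)
qed

lemma ell2_summable: "f \<in> ell2 I \<Longrightarrow> (\<lambda>x. (cmod (f x))\<^sup>2) summable_on I"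
  by (simp add: ell2_def)

lemma ell2_outside: "f \<in> ell2 I \<Longrightarrow> x \<notin> I \<Longrightarrow> f x = 0"
  by (simp add: ell2_def)

lemma L2c_le_ell2_norm:
  assumes "f \<in> ell2 I" "finite F" "F \<subseteq> I"
  shows "L2c f F \<le> ell2_norm I f"
  unfolding ell2_norm_def L2_set_def
  by (intro real_sqrt_le_mono finite_sum_le_infsum ell2_summable assms) auto

lemma ell2_norm_nonneg [simp]: "0 \<le> ell2_norm I f"
  by (simp add: ell2_norm_def infsum_nonneg)

lemma ell2_norm_power2: "(ell2_norm I f)\<^sup>2 = (\<Sum>\<^sub>\<infinity>x\<in>I. (cmod (f x))\<^sup>2)"
  by (simp add: ell2_norm_def infsum_nonneg)

lemma cmod_le_ell2_norm:
  assumes "f \<in> ell2 I" "x \<in> I"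
  shows "cmod (f x) \<le> ell2_norm I f"
  using L2c_le_ell2_norm[OF assms(1), of "{x}"] assms(2) by simp

lemma ell2_norm_eq_0: "f \<in> ell2 I \<Longrightarrow> ell2_norm I f = 0 \<Longrightarrow> f = (\<lambda>x. 0)"
  using cmod_le_ell2_norm ell2_outside by fastforce

lemma ell2_zero [simp]: "(\<lambda>x. 0) \<in> ell2 I" and ell2_norm_zero [simp]: "ell2_norm I (\<lambda>x. 0) = 0"
  by (auto simp: ell2_def ell2_norm_def)

lemma ell2_add:
  assumes f: "f \<in> ell2 I" and g: "g \<in> ell2 I"
  shows "(\<lambda>x. f x + g x) \<in> ell2 I"
    and "ell2_norm I (\<lambda>x. f x + g x) \<le> ell2_norm I f + ell2_norm I g"
proof -
  have "L2c (\<lambda>x. f x + g x) F \<le> ell2_norm I f + ell2_norm I g" if F: "finite F" "F \<subseteq> I" for F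
  proof -
    have "L2c (\<lambda>x. f x + g x) F \<le> L2_set (\<lambda>x. cmod (f x) + cmod (g x)) F"
      by (intro L2_set_mono norm_triangle_ineq) auto
    also have "\<dots> \<le> L2c f F + L2c g F" by (rule L2_set_triangle_ineq)
    also have "\<dots> \<le> ell2_norm I f + ell2_norm I g"
      by (intro add_mono L2c_le_ell2_norm f g F)
    finally show ?thesis .
  qed
  note * = ell2_normI[OF _ this]
  show "(\<lambda>x. f x + g x) \<in> ell2 I"
    and "ell2_norm I (\<lambda>x. f x + g x) \<le> ell2_norm I f + ell2_norm I g"
    by (rule *, use f g in \<open>auto simp: ell2_outside\<close>)+
qed

lemma ell2_scale:
  assumes "f \<in> ell2 I"
  shows "(\<lambda>x. c * f x) \<in> ell2 I"
  using assms by (auto simp: ell2_def norm_mult power_mult_distrib intro: summable_on_cmult_right)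

lemma ell2_norm_scale: "ell2_norm I (\<lambda>x. c * f x) = cmod c * ell2_norm I f"
  by (simp add: ell2_norm_def norm_mult power_mult_distrib infsum_cmult_right' real_sqrt_mult)

lemma ell2_diff:
  assumes f: "f \<in> ell2 I" and g: "g \<in> ell2 I"
  shows "(\<lambda>x. f x - g x) \<in> ell2 I"
    and "ell2_norm I (\<lambda>x. f x - g x) \<le> ell2_norm I f + ell2_norm I g"
  using ell2_add[OF f ell2_scale[OF g, of "-1"]] ell2_norm_scale[of I "-1" g] by simp_all

lemma ell2_sum:
  assumes "\<And>i. i \<in> A \<Longrightarrow> f i \<in> ell2 I"
  shows "(\<lambda>x. \<Sum>i\<in>A. f i x) \<in> ell2 I"
  using assms by (induction A rule: infinite_finite_induct) (auto intro: ell2_add)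

definition trunc :: "'x set \<Rightarrow> ('x \<Rightarrow> complex) \<Rightarrow> 'x \<Rightarrow> complex" where
  "trunc F f = (\<lambda>x. if x \<in> F then f x else 0)"

lemma trunc_in_ell2:
  assumes "finite F" "F \<subseteq> I"
  shows "trunc F f \<in> ell2 I"
proof -
  have "(\<lambda>x. (cmod (trunc F f x))\<^sup>2) summable_on I"
    by (rule finite_nonzero_values_imp_summable_on, rule finite_subset[OF _ assms(1)])
       (auto simp: trunc_def)
  then show ?thesis using assms by (auto simp: ell2_def trunc_def)
qed

lemma ell2_norm_trunc:
  assumes "finite F" "F \<subseteq> I"
  shows "ell2_norm I (trunc F f) = L2c f F"
proof -
  have "(\<Sum>\<^sub>\<infinity>x\<in>I. (cmod (trunc F f x))\<^sup>2) = (\<Sum>\<^sub>\<infinity>x\<in>F. (cmod (f x))\<^sup>2)"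
    by (rule infsum_cong_neutral) (use assms in \<open>auto simp: trunc_def\<close>)
  then show ?thesis using assms by (simp add: ell2_norm_def L2_set_def)
qed

lemma trunc_approx:
  assumes f: "f \<in> ell2 I" and e: "0 < e"
  obtains F where "finite F" "F \<subseteq> I" "ell2_norm I (\<lambda>x. f x - trunc F f x) \<le> e"
proof -
  let ?s = "\<lambda>x. (cmod (f x))\<^sup>2"
  obtain F where F: "finite F" "F \<subseteq> I" "dist (sum ?s F) (infsum ?s I) \<le> e\<^sup>2"
    using infsum_finite_approximation[OF ell2_summable[OF f], of "e\<^sup>2"] e by auto
  have "L2c (\<lambda>x. f x - trunc F f x) G \<le> e" if G: "finite G" "G \<subseteq> I" for G
  proof -
    have "(\<Sum>x\<in>G. (cmod (f x - trunc F f x))\<^sup>2) = sum ?s (G - F)"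
      by (rule sum.mono_neutral_cong_right) (use G in \<open>auto simp: trunc_def\<close>)
    also have "\<dots> = sum ?s (F \<union> G) - sum ?s F"
    proof -
      have "F \<union> G - F = G - F" by auto
      then show ?thesis using sum_diff[of "F \<union> G" F ?s] F G by simp
    qed
    also have "\<dots> \<le> infsum ?s I - sum ?s F"
      using finite_sum_le_infsum[OF ell2_summable[OF f], of "F \<union> G"] F G by simp
    also have "\<dots> \<le> e\<^sup>2" using F(3) by (simp add: dist_real_def)
    finally show ?thesis unfolding L2_set_def using e by (simp add: real_le_lsqrt)
  qed
  then have "ell2_norm I (\<lambda>x. f x - trunc F f x) \<le> e"
    by (intro ell2_normI) (use f F in \<open>auto simp: ell2_outside trunc_def\<close>)
  with F show ?thesis using that by blast
qed

subsection \<open>The inner product\<close>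

lemma cnj_mult_self: "cnj z * z = complex_of_real ((cmod z)\<^sup>2)"
  by (metis complex_norm_square mult.commute)

lemma ell2_inner_summable:
  assumes f: "f \<in> ell2 I" and g: "g \<in> ell2 I"
  shows "(\<lambda>x. norm (cnj (f x) * g x)) summable_on I"
    and "cmod (ell2_inner I f g) \<le> ell2_norm I f * ell2_norm I g"
proof -
  have b: "(\<Sum>x\<in>F. norm (cnj (f x) * g x)) \<le> ell2_norm I f * ell2_norm I g"
    if F: "finite F" "F \<subseteq> I" for F
  proof -
    have "(\<Sum>x\<in>F. norm (cnj (f x) * g x)) \<le> L2c f F * L2c g F"
      using L2_set_mult_ineq[of "\<lambda>x. cmod (f x)" "\<lambda>x. cmod (g x)" F] by (simp add: norm_mult)
    also have "\<dots> \<le> ell2_norm I f * ell2_norm I g"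
      by (intro mult_mono L2c_le_ell2_norm f g F) auto
    finally show ?thesis .
  qed
  show s: "(\<lambda>x. norm (cnj (f x) * g x)) summable_on I"
    by (rule nonneg_bdd_above_summable_on)
       (auto intro!: bdd_aboveI[of _ "ell2_norm I f * ell2_norm I g"] b)
  have "cmod (ell2_inner I f g) \<le> (\<Sum>\<^sub>\<infinity>x\<in>I. norm (cnj (f x) * g x))"
    unfolding ell2_inner_def by (rule norm_infsum_bound[OF s])
  also have "\<dots> \<le> ell2_norm I f * ell2_norm I g"
    by (rule infsum_le_finite_sums[OF s b])
  finally show "cmod (ell2_inner I f g) \<le> ell2_norm I f * ell2_norm I g" .
qed

lemma ell2_inner_add_right:
  assumes "f \<in> ell2 I" "g \<in> ell2 I" "h \<in> ell2 I"
  shows "ell2_inner I f (\<lambda>x. g x + h x) = ell2_inner I f g + ell2_inner I f h"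
  unfolding ell2_inner_def distrib_left
  by (rule infsum_add; rule abs_summable_summable; rule ell2_inner_summable; rule assms)

lemma ell2_inner_scale_right: "ell2_inner I f (\<lambda>x. c * g x) = c * ell2_inner I f g"
  unfolding ell2_inner_def by (simp add: mult.left_commute infsum_cmult_right')

lemma ell2_inner_diff_right:
  assumes "f \<in> ell2 I" "g \<in> ell2 I" "h \<in> ell2 I"
  shows "ell2_inner I f (\<lambda>x. g x - h x) = ell2_inner I f g - ell2_inner I f h"
  using ell2_inner_add_right[OF assms(1,2) ell2_scale[OF assms(3), of "-1"]]
    ell2_inner_scale_right[of I f "-1" h] by simp

lemma ell2_inner_cnj: "cnj (ell2_inner I f g) = ell2_inner I g f"
  unfolding ell2_inner_def by (simp add: mult.commute flip: infsum_cnj)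

lemma ell2_inner_sum_right:
  assumes "f \<in> ell2 I" "\<And>i. i \<in> A \<Longrightarrow> g i \<in> ell2 I"
  shows "ell2_inner I f (\<lambda>x. \<Sum>i\<in>A. c i * g i x) = (\<Sum>i\<in>A. c i * ell2_inner I f (g i))"
  using assms(2)
proof (induction A rule: infinite_finite_induct)
  case (insert a A)
  then show ?case
    using assms(1)
    by (simp add: ell2_inner_add_right ell2_sum ell2_scale ell2_inner_scale_right)
qed (auto simp: ell2_inner_def)

lemma ell2_inner_self:
  assumes f: "f \<in> ell2 I"
  shows "ell2_inner I f f = complex_of_real ((ell2_norm I f)\<^sup>2)"
proof -
  have "ell2_inner I f f = (\<Sum>\<^sub>\<infinity>x\<in>I. complex_of_real ((cmod (f x))\<^sup>2))"
    by (simp only: ell2_inner_def cnj_mult_self)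
  then show ?thesis 
    using infsumI[OF has_sum_of_real[OF has_sum_infsum[OF ell2_summable[OF f]]]]
    by (simp only: ell2_norm_power2)
qed

lemma ell2_inner_trunc:
  assumes "finite F" "F \<subseteq> I"
  shows "ell2_inner I (trunc F f) g = (\<Sum>x\<in>F. cnj (f x) * g x)"
proof -
  have "ell2_inner I (trunc F f) g = (\<Sum>\<^sub>\<infinity>x\<in>F. cnj (f x) * g x)"
    unfolding ell2_inner_def
    by (rule infsum_cong_neutral) (use assms in \<open>auto simp: trunc_def\<close>)
  then show ?thesis using assms by simp
qed

lemma ell2_inner_delta:
  assumes "x \<in> I"
  shows "ell2_inner I (delta x) g = g x"
proof -
  have "delta x = trunc {x} (\<lambda>_. 1)" by (auto simp: delta_def trunc_def)
  then show ?thesis using ell2_inner_trunc[of "{x}" I "\<lambda>_. 1" g] assms by simp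
qed

text \<open>Testing against the truncations of the vector itself.\<close>

lemma ell2_normI_dual:
  assumes out: "\<And>x. x \<notin> I \<Longrightarrow> f x = 0" and K: "0 \<le> K"
    and le: "\<And>F g. finite F \<Longrightarrow> F \<subseteq> I \<Longrightarrow> cmod (\<Sum>x\<in>F. cnj (g x) * f x) \<le> K * L2c g F"
  shows "f \<in> ell2 I" and "ell2_norm I f \<le> K"
proof -
  have "L2c f F \<le> K" if F: "finite F" "F \<subseteq> I" for F
  proof -
    have "cmod (\<Sum>x\<in>F. cnj (f x) * f x) = cmod (complex_of_real (\<Sum>x\<in>F. (cmod (f x))\<^sup>2))"
      by (simp only: cnj_mult_self of_real_sum)
    also have "\<dots> = (\<Sum>x\<in>F. (cmod (f x))\<^sup>2)" by (simp only: norm_of_real abs_of_nonneg[OF sum_nonneg] zero_le_power2)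
    also have "\<dots> = (L2c f F)\<^sup>2" by (simp add: L2_set_def sum_nonneg)
    finally have "(L2c f F)\<^sup>2 \<le> K * L2c f F" using le[OF F, of f] by simp
    then show ?thesis using K L2_set_nonneg[of "\<lambda>x. cmod (f x)" F]
      by (metis less_eq_real_def mult_le_cancel_right_pos power2_eq_square)
  qed
  note * = ell2_normI[OF out this]
  show "f \<in> ell2 I" "ell2_norm I f \<le> K" by (rule *, assumption+)+
qed

section \<open>Bounded operators\<close>

lemma bounded_operatorsI:
  assumes "\<And>f. f \<in> ell2 I \<Longrightarrow> T f \<in> ell2 I" "T \<in> extensional (ell2 I)"
    and "\<And>f g. f \<in> ell2 I \<Longrightarrow> g \<in> ell2 I \<Longrightarrow> T (\<lambda>x. f x + g x) = (\<lambda>x. T f x + T g x)"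
    and "\<And>c f. f \<in> ell2 I \<Longrightarrow> T (\<lambda>x. c * f x) = (\<lambda>x. c * T f x)"
    and "\<And>f. f \<in> ell2 I \<Longrightarrow> ell2_norm I (T f) \<le> K * ell2_norm I f"
  shows "T \<in> bounded_operators I"
  unfolding bounded_operators_def using assms by (auto simp: PiE_def intro!: exI[of _ K])

lemma op_ext:
  assumes "T \<in> extensional (ell2 I)" "U \<in> extensional (ell2 I)"
    and "\<And>f. f \<in> ell2 I \<Longrightarrow> T f = U f"
  shows "T = U"
  using assms by (rule extensionalityI)

lemma op_extensional: "T \<in> bounded_operators I \<Longrightarrow> T \<in> extensional (ell2 I)"
  by (auto simp: bounded_operators_def PiE_def)

lemma op_closed: "T \<in> bounded_operators I \<Longrightarrow> f \<in> ell2 I \<Longrightarrow> T f \<in> ell2 I"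
  by (auto simp: bounded_operators_def)

lemma op_add: "T \<in> bounded_operators I \<Longrightarrow> f \<in> ell2 I \<Longrightarrow> g \<in> ell2 I \<Longrightarrow>
    T (\<lambda>x. f x + g x) = (\<lambda>x. T f x + T g x)"
  by (auto simp: bounded_operators_def)

lemma op_scale: "T \<in> bounded_operators I \<Longrightarrow> f \<in> ell2 I \<Longrightarrow> T (\<lambda>x. c * f x) = (\<lambda>x. c * T f x)"
  by (auto simp: bounded_operators_def)

lemma op_diff:
  assumes "T \<in> bounded_operators I" "f \<in> ell2 I" "g \<in> ell2 I"
  shows "T (\<lambda>x. f x - g x) = (\<lambda>x. T f x - T g x)"
  using op_add[OF assms(1,2) ell2_scale[OF assms(3), of "-1"]] op_scale[OF assms(1,3), of "-1"]
  by simp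

lemma op_zero: "T \<in> bounded_operators I \<Longrightarrow> T (\<lambda>x. 0) = (\<lambda>x. 0)"
  using op_scale[of T I "\<lambda>x. 0" 0] by simp

lemma op_sum:
  assumes T: "T \<in> bounded_operators I" and f: "\<And>i. i \<in> A \<Longrightarrow> f i \<in> ell2 I"
  shows "T (\<lambda>x. \<Sum>i\<in>A. c i * f i x) = (\<lambda>x. \<Sum>i\<in>A. c i * T (f i) x)"
  using f
proof (induction A rule: infinite_finite_induct)
  case (insert a A)
  then show ?case
    using op_add[OF T ell2_scale[of "f a" I "c a"] ell2_sum[of A "\<lambda>i x. c i * f i x" I]]
      op_scale[OF T] by (simp add: ell2_scale)
qed (auto simp: op_zero[OF T])

lemma op_norm_le:
  assumes K: "0 \<le> K" and le: "\<And>f. f \<in> ell2 I \<Longrightarrow> ell2_norm I (T f) \<le> K * ell2_norm I f"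
  shows "operator_norm I T \<le> K"
  unfolding operator_norm_def
proof (rule cSUP_least)
  show "{f \<in> ell2 I. ell2_norm I f \<le> 1} \<noteq> {}" by (auto intro!: exI[of _ "\<lambda>x. 0"])
  fix f assume "f \<in> {f \<in> ell2 I. ell2_norm I f \<le> 1}"
  then show "ell2_norm I (T f) \<le> K"
    using le[of f] K mult_left_mono[of "ell2_norm I f" 1 K] by auto
qed

lemma op_norm_bound:
  assumes T: "T \<in> bounded_operators I" and f: "f \<in> ell2 I"
  shows "ell2_norm I (T f) \<le> operator_norm I T * ell2_norm I f"
    and "0 \<le> operator_norm I T"
proof -
  obtain K where K: "\<And>f. f \<in> ell2 I \<Longrightarrow> ell2_norm I (T f) \<le> K * ell2_norm I f"
    using T unfolding bounded_operators_def by blast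
  have bdd: "bdd_above ((\<lambda>f. ell2_norm I (T f)) ` {f \<in> ell2 I. ell2_norm I f \<le> 1})"
  proof (rule bdd_aboveI2)
    fix f assume f: "f \<in> {f \<in> ell2 I. ell2_norm I f \<le> 1}"
    have "ell2_norm I (T f) \<le> K * ell2_norm I f" using K f by simp
    also have "\<dots> \<le> \<bar>K\<bar> * 1" using f by (intro mult_mono) auto
    finally show "ell2_norm I (T f) \<le> \<bar>K\<bar>" by simp
  qed
  have up: "ell2_norm I (T g) \<le> operator_norm I T" if "g \<in> ell2 I" "ell2_norm I g \<le> 1" for g
    unfolding operator_norm_def by (rule cSUP_upper[OF _ bdd]) (use that in auto)
  show "0 \<le> operator_norm I T" using up[of "\<lambda>x. 0"] op_zero[OF T] by simp
  show "ell2_norm I (T f) \<le> operator_norm I T * ell2_norm I f"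
  proof (cases "ell2_norm I f = 0")
    case True
    then have "f = (\<lambda>x. 0)" using f ell2_norm_eq_0 by blast
    then show ?thesis using op_zero[OF T] by simp
  next
    case False
    define c where "c = complex_of_real (1 / ell2_norm I f)"
    have c: "cmod c * ell2_norm I f = 1" using False by (simp add: c_def norm_divide)
    have "ell2_norm I (T (\<lambda>x. c * f x)) \<le> operator_norm I T"
      using up[OF ell2_scale[OF f, of c]] c by (simp add: ell2_norm_scale)
    then have "cmod c * ell2_norm I (T f) \<le> operator_norm I T"
      by (simp add: op_scale[OF T f] ell2_norm_scale)
    then show ?thesis using False
      by (simp add: c_def norm_divide divide_simps less_le mult.commute split: if_splits)
  qed
qed

lemma op_norm_nonneg: "T \<in> bounded_operators I \<Longrightarrow> 0 \<le> operator_norm I T"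
  using op_norm_bound(2)[of T I "\<lambda>x. 0"] by simp

lemma trunc_eq_sum: "finite F \<Longrightarrow> trunc F f = (\<lambda>y. \<Sum>x\<in>F. f x * delta x y)"
  by (auto simp: trunc_def delta_def fun_eq_iff if_distrib sum.delta' cong: if_cong)

lemma op_trunc:
  assumes "T \<in> bounded_operators I" "finite F" "F \<subseteq> I"
  shows "T (trunc F f) = (\<lambda>y. \<Sum>x\<in>F. f x * T (delta x) y)"
  unfolding trunc_eq_sum[OF assms(2)] using assms
  by (intro op_sum) (auto intro: delta_in_ell2)

text \<open>Truncations are dense, so that estimates and equations of operators only have to be checked
  for finite sums of matrix entries.\<close>

lemma op_norm_leI_form:
  assumes T: "T \<in> bounded_operators I" and K: "0 \<le> K"
    and le: "\<And>F G f g. finite F \<Longrightarrow> F \<subseteq> I \<Longrightarrow> finite G \<Longrightarrow> G \<subseteq> I \<Longrightarrow>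
      cmod (\<Sum>x\<in>F. \<Sum>y\<in>G. cnj (f x) * g y * T (delta y) x) \<le> K * L2c f F * L2c g G"
  shows "operator_norm I T \<le> K"
proof (rule op_norm_le[OF K])
  have trunc: "ell2_norm I (T (trunc G g)) \<le> K * L2c g G" if G: "finite G" "G \<subseteq> I" for G g
  proof (rule ell2_normI_dual)
    show "T (trunc G g) x = 0" if "x \<notin> I" for x
      using op_closed[OF T trunc_in_ell2[OF G]] that by (rule ell2_outside)
    show "0 \<le> K * L2c g G" using K by simp
    fix F f assume F: "finite F" "F \<subseteq> I"
    have "(\<Sum>x\<in>F. cnj (f x) * T (trunc G g) x)
        = (\<Sum>x\<in>F. \<Sum>y\<in>G. cnj (f x) * g y * T (delta y) x)"
      by (simp add: op_trunc[OF T G] sum_distrib_left mult.assoc)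
    then show "cmod (\<Sum>x\<in>F. cnj (f x) * T (trunc G g) x) \<le> K * L2c g G * L2c f F"
      using le[OF F G, of f g] by (simp add: mult_ac)
  qed
  fix f assume f: "f \<in> ell2 I"
  have "ell2_norm I (T f) \<le> K * ell2_norm I f + e" if e: "0 < e" for e
  proof -
    define d where "d = e / (operator_norm I T + 1)"
    have p: "0 < operator_norm I T + 1" using op_norm_nonneg[OF T] by simp
    obtain F where F: "finite F" "F \<subseteq> I" "ell2_norm I (\<lambda>x. f x - trunc F f x) \<le> d"
      using trunc_approx[OF f, of d] e p by (auto simp: d_def)
    have cf: "trunc F f \<in> ell2 I" using F trunc_in_ell2 by blast
    have "T f = (\<lambda>x. T (trunc F f) x + T (\<lambda>x. f x - trunc F f x) x)"
      using op_diff[OF T f cf] by auto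
    then have "ell2_norm I (T f) \<le> ell2_norm I (T (trunc F f)) + ell2_norm I (T (\<lambda>x. f x - trunc F f x))"
      using ell2_add(2)[OF op_closed[OF T cf] op_closed[OF T ell2_diff(1)[OF f cf]]] by simp
    also have "\<dots> \<le> K * ell2_norm I f + operator_norm I T * d"
    proof (rule add_mono)
      show "ell2_norm I (T (trunc F f)) \<le> K * ell2_norm I f"
        using trunc[OF F(1,2), of f] L2c_le_ell2_norm[OF f F(1,2)] K
        by (meson mult_left_mono order_trans)
      have "ell2_norm I (T (\<lambda>x. f x - trunc F f x)) \<le> operator_norm I T * ell2_norm I (\<lambda>x. f x - trunc F f x)"
        by (rule op_norm_bound(1)[OF T ell2_diff(1)[OF f cf]])
      also have "\<dots> \<le> operator_norm I T * d" by (intro mult_left_mono F op_norm_nonneg T)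
      finally show "ell2_norm I (T (\<lambda>x. f x - trunc F f x)) \<le> operator_norm I T * d" .
    qed
    also have "operator_norm I T * d \<le> e"
      using p e op_norm_nonneg[OF T] by (simp add: d_def divide_simps)
    finally show ?thesis by simp
  qed
  then show "ell2_norm I (T f) \<le> K * ell2_norm I f" by (rule field_le_epsilon)
qed


lemma op_eqI_delta:
  assumes T: "T \<in> bounded_operators I" and U: "U \<in> bounded_operators I"
    and eq: "\<And>x. x \<in> I \<Longrightarrow> T (delta x) = U (delta x)"
  shows "T = U"
proof (rule op_ext[OF op_extensional[OF T] op_extensional[OF U]])
  fix f assume f: "f \<in> ell2 I"
  let ?c = "operator_norm I T + operator_norm I U + 1"
  have c: "0 < ?c" using op_norm_nonneg[OF T] op_norm_nonneg[OF U] by simp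
  have TU: "(\<lambda>x. T f x - U f x) \<in> ell2 I"
    by (intro ell2_diff op_closed[OF T] op_closed[OF U] f)
  have "ell2_norm I (\<lambda>x. T f x - U f x) \<le> 0 + e" if e: "0 < e" for e
  proof -
    obtain F where F: "finite F" "F \<subseteq> I" "ell2_norm I (\<lambda>x. f x - trunc F f x) \<le> e / ?c"
      using trunc_approx[OF f, of "e / ?c"] e c by auto
    let ?g = "trunc F f" and ?h = "\<lambda>x. f x - trunc F f x"
    have g: "?g \<in> ell2 I" using F trunc_in_ell2 by blast
    have h: "?h \<in> ell2 I" by (rule ell2_diff(1)[OF f g])
    have "T ?g = U ?g"
      using F eq by (simp add: op_trunc[OF T] op_trunc[OF U] subset_iff)
    then have "(\<lambda>x. T f x - U f x) = (\<lambda>x. T ?h x - U ?h x)"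
      by (simp add: op_diff[OF T f g] op_diff[OF U f g])
    then have "ell2_norm I (\<lambda>x. T f x - U f x) \<le> ell2_norm I (T ?h) + ell2_norm I (U ?h)"
      using ell2_diff(2)[OF op_closed[OF T h] op_closed[OF U h]] by simp
    also have "\<dots> \<le> operator_norm I T * ell2_norm I ?h + operator_norm I U * ell2_norm I ?h"
      by (intro add_mono op_norm_bound T U h)
    also have "\<dots> \<le> ?c * ell2_norm I ?h" by (simp add: algebra_simps)
    also have "\<dots> \<le> ?c * (e / ?c)" by (intro mult_left_mono F) (use c in simp)
    finally show ?thesis using c by simp
  qed
  then have "ell2_norm I (\<lambda>x. T f x - U f x) \<le> 0" by (rule field_le_epsilon)
  then have "(\<lambda>x. T f x - U f x) = (\<lambda>x. 0)"
    using ell2_norm_eq_0[OF TU] ell2_norm_nonneg[of I] by (metis antisym)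
  then show "T f = U f" by (auto simp: fun_eq_iff)
qed

subsection \<open>Adjoints\<close>

text \<open>The matrix entries of the adjoint are forced, and they define a bounded operator by duality:
  the norm of a vector is the supremum of its pairings with unit vectors.\<close>

definition matrix_adjoint :: "'x set \<Rightarrow> 'x operator \<Rightarrow> 'x operator" where
  "matrix_adjoint I T =
     (\<lambda>f\<in>ell2 I. \<lambda>x. if x \<in> I then ell2_inner I (T (delta x)) f else 0)"

lemma matrix_adjoint_bound:
  assumes T: "T \<in> bounded_operators I" and f: "f \<in> ell2 I"
  shows "matrix_adjoint I T f \<in> ell2 I"
    and "ell2_norm I (matrix_adjoint I T f) \<le> operator_norm I T * ell2_norm I f"
proof -
  let ?K = "operator_norm I T * ell2_norm I f"
  have out: "matrix_adjoint I T f x = 0" if "x \<notin> I" for x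
    using that f by (simp add: matrix_adjoint_def)
  have K: "0 \<le> ?K" using op_norm_nonneg[OF T] by simp
  have le: "cmod (\<Sum>x\<in>F. cnj (g x) * matrix_adjoint I T f x) \<le> ?K * L2c g F"
    if F: "finite F" "F \<subseteq> I" for F g
  proof -
    have Tg: "T (trunc F g) \<in> ell2 I" by (intro op_closed[OF T] trunc_in_ell2 F)
    have "(\<Sum>x\<in>F. cnj (g x) * matrix_adjoint I T f x)
        = (\<Sum>x\<in>F. cnj (g x * ell2_inner I f (T (delta x))))"
      using F f by (intro sum.cong) (auto simp: matrix_adjoint_def ell2_inner_cnj)
    also have "\<dots> = cnj (ell2_inner I f (T (trunc F g)))"
      using F ell2_inner_sum_right[OF f, of F "\<lambda>x. T (delta x)" g]
      by (simp add: op_trunc[OF T] op_closed[OF T] delta_in_ell2 subset_iff)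
    finally have "cmod (\<Sum>x\<in>F. cnj (g x) * matrix_adjoint I T f x)
        \<le> ell2_norm I f * ell2_norm I (T (trunc F g))"
      using ell2_inner_summable(2)[OF f Tg] by simp
    also have "\<dots> \<le> ell2_norm I f * (operator_norm I T * ell2_norm I (trunc F g))"
      by (intro mult_left_mono op_norm_bound T trunc_in_ell2 F) auto
    finally show ?thesis by (simp add: ell2_norm_trunc[OF F] mult_ac)
  qed
  note * = ell2_normI_dual[OF out K le]
  show "matrix_adjoint I T f \<in> ell2 I" "ell2_norm I (matrix_adjoint I T f) \<le> ?K"
    by (rule *, assumption+)+
qed

lemma matrix_adjoint_bounded:
  assumes T: "T \<in> bounded_operators I"
  shows "matrix_adjoint I T \<in> bounded_operators I"
proof (rule bounded_operatorsI[where K = "operator_norm I T"])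
  have d: "T (delta x) \<in> ell2 I" if "x \<in> I" for x
    by (intro op_closed[OF T] delta_in_ell2 that)
  show "matrix_adjoint I T (\<lambda>x. f x + g x) = (\<lambda>x. matrix_adjoint I T f x + matrix_adjoint I T g x)"
    if "f \<in> ell2 I" "g \<in> ell2 I" for f g
    using that by (simp add: matrix_adjoint_def ell2_add fun_eq_iff ell2_inner_add_right d)
  show "matrix_adjoint I T (\<lambda>x. c * f x) = (\<lambda>x. c * matrix_adjoint I T f x)"
    if "f \<in> ell2 I" for c f
    using that by (simp add: matrix_adjoint_def ell2_scale fun_eq_iff ell2_inner_scale_right)
  show "matrix_adjoint I T \<in> extensional (ell2 I)" by (simp add: matrix_adjoint_def)
qed (auto intro: matrix_adjoint_bound[OF T])

lemma matrix_adjoint_inner: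
  assumes T: "T \<in> bounded_operators I" and f: "f \<in> ell2 I" and g: "g \<in> ell2 I"
  shows "ell2_inner I (matrix_adjoint I T f) g = ell2_inner I f (T g)"
proof -
  let ?A = "matrix_adjoint I T"
  have Af: "?A f \<in> ell2 I" by (rule matrix_adjoint_bound(1)[OF T f])
  have fin: "ell2_inner I (?A f) (trunc F g) = ell2_inner I f (T (trunc F g))"
    if F: "finite F" "F \<subseteq> I" for F
  proof -
    have "ell2_inner I f (T (trunc F g)) = (\<Sum>x\<in>F. g x * ell2_inner I f (T (delta x)))"
      using F ell2_inner_sum_right[OF f, of F "\<lambda>x. T (delta x)" g]
      by (simp add: op_trunc[OF T] op_closed[OF T] delta_in_ell2 subset_iff)
    also have "\<dots> = (\<Sum>x\<in>F. cnj (cnj (g x) * ?A f x))"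
      using F f by (intro sum.cong) (auto simp: matrix_adjoint_def ell2_inner_cnj)
    also have "\<dots> = cnj (ell2_inner I (trunc F g) (?A f))"
      by (simp add: ell2_inner_trunc[OF F])
    finally show ?thesis by (simp add: ell2_inner_cnj)
  qed
  let ?c = "ell2_norm I (?A f) + ell2_norm I f * operator_norm I T + 1"
  have c: "0 < ?c" using op_norm_nonneg[OF T]
    by (simp add: add_nonneg_pos)
  have "cmod (ell2_inner I (?A f) g - ell2_inner I f (T g)) \<le> 0 + e" if e: "0 < e" for e
  proof -
    obtain F where F: "finite F" "F \<subseteq> I" "ell2_norm I (\<lambda>x. g x - trunc F g x) \<le> e / ?c"
      using trunc_approx[OF g, of "e / ?c"] e c by auto
    let ?h = "\<lambda>x. g x - trunc F g x"
    have t: "trunc F g \<in> ell2 I" using F trunc_in_ell2 by blast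
    have h: "?h \<in> ell2 I" by (rule ell2_diff(1)[OF g t])
    have "ell2_inner I (?A f) g - ell2_inner I f (T g)
        = ell2_inner I (?A f) ?h - ell2_inner I f (T ?h)"
      using fin[OF F(1,2)]
      by (simp add: ell2_inner_diff_right Af g t f op_diff[OF T g t] op_closed[OF T])
    also have "cmod \<dots> \<le> cmod (ell2_inner I (?A f) ?h) + cmod (ell2_inner I f (T ?h))"
      by (rule norm_triangle_ineq4)
    also have "\<dots> \<le> ell2_norm I (?A f) * ell2_norm I ?h
        + ell2_norm I f * (operator_norm I T * ell2_norm I ?h)"
      by (intro add_mono order_trans[OF ell2_inner_summable(2)] mult_left_mono op_norm_bound
          Af h f op_closed[OF T] T) auto
    also have "\<dots> \<le> ?c * ell2_norm I ?h" by (simp add: algebra_simps)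
    also have "\<dots> \<le> ?c * (e / ?c)" by (intro mult_left_mono F) (use c in simp)
    finally show ?thesis using c by simp
  qed
  then have "cmod (ell2_inner I (?A f) g - ell2_inner I f (T g)) \<le> 0" by (rule field_le_epsilon)
  then show ?thesis by simp
qed

lemma adjoint_operatorI:
  assumes T': "T' \<in> bounded_operators I"
    and eq: "\<And>f g. f \<in> ell2 I \<Longrightarrow> g \<in> ell2 I \<Longrightarrow> ell2_inner I (T' f) g = ell2_inner I f (T g)"
  shows "adjoint_operator I T = T'"
  unfolding adjoint_operator_def
proof (rule the_equality)
  fix U assume U: "U \<in> bounded_operators I \<and>
    (\<forall>f\<in>ell2 I. \<forall>g\<in>ell2 I. ell2_inner I (U f) g = ell2_inner I f (T g))"
  show "U = T'"
  proof (rule op_ext)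
    show "U f = T' f" if f: "f \<in> ell2 I" for f
    proof
      fix x
      have c: "cnj (V x) = ell2_inner I V (delta x)" if "x \<in> I" for V
        using ell2_inner_delta[OF that, of V] ell2_inner_cnj by metis
      show "U f x = T' f x"
      proof (cases "x \<in> I")
        case True
        then have "cnj (U f x) = cnj (T' f x)"
          using U eq[OF f] f by (simp add: c delta_in_ell2)
        then show ?thesis by simp
      next
        case False
        then show ?thesis using U T' f ell2_outside op_closed by metis
      qed
    qed
  qed (use U T' op_extensional in auto)
qed (use assms in auto)

lemma adjoint_operator_eq:
  "T \<in> bounded_operators I \<Longrightarrow> adjoint_operator I T = matrix_adjoint I T"
  by (intro adjoint_operatorI matrix_adjoint_bounded matrix_adjoint_inner)

lemma adjoint_bounded: "T \<in> bounded_operators I \<Longrightarrow> adjoint_operator I T \<in> bounded_operators I"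
  by (simp add: adjoint_operator_eq matrix_adjoint_bounded)

lemma adjoint_inner:
  "T \<in> bounded_operators I \<Longrightarrow> f \<in> ell2 I \<Longrightarrow> g \<in> ell2 I \<Longrightarrow>
    ell2_inner I (adjoint_operator I T f) g = ell2_inner I f (T g)"
  by (simp add: adjoint_operator_eq matrix_adjoint_inner)

lemma adjoint_inner_right:
  assumes "T \<in> bounded_operators I" "f \<in> ell2 I" "g \<in> ell2 I"
  shows "ell2_inner I f (adjoint_operator I T g) = ell2_inner I (T f) g"
  using adjoint_inner[OF assms(1,3,2)] ell2_inner_cnj by metis

lemma op_norm_adjoint_le:
  assumes T: "T \<in> bounded_operators I"
  shows "operator_norm I (adjoint_operator I T) \<le> operator_norm I T"
  unfolding adjoint_operator_eq[OF T]
  by (rule op_norm_le[OF op_norm_nonneg[OF T] matrix_adjoint_bound(2)[OF T]])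

section \<open>Normed algebras, completeness and closures\<close>

lemma complex_ring_simps [simp]:
  "carrier complex_ring = UNIV" "mult complex_ring = (*)" "one complex_ring = 1"
  "zero complex_ring = 0" "add complex_ring = (+)"
  by (simp_all add: complex_ring_def)

lemma cring_complex_ring: "cring complex_ring"
proof (rule cringI)
  show "abelian_group complex_ring"
    by (rule abelian_groupI) (auto simp: algebra_simps intro: exI[of _ "- x" for x])
  show "comm_monoid complex_ring"
    by (rule comm_monoidI) (auto simp: algebra_simps)
qed (auto simp: algebra_simps)

text \<open>The part of the structure of a C*-algebra that carries its metric. It is split off because the
  completeness of an algebra can only be discussed once its norm is known to define a metric.\<close>

locale normed_algebra = alg?: ring A + Module.module complex_ring A
  for A :: "('b, 'z) star_algebra_scheme" (structure) +
  assumes norm_nonneg: "a \<in> carrier A \<Longrightarrow> 0 \<le> nrm A a"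
    and norm_eq_0: "a \<in> carrier A \<Longrightarrow> nrm A a = 0 \<longleftrightarrow> a = \<zero>"
    and norm_smult: "a \<in> carrier A \<Longrightarrow> nrm A (c \<odot> a) = cmod c * nrm A a"
    and norm_triangle: "\<lbrakk>a \<in> carrier A; b \<in> carrier A\<rbrakk> \<Longrightarrow> nrm A (a \<oplus> b) \<le> nrm A a + nrm A b"
begin

text \<open>The laws of the ring of scalars share their names with those of the algebra, which are
  therefore given names of their own.\<close>

lemmas A_a_assoc = alg.a_assoc and A_a_comm = alg.a_comm and A_a_lcomm = alg.a_lcomm
  and A_a_closed = alg.a_closed and A_minus_closed = alg.minus_closed and A_minus_add = alg.minus_add
  and A_minus_minus = alg.minus_minus and A_r_neg1 = alg.r_neg1 and A_r_neg2 = alg.r_neg2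
  and A_r_neg = alg.r_neg and A_l_neg = alg.l_neg and A_r_distr = alg.r_distr
  and A_l_distr = alg.l_distr and A_r_minus = alg.r_minus and A_l_minus = alg.l_minus
  and A_m_assoc = alg.m_assoc and A_one_closed = alg.one_closed and A_zero_closed = alg.zero_closed
  and A_m_closed = alg.m_closed and A_l_one = alg.l_one and A_r_one = alg.r_one
  and A_a_inv_closed = alg.a_inv_closed and A_l_zero = alg.l_zero and A_r_zero = alg.r_zero
  and A_l_null = alg.l_null and A_r_null = alg.r_null and A_minus_equality = alg.minus_equality

lemma smult_cl [simp, intro]: "a \<in> carrier A \<Longrightarrow> c \<odot> a \<in> carrier A"
  using smult_closed[of c a] by simp

lemma smult_distr: 
  "a \<in> carrier A \<Longrightarrow> (c + d) \<odot> a = c \<odot> a \<oplus> d \<odot> a"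
  "a \<in> carrier A \<Longrightarrow> b \<in> carrier A \<Longrightarrow> c \<odot> (a \<oplus> b) = c \<odot> a \<oplus> c \<odot> b"
  "a \<in> carrier A \<Longrightarrow> (c * d) \<odot> a = c \<odot> (d \<odot> a)"
  "a \<in> carrier A \<Longrightarrow> 1 \<odot> a = a"
  using smult_l_distr[of c d a] smult_r_distr[of c a b] smult_assoc1[of c d a] smult_one[of a]
  by simp_all

lemma smult_zero_left: "a \<in> carrier A \<Longrightarrow> 0 \<odot> a = \<zero>"
  using norm_smult[of a 0] norm_eq_0[of "0 \<odot> a"] by simp

lemma uminus_smult: 
  assumes a: "a \<in> carrier A" shows "\<ominus> a = (-1) \<odot> a"
proof (rule A_minus_equality)
  have "(-1) \<odot> a \<oplus> a = ((-1) + 1) \<odot> a" by (simp only: smult_distr(1,4) a)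
  then show "(-1) \<odot> a \<oplus> a = \<zero>" using a by (simp add: smult_zero_left)
qed (use a in auto)

lemma minus_smult: "a \<in> carrier A \<Longrightarrow> b \<in> carrier A \<Longrightarrow> a \<ominus> b = a \<oplus> (-1) \<odot> b"
  by (simp add: a_minus_def uminus_smult)

lemma smult_minus_right:
  "a \<in> carrier A \<Longrightarrow> b \<in> carrier A \<Longrightarrow> c \<odot> (a \<ominus> b) = c \<odot> a \<ominus> c \<odot> b"
  by (simp add: minus_smult smult_distr(2) flip: smult_distr(3))

lemma nrm_minus_commute:
  assumes "a \<in> carrier A" "b \<in> carrier A"
  shows "nrm A (a \<ominus> b) = nrm A (b \<ominus> a)"
proof -
  have "b \<ominus> a = \<ominus> (a \<ominus> b)"
    using assms by (simp add: a_minus_def A_minus_add A_a_comm)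
  then show ?thesis using assms norm_smult[of "a \<ominus> b" "-1"] by (simp add: uminus_smult)
qed

lemma minus_decompose:
  assumes "a \<in> carrier A" "b \<in> carrier A" "c \<in> carrier A"
  shows "a \<ominus> c = (a \<ominus> b) \<oplus> (b \<ominus> c)"
  using assms by (simp add: a_minus_def A_a_assoc A_r_neg1)

lemma norm_triangle_minus:
  assumes "a \<in> carrier A" "b \<in> carrier A" "c \<in> carrier A"
  shows "nrm A (a \<ominus> c) \<le> nrm A (a \<ominus> b) + nrm A (b \<ominus> c)"
  unfolding minus_decompose[OF assms] using assms by (intro norm_triangle) auto

lemma norm_minus_le:
  "a \<in> carrier A \<Longrightarrow> b \<in> carrier A \<Longrightarrow> nrm A (a \<ominus> b) \<le> nrm A a + nrm A b"
  using norm_triangle[of a "\<ominus> b"] norm_smult[of b "-1"] by (simp add: a_minus_def uminus_smult)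

lemma nrm_zero: "nrm A \<zero> = 0"
  using norm_eq_0[of \<zero>] by simp

lemma minus_eq_zero: "a \<in> carrier A \<Longrightarrow> b \<in> carrier A \<Longrightarrow> a \<ominus> b = \<zero> \<longleftrightarrow> a = b"
  by (metis a_minus_def A_a_inv_closed A_minus_equality A_minus_minus A_r_neg)

lemma metric: "Metric_space (carrier A) (nrm_dist A)"
proof
  fix a b c
  show "0 \<le> nrm_dist A a b" by (simp add: nrm_dist_def norm_nonneg)
  show "nrm_dist A a b = nrm_dist A b a" by (simp add: nrm_dist_def nrm_minus_commute)
  show "nrm_dist A a b = 0 \<longleftrightarrow> a = b" if "a \<in> carrier A" "b \<in> carrier A"
    using that by (simp add: nrm_dist_def norm_eq_0 minus_eq_zero)
  show "nrm_dist A a c \<le> nrm_dist A a b + nrm_dist A b c"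
    if "a \<in> carrier A" "b \<in> carrier A" "c \<in> carrier A"
    using that by (simp add: nrm_dist_def norm_triangle_minus)
qed

lemma topology_closure_of:
  assumes "X \<subseteq> carrier A"
  shows "nrm_topology A closure_of X
    = {a \<in> carrier A. \<forall>e>0. \<exists>b\<in>X. nrm A (a \<ominus> b) < e}"
  unfolding nrm_topology_def Metric_space.metric_closure_of[OF metric]
  using assms by (auto simp: Metric_space.in_mball[OF metric] nrm_dist_def subset_iff)

lemma mcomplete_iff_Cauchy:
  "Metric_space.mcomplete (carrier A) (nrm_dist A) \<longleftrightarrow>
    (\<forall>\<sigma> :: nat \<Rightarrow> 'b. (\<forall>n. \<sigma> n \<in> carrier A) \<and> (\<forall>e>0. \<exists>N. \<forall>m n. N \<le> m \<longrightarrow> N \<le> n \<longrightarrow> nrm A (\<sigma> m \<ominus> \<sigma> n) < e)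
      \<longrightarrow> (\<exists>a\<in>carrier A. \<forall>e>0. \<exists>N. \<forall>n\<ge>N. nrm A (\<sigma> n \<ominus> a) < e))"
proof -
  have c: "Metric_space.MCauchy (carrier A) (nrm_dist A) \<sigma> \<longleftrightarrow> (\<forall>n. \<sigma> n \<in> carrier A) \<and>
      (\<forall>e>0. \<exists>N. \<forall>m n. N \<le> m \<longrightarrow> N \<le> n \<longrightarrow> nrm A (\<sigma> m \<ominus> \<sigma> n) < e)" for \<sigma>
    by (auto simp: Metric_space.MCauchy_def[OF metric] nrm_dist_def image_subset_iff)
  have l: "limitin (Metric_space.mtopology (carrier A) (nrm_dist A)) \<sigma> a sequentially \<longleftrightarrow>
      a \<in> carrier A \<and> (\<forall>e>0. \<exists>N. \<forall>n\<ge>N. nrm A (\<sigma> n \<ominus> a) < e)"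
    if "\<forall>n. \<sigma> n \<in> carrier A" for \<sigma> :: "nat \<Rightarrow> 'b" and a
    using that by (auto simp: Metric_space.limit_metric_sequentially[OF metric] nrm_dist_def)
  show ?thesis unfolding Metric_space.mcomplete_def[OF metric] c
    by (rule all_cong1, rule imp_cong[OF refl], elim conjE, simp add: l Bex_def)
qed

end

sublocale unital_cstar_algebra \<subseteq> normed_algebra
  by unfold_locales (auto simp: nrm_nonneg nrm_eq_0 nrm_smult nrm_triangle)

section \<open>The C*-algebra of bounded operators\<close>

lemma operator_algebra_simps [simp]:
  "carrier (operator_algebra I) = bounded_operators I"
  "mult (operator_algebra I) = compose (ell2 I)"
  "one (operator_algebra I) = (\<lambda>f\<in>ell2 I. f)"
  "zero (operator_algebra I) = (\<lambda>f\<in>ell2 I. (\<lambda>x. 0))"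
  "add (operator_algebra I) = (\<lambda>T U. \<lambda>f\<in>ell2 I. (\<lambda>x. T f x + U f x))"
  "smult (operator_algebra I) = (\<lambda>c T. \<lambda>f\<in>ell2 I. (\<lambda>x. c * T f x))"
  "invol (operator_algebra I) = adjoint_operator I"
  "nrm (operator_algebra I) = operator_norm I"
  by (simp_all add: operator_algebra_def)

lemma op_plus_closed:
  assumes T: "T \<in> bounded_operators I" and U: "U \<in> bounded_operators I"
  shows "(\<lambda>f\<in>ell2 I. (\<lambda>x. T f x + U f x)) \<in> bounded_operators I"
    and "operator_norm I (\<lambda>f\<in>ell2 I. (\<lambda>x. T f x + U f x)) \<le> operator_norm I T + operator_norm I U"
proof -
  have le: "ell2_norm I ((\<lambda>f\<in>ell2 I. (\<lambda>x. T f x + U f x)) f)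
      \<le> (operator_norm I T + operator_norm I U) * ell2_norm I f" if f: "f \<in> ell2 I" for f
    using ell2_add(2)[OF op_closed[OF T f] op_closed[OF U f]] op_norm_bound(1)[OF T f]
      op_norm_bound(1)[OF U f] f by (simp add: algebra_simps)
  show "(\<lambda>f\<in>ell2 I. (\<lambda>x. T f x + U f x)) \<in> bounded_operators I"
    by (rule bounded_operatorsI[OF _ restrict_extensional _ _ le])
       (auto simp: ell2_add ell2_scale op_closed[OF T] op_closed[OF U] op_add[OF T] op_add[OF U]
          op_scale[OF T] op_scale[OF U] algebra_simps)
  show "operator_norm I (\<lambda>f\<in>ell2 I. (\<lambda>x. T f x + U f x)) \<le> operator_norm I T + operator_norm I U"
    by (rule op_norm_le[OF _ le]) (simp_all add: op_norm_nonneg T U)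
qed

lemma op_smult_closed:
  assumes T: "T \<in> bounded_operators I"
  shows "(\<lambda>f\<in>ell2 I. (\<lambda>x. c * T f x)) \<in> bounded_operators I"
proof (rule bounded_operatorsI[where K = "cmod c * operator_norm I T"])
  show "(\<lambda>f\<in>ell2 I. (\<lambda>x. c * T f x)) \<in> extensional (ell2 I)" by simp
  show "ell2_norm I ((\<lambda>f\<in>ell2 I. (\<lambda>x. c * T f x)) f) \<le> cmod c * operator_norm I T * ell2_norm I f"
    if f: "f \<in> ell2 I" for f
    using f op_norm_bound(1)[OF T f] by (simp add: ell2_norm_scale mult_left_mono mult.assoc)
qed (auto simp: ell2_add ell2_scale op_closed[OF T] op_add[OF T] op_scale[OF T] algebra_simps)

lemma op_norm_smult:
  assumes T: "T \<in> bounded_operators I"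
  shows "operator_norm I (\<lambda>f\<in>ell2 I. (\<lambda>x. c * T f x)) = cmod c * operator_norm I T"
proof -
  have le: "operator_norm I (\<lambda>f\<in>ell2 I. (\<lambda>x. d * V f x)) \<le> cmod d * operator_norm I V"
    if V: "V \<in> bounded_operators I" for d V
    by (rule op_norm_le)
       (use op_norm_bound(1)[OF V] op_norm_nonneg[OF V] in
         \<open>auto simp: ell2_norm_scale mult_left_mono mult.assoc\<close>)
  show ?thesis
  proof (cases "c = 0")
    case True
    then show ?thesis using le[OF T, of c] op_norm_nonneg[OF op_smult_closed[OF T, of c]] by simp
  next
    case False
    let ?V = "\<lambda>f\<in>ell2 I. (\<lambda>x. c * T f x)"
    have "(\<lambda>f\<in>ell2 I. (\<lambda>x. inverse c * ?V f x)) = T"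
      by (rule op_ext) (use False T op_extensional in \<open>auto simp: fun_eq_iff\<close>)
    then have "operator_norm I T \<le> cmod (inverse c) * operator_norm I ?V"
      using le[OF op_smult_closed[OF T, of c], of "inverse c"] by simp
    then have "cmod c * operator_norm I T \<le> cmod c * (cmod (inverse c) * operator_norm I ?V)"
      by (rule mult_left_mono) simp
    also have "\<dots> = operator_norm I ?V" using False by (simp only: norm_inverse) simp
    finally have "cmod c * operator_norm I T \<le> operator_norm I ?V" .
    with le[OF T, of c] show ?thesis by simp
  qed
qed

lemma op_compose_closed:
  assumes T: "T \<in> bounded_operators I" and U: "U \<in> bounded_operators I"
  shows "compose (ell2 I) T U \<in> bounded_operators I"
    and "operator_norm I (compose (ell2 I) T U) \<le> operator_norm I T * operator_norm I U"
proof -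
  have le: "ell2_norm I (compose (ell2 I) T U f) \<le> (operator_norm I T * operator_norm I U) * ell2_norm I f"
    if f: "f \<in> ell2 I" for f
  proof -
    have "ell2_norm I (compose (ell2 I) T U f) \<le> operator_norm I T * ell2_norm I (U f)"
      using f op_norm_bound(1)[OF T op_closed[OF U f]] by (simp add: compose_def)
    also have "\<dots> \<le> operator_norm I T * (operator_norm I U * ell2_norm I f)"
      by (rule mult_left_mono[OF op_norm_bound(1)[OF U f] op_norm_nonneg[OF T]])
    finally show ?thesis by (simp add: mult_ac)
  qed
  show "compose (ell2 I) T U \<in> bounded_operators I"
    by (rule bounded_operatorsI[OF _ compose_extensional _ _ le])
       (auto simp: compose_def ell2_add ell2_scale op_closed[OF T] op_closed[OF U] op_add[OF T]
          op_add[OF U] op_scale[OF T] op_scale[OF U])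
  show "operator_norm I (compose (ell2 I) T U) \<le> operator_norm I T * operator_norm I U"
    by (rule op_norm_le[OF _ le]) (simp_all add: op_norm_nonneg T U)
qed

lemma op_one_closed: "(\<lambda>f\<in>ell2 I. f) \<in> bounded_operators I"
  by (rule bounded_operatorsI[where K = 1]) (auto simp: ell2_add ell2_scale)

lemma op_zero_closed: "(\<lambda>f\<in>ell2 I. (\<lambda>x. 0)) \<in> bounded_operators I"
  by (rule bounded_operatorsI[where K = 0]) (auto simp: ell2_add ell2_scale)

lemma abelian_group_operator_algebra: "abelian_group (operator_algebra I)"
proof (rule abelian_groupI)
  fix T assume "T \<in> carrier (operator_algebra I)"
  then have T: "T \<in> bounded_operators I" by simp
  show "\<exists>U\<in>carrier (operator_algebra I). U \<oplus>\<^bsub>operator_algebra I\<^esub> T = \<zero>\<^bsub>operator_algebra I\<^esub>"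
    by (rule bexI[of _ "\<lambda>f\<in>ell2 I. (\<lambda>x. (-1) * T f x)"])
       (auto simp: op_smult_closed[OF T, of "-1", simplified] intro!: op_ext)
  show "\<zero>\<^bsub>operator_algebra I\<^esub> \<oplus>\<^bsub>operator_algebra I\<^esub> T = T"
    using op_extensional[OF T] by (auto intro!: op_ext)
qed (auto simp: op_plus_closed op_zero_closed add_ac intro!: op_ext)

lemma ring_operator_algebra: "ring (operator_algebra I)"
proof (rule ringI[OF abelian_group_operator_algebra])
  show "monoid (operator_algebra I)"
    by (rule monoidI)
       (auto simp: op_compose_closed(1)[unfolded compose_def] op_one_closed compose_def op_closed
          op_extensional intro!: op_ext)
qed (auto simp: compose_def op_add op_closed intro!: op_ext)

lemma normed_algebra_operator_algebra: "normed_algebra (operator_algebra I)"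
proof -
  interpret R: ring "operator_algebra I" by (rule ring_operator_algebra)
  have mod: "Module.module complex_ring (operator_algebra I)"
    by (rule moduleI[OF cring_complex_ring abelian_group_operator_algebra])
       (auto simp: op_smult_closed algebra_simps op_extensional intro!: op_ext)
  have nrm0: "T = (\<lambda>f\<in>ell2 I. (\<lambda>x. 0))" if T: "T \<in> bounded_operators I" "operator_norm I T = 0" for T
  proof (rule op_ext)
    show "T f = (\<lambda>f\<in>ell2 I. \<lambda>x. 0) f" if f: "f \<in> ell2 I" for f
    proof -
      have "ell2_norm I (T f) \<le> 0" using op_norm_bound(1)[OF T(1) f] T(2) by simp
      then have "T f = (\<lambda>x. 0)"
        using ell2_norm_eq_0[OF op_closed[OF T(1) f]] ell2_norm_nonneg[of I "T f"] by linarith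
      then show ?thesis using f by simp
    qed
  qed (use T op_extensional in auto)
  have "operator_norm I (\<lambda>f\<in>ell2 I. (\<lambda>x. 0)) \<le> 0" by (rule op_norm_le) auto
  then have nrm00: "operator_norm I (\<lambda>f\<in>ell2 I. (\<lambda>x. 0)) = 0"
    using op_norm_nonneg[OF op_zero_closed, of I] by linarith
  show ?thesis
    by (intro normed_algebra.intro ring_operator_algebra mod normed_algebra_axioms.intro)
       (auto simp: op_norm_nonneg nrm00 nrm0 op_norm_smult op_plus_closed(2))
qed

lemma op_minus:
  assumes "T \<in> bounded_operators I" "U \<in> bounded_operators I"
  shows "T \<ominus>\<^bsub>operator_algebra I\<^esub> U = (\<lambda>f\<in>ell2 I. (\<lambda>x. T f x - U f x))"
proof -
  interpret normed_algebra "operator_algebra I" by (rule normed_algebra_operator_algebra)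
  show ?thesis using minus_smult[of T U] assms by (auto intro!: op_ext)
qed

lemma op_minus_closed:
  assumes "T \<in> bounded_operators I" "U \<in> bounded_operators I"
  shows "(\<lambda>f\<in>ell2 I. (\<lambda>x. T f x - U f x)) \<in> bounded_operators I"
proof -
  interpret normed_algebra "operator_algebra I" by (rule normed_algebra_operator_algebra)
  have "T \<ominus>\<^bsub>operator_algebra I\<^esub> U \<in> carrier (operator_algebra I)"
    using assms by (intro A_minus_closed) simp_all
  then show ?thesis by (simp only: op_minus[OF assms] operator_algebra_simps)
qed

text \<open>A Cauchy sequence of operators converges entrywise, and the limit inherits the norm estimates
  because these only concern finitely many coordinates at a time.\<close>

lemma operator_algebra_complete:
  fixes \<sigma> :: "nat \<Rightarrow> 'x operator"
  assumes \<sigma>: "\<And>n. \<sigma> n \<in> bounded_operators I"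
    and cauchy: "\<And>e. 0 < e \<Longrightarrow>
      \<exists>N. \<forall>m n. N \<le> m \<longrightarrow> N \<le> n \<longrightarrow> operator_norm I (\<lambda>f\<in>ell2 I. (\<lambda>x. \<sigma> m f x - \<sigma> n f x)) < e"
  shows "\<exists>T\<in>bounded_operators I. \<forall>e>0. \<exists>N. \<forall>n\<ge>N.
    operator_norm I (\<lambda>f\<in>ell2 I. (\<lambda>x. \<sigma> n f x - T f x)) < e"
proof -
  have d: "(\<lambda>f\<in>ell2 I. (\<lambda>x. \<sigma> m f x - \<sigma> n f x)) \<in> bounded_operators I" for m n
    using op_minus_closed[OF \<sigma> \<sigma>] .
  have est: "\<exists>N. \<forall>m\<ge>N. \<forall>n\<ge>N. \<forall>f\<in>ell2 I. ell2_norm I (\<lambda>x. \<sigma> m f x - \<sigma> n f x) \<le> e * ell2_norm I f"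
    if e: "0 < e" for e
  proof -
    obtain N where N: "operator_norm I (\<lambda>f\<in>ell2 I. (\<lambda>x. \<sigma> m f x - \<sigma> n f x)) < e"
      if "N \<le> m" "N \<le> n" for m n
      using cauchy[OF e] by blast
    have "ell2_norm I (\<lambda>x. \<sigma> m f x - \<sigma> n f x) \<le> e * ell2_norm I f"
      if "N \<le> m" "N \<le> n" "f \<in> ell2 I" for m n f
      using op_norm_bound(1)[OF d that(3), of m n] that(3)
        mult_right_mono[OF less_imp_le[OF N[OF that(1,2)]], of "ell2_norm I f"] by simp
    then show ?thesis by blast
  qed
  have conv: "convergent (\<lambda>n. \<sigma> n f x)" if f: "f \<in> ell2 I" for f x
  proof (cases "x \<in> I")
    case True
    have "Cauchy (\<lambda>n. \<sigma> n f x)"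
    proof (rule metric_CauchyI)
      fix e :: real assume e: "0 < e"
      define e' where "e' = e / (ell2_norm I f + 1)"
      have p: "0 < ell2_norm I f + 1" by (simp add: add_nonneg_pos)
      have e': "0 < e'" using e p by (simp add: e'_def)
      obtain N where N: "\<And>m n. N \<le> m \<Longrightarrow> N \<le> n \<Longrightarrow> ell2_norm I (\<lambda>x. \<sigma> m f x - \<sigma> n f x) \<le> e' * ell2_norm I f"
        using est[OF e'] f by blast
      have "e' * ell2_norm I f < e' * (ell2_norm I f + 1)" using e' by simp
      also have "\<dots> = e" using p by (simp add: e'_def)
      finally have lt: "e' * ell2_norm I f < e" .
      have "dist (\<sigma> m f x) (\<sigma> n f x) < e" if "N \<le> m" "N \<le> n" for m n
        using cmod_le_ell2_norm[OF ell2_diff(1)[OF op_closed[OF \<sigma> f] op_closed[OF \<sigma> f]] True, of m n]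
          N[OF that] lt by (simp add: dist_norm)
      then show "\<exists>N. \<forall>m\<ge>N. \<forall>n\<ge>N. dist (\<sigma> m f x) (\<sigma> n f x) < e" by blast
    qed
    then show ?thesis by (rule Cauchy_convergent)
  next
    case False
    then have "\<sigma> n f x = 0" for n using ell2_outside[OF op_closed[OF \<sigma> f] False] by simp
    then show ?thesis by (simp add: convergent_const)
  qed
  define T where "T = (\<lambda>f\<in>ell2 I. (\<lambda>x. lim (\<lambda>n. \<sigma> n f x)))"
  have lim: "(\<lambda>n. \<sigma> n f x) \<longlonglongrightarrow> T f x" if "f \<in> ell2 I" for f x
    using conv[OF that, of x] that by (simp add: T_def convergent_LIMSEQ_iff)
  have close: "\<exists>N. \<forall>n\<ge>N. \<forall>f\<in>ell2 I. (\<lambda>x. \<sigma> n f x - T f x) \<in> ell2 I \<and>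
      ell2_norm I (\<lambda>x. \<sigma> n f x - T f x) \<le> e * ell2_norm I f" if e: "0 < e" for e
  proof -
    obtain N where N: "\<And>m n f. N \<le> m \<Longrightarrow> N \<le> n \<Longrightarrow> f \<in> ell2 I \<Longrightarrow>
        ell2_norm I (\<lambda>x. \<sigma> m f x - \<sigma> n f x) \<le> e * ell2_norm I f"
      using est[OF e] by blast
    have "(\<lambda>x. \<sigma> n f x - T f x) \<in> ell2 I \<and> ell2_norm I (\<lambda>x. \<sigma> n f x - T f x) \<le> e * ell2_norm I f"
      if n: "N \<le> n" and f: "f \<in> ell2 I" for n f
    proof -
      have le: "L2c (\<lambda>x. \<sigma> n f x - T f x) F \<le> e * ell2_norm I f" if F: "finite F" "F \<subseteq> I" for F
      proof (rule LIMSEQ_le_const2)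
        show "(\<lambda>m. L2c (\<lambda>x. \<sigma> n f x - \<sigma> m f x) F) \<longlonglongrightarrow> L2c (\<lambda>x. \<sigma> n f x - T f x) F"
          unfolding L2_set_def by (intro tendsto_intros lim[OF f])
        have "L2c (\<lambda>x. \<sigma> n f x - \<sigma> m f x) F \<le> e * ell2_norm I f" if "N \<le> m" for m
          using L2c_le_ell2_norm[OF ell2_diff(1)[OF op_closed[OF \<sigma> f] op_closed[OF \<sigma> f]] F, of n m]
            N[OF n that f] by simp
        then show "\<exists>N. \<forall>m\<ge>N. L2c (\<lambda>x. \<sigma> n f x - \<sigma> m f x) F \<le> e * ell2_norm I f" by blast
      qed
      have out: "\<sigma> n f x - T f x = 0" if "x \<notin> I" for x
      proof -
        have z: "\<sigma> k f x = 0" for k using ell2_outside[OF op_closed[OF \<sigma> f] that] by simp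
        then have "T f x = 0" using LIMSEQ_unique[OF lim[OF f, of x]] by simp
        then show ?thesis using z by simp
      qed
      show ?thesis by (rule conjI; rule ell2_normI[OF out le])
    qed
    then show ?thesis by blast
  qed
  obtain N1 where N1: "\<And>f. f \<in> ell2 I \<Longrightarrow> (\<lambda>x. \<sigma> N1 f x - T f x) \<in> ell2 I"
    "\<And>f. f \<in> ell2 I \<Longrightarrow> ell2_norm I (\<lambda>x. \<sigma> N1 f x - T f x) \<le> 1 * ell2_norm I f"
    using close[of 1] by fastforce
  have Teq: "T f = (\<lambda>x. \<sigma> N1 f x - (\<sigma> N1 f x - T f x))" for f by simp
  have T: "T \<in> bounded_operators I"
  proof (rule bounded_operatorsI[where K = "operator_norm I (\<sigma> N1) + 1"])
    fix f assume f: "f \<in> ell2 I"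
    show "T f \<in> ell2 I" by (subst Teq, intro ell2_diff(1) op_closed[OF \<sigma>] f N1)
    have "ell2_norm I (T f) \<le> ell2_norm I (\<sigma> N1 f) + ell2_norm I (\<lambda>x. \<sigma> N1 f x - T f x)"
      by (subst Teq, rule ell2_diff(2)[OF op_closed[OF \<sigma> f] N1(1)[OF f]])
    then show "ell2_norm I (T f) \<le> (operator_norm I (\<sigma> N1) + 1) * ell2_norm I f"
      using op_norm_bound(1)[OF \<sigma> f, of N1] N1(2)[OF f] by (simp add: algebra_simps)
    show "T (\<lambda>x. f x + g x) = (\<lambda>x. T f x + T g x)" if g: "g \<in> ell2 I" for g
    proof
      fix x
      have "(\<lambda>n. \<sigma> n (\<lambda>x. f x + g x) x) \<longlonglongrightarrow> T f x + T g x"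
        unfolding op_add[OF \<sigma> f g] by (intro tendsto_add lim f g)
      then show "T (\<lambda>x. f x + g x) x = T f x + T g x"
        using lim[OF ell2_add(1)[OF f g]] LIMSEQ_unique by blast
    qed
    show "T (\<lambda>x. c * f x) = (\<lambda>x. c * T f x)" for c
    proof
      fix x
      have "(\<lambda>n. \<sigma> n (\<lambda>x. c * f x) x) \<longlonglongrightarrow> c * T f x"
        unfolding op_scale[OF \<sigma> f] by (intro tendsto_mult_left lim f)
      then show "T (\<lambda>x. c * f x) x = c * T f x"
        using lim[OF ell2_scale[OF f]] LIMSEQ_unique by blast
    qed
  qed (simp add: T_def)
  have "\<exists>N. \<forall>n\<ge>N. operator_norm I (\<lambda>f\<in>ell2 I. (\<lambda>x. \<sigma> n f x - T f x)) < e" if e: "0 < e" for e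
  proof -
    obtain N where N: "\<And>n f. N \<le> n \<Longrightarrow> f \<in> ell2 I \<Longrightarrow>
        ell2_norm I (\<lambda>x. \<sigma> n f x - T f x) \<le> (e / 2) * ell2_norm I f"
      using close[of "e / 2"] e by auto
    have "operator_norm I (\<lambda>f\<in>ell2 I. (\<lambda>x. \<sigma> n f x - T f x)) \<le> e / 2" if "N \<le> n" for n
      by (rule op_norm_le) (use e N[OF that] in auto)
    then show ?thesis using e by (intro exI[of _ N]) fastforce
  qed
  with T show ?thesis by blast
qed

theorem cstar_operator_algebra: "unital_cstar_algebra (operator_algebra I)"
proof -
  interpret normed_algebra "operator_algebra I" by (rule normed_algebra_operator_algebra)
  note adj = adjoint_operatorI[symmetric]
  have cstar: "operator_norm I (compose (ell2 I) (adjoint_operator I T) T) = (operator_norm I T)\<^sup>2"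
    if T: "T \<in> bounded_operators I" for T
  proof (rule antisym)
    have A: "adjoint_operator I T \<in> bounded_operators I" by (rule adjoint_bounded[OF T])
    show "operator_norm I (compose (ell2 I) (adjoint_operator I T) T) \<le> (operator_norm I T)\<^sup>2"
      using op_compose_closed(2)[OF A T]
        mult_right_mono[OF op_norm_adjoint_le[OF T] op_norm_nonneg[OF T]] by (simp add: power2_eq_square)
    let ?K = "operator_norm I (compose (ell2 I) (adjoint_operator I T) T)"
    have C: "compose (ell2 I) (adjoint_operator I T) T \<in> bounded_operators I"
      by (rule op_compose_closed(1)[OF A T])
    have "operator_norm I T \<le> sqrt ?K"
    proof (rule op_norm_le)
      show "0 \<le> sqrt ?K" using op_norm_nonneg[OF C] by simp
      fix f assume f: "f \<in> ell2 I"
      have "complex_of_real ((ell2_norm I (T f))\<^sup>2) = ell2_inner I (adjoint_operator I T (T f)) f"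
        by (simp add: ell2_inner_self[OF op_closed[OF T f]] adjoint_inner[OF T op_closed[OF T f] f])
      then have "(ell2_norm I (T f))\<^sup>2 = cmod (ell2_inner I (adjoint_operator I T (T f)) f)"
        by (metis abs_power2 norm_of_real)
      also have "\<dots> \<le> ell2_norm I (adjoint_operator I T (T f)) * ell2_norm I f"
        by (intro ell2_inner_summable(2) op_closed[OF A] op_closed[OF T] f)
      also have "\<dots> \<le> (?K * ell2_norm I f) * ell2_norm I f"
        using op_norm_bound(1)[OF C f] f by (intro mult_right_mono) (simp_all add: compose_def)
      also have "\<dots> = (sqrt ?K * ell2_norm I f)\<^sup>2"
        using op_norm_nonneg[OF C] by (simp add: power_mult_distrib power2_eq_square)
      finally show "ell2_norm I (T f) \<le> sqrt ?K * ell2_norm I f"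
        by (rule power2_le_imp_le) (simp add: op_norm_nonneg[OF C])
    qed
    then show "(operator_norm I T)\<^sup>2 \<le> ?K"
      using op_norm_nonneg[OF T] op_norm_nonneg[OF C] by (simp add: sqrt_ge_absD)
  qed
  show ?thesis
  proof (intro unital_cstar_algebra.intro unital_cstar_algebra_axioms.intro)
    show "Metric_space.mcomplete (carrier (operator_algebra I)) (nrm_dist (operator_algebra I))"
    proof (rule mcomplete_iff_Cauchy[THEN iffD2], intro allI impI, elim conjE)
      fix \<sigma> :: "nat \<Rightarrow> _" assume \<sigma>: "\<forall>n. \<sigma> n \<in> carrier (operator_algebra I)"
        and c: "\<forall>e>0. \<exists>N. \<forall>m n. N \<le> m \<longrightarrow> N \<le> n \<longrightarrow>
          nrm (operator_algebra I) (\<sigma> m \<ominus>\<^bsub>operator_algebra I\<^esub> \<sigma> n) < e"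
      have "\<exists>T\<in>bounded_operators I. \<forall>e>0. \<exists>N. \<forall>n\<ge>N.
          operator_norm I (\<lambda>f\<in>ell2 I. (\<lambda>x. \<sigma> n f x - T f x)) < e"
        by (rule operator_algebra_complete) (use \<sigma> c in \<open>auto simp: op_minus\<close>)
      then show "\<exists>a\<in>carrier (operator_algebra I). \<forall>e>0. \<exists>N. \<forall>n\<ge>N.
          nrm (operator_algebra I) (\<sigma> n \<ominus>\<^bsub>operator_algebra I\<^esub> a) < e"
        using \<sigma> by (auto simp: op_minus)
    qed
    show "Module.module complex_ring (operator_algebra I)" by unfold_locales
    show "ring (operator_algebra I)" by unfold_locales
  next
    fix T assume "T \<in> carrier (operator_algebra I)"
    then have T: "T \<in> bounded_operators I" by simp
    then show "invol (operator_algebra I) (invol (operator_algebra I) T) = T"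
      by (auto intro!: adjoint_operatorI simp: adjoint_bounded adjoint_inner_right)
    show "invol (operator_algebra I) (c \<odot>\<^bsub>operator_algebra I\<^esub> T)
        = cnj c \<odot>\<^bsub>operator_algebra I\<^esub> invol (operator_algebra I) T" for c
      using T by (auto intro!: adjoint_operatorI op_smult_closed adjoint_bounded
          simp: adjoint_inner ell2_inner_scale_right)
        (metis adjoint_inner complex_cnj_cnj complex_cnj_mult ell2_inner_cnj ell2_inner_scale_right)
  next
    fix T U assume "T \<in> carrier (operator_algebra I)" "U \<in> carrier (operator_algebra I)"
    then have T: "T \<in> bounded_operators I" and U: "U \<in> bounded_operators I" by simp_all
    note TA = adjoint_bounded[OF T] and UA = adjoint_bounded[OF U]
    have l: "ell2_inner I (\<lambda>x. f x + g x) h = ell2_inner I f h + ell2_inner I g h"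
      if "f \<in> ell2 I" "g \<in> ell2 I" "h \<in> ell2 I" for f g h
      using ell2_inner_add_right[OF that(3,1,2)] ell2_inner_cnj complex_cnj_add by metis
    show "invol (operator_algebra I) (T \<oplus>\<^bsub>operator_algebra I\<^esub> U)
        = invol (operator_algebra I) T \<oplus>\<^bsub>operator_algebra I\<^esub> invol (operator_algebra I) U"
      by (auto intro!: adjoint_operatorI op_plus_closed TA UA
          simp: l op_closed[OF TA] op_closed[OF UA] op_closed[OF T] op_closed[OF U]
            ell2_inner_add_right adjoint_inner[OF T] adjoint_inner[OF U])
    show "invol (operator_algebra I) (T \<otimes>\<^bsub>operator_algebra I\<^esub> U)
        = invol (operator_algebra I) U \<otimes>\<^bsub>operator_algebra I\<^esub> invol (operator_algebra I) T"
      by (auto intro!: adjoint_operatorI simp: op_compose_closed(1)[OF UA TA, unfolded compose_def]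
          compose_def op_closed[OF TA] op_closed[OF U] adjoint_inner[OF T] adjoint_inner[OF U])
    show "(c \<odot>\<^bsub>operator_algebra I\<^esub> T) \<otimes>\<^bsub>operator_algebra I\<^esub> U
        = c \<odot>\<^bsub>operator_algebra I\<^esub> (T \<otimes>\<^bsub>operator_algebra I\<^esub> U)" for c
      by (auto intro!: op_ext simp: compose_def op_closed[OF U])
    show "T \<otimes>\<^bsub>operator_algebra I\<^esub> (c \<odot>\<^bsub>operator_algebra I\<^esub> U)
        = c \<odot>\<^bsub>operator_algebra I\<^esub> (T \<otimes>\<^bsub>operator_algebra I\<^esub> U)" for c
      by (auto intro!: op_ext simp: compose_def op_closed[OF U] ell2_scale op_scale[OF T])
    show "nrm (operator_algebra I) (T \<otimes>\<^bsub>operator_algebra I\<^esub> U)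
        \<le> nrm (operator_algebra I) T * nrm (operator_algebra I) U"
      using op_compose_closed(2)[OF T U] by simp
  qed (auto simp: cstar adjoint_bounded norm_nonneg[simplified] norm_eq_0[simplified]
       norm_smult[simplified] norm_triangle[simplified] op_norm_nonneg op_norm_smult op_plus_closed(2))
qed


section \<open>Closures of *-subalgebras\<close>

context unital_cstar_algebra
begin

lemma Cauchy_limit:
  fixes \<sigma> :: "nat \<Rightarrow> 'b"
  assumes \<sigma>: "\<And>n. \<sigma> n \<in> carrier A"
    and c: "\<forall>e>0. \<exists>N. \<forall>m n. N \<le> m \<longrightarrow> N \<le> n \<longrightarrow> nrm A (\<sigma> m \<ominus> \<sigma> n) < e"
  obtains a where "a \<in> carrier A" "\<And>e. 0 < e \<Longrightarrow> \<exists>N. \<forall>n\<ge>N. nrm A (\<sigma> n \<ominus> a) < e"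
proof -
  have "(\<forall>n. \<sigma> n \<in> carrier A) \<and>
      (\<forall>e>0. \<exists>N. \<forall>m n. N \<le> m \<longrightarrow> N \<le> n \<longrightarrow> nrm A (\<sigma> m \<ominus> \<sigma> n) < e)"
    by (intro conjI allI \<sigma> c)
  from complete[unfolded mcomplete_iff_Cauchy, THEN spec, THEN mp, OF this]
  show ?thesis using that by (elim bexE) simp
qed

lemma norm_invol:
  assumes "a \<in> carrier A" shows "nrm A (invol A a) = nrm A a"
proof -
  have le: "nrm A b \<le> nrm A (invol A b)" if b: "b \<in> carrier A" for b
  proof (cases "nrm A b = 0")
    case True
    then show ?thesis using nrm_nonneg[OF invol_closed[OF b]] by simp
  next
    case False
    then have pos: "0 < nrm A b" using nrm_nonneg[OF b] by simp
    have "nrm A b * nrm A b \<le> nrm A (invol A b) * nrm A b"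
      using nrm_mult[OF invol_closed[OF b] b] cstar_identity[OF b] by (simp add: power2_eq_square)
    then show ?thesis using pos by simp
  qed
  show ?thesis using le[OF assms] le[OF invol_closed[OF assms]] invol_invol[OF assms] by simp
qed

text \<open>The operations are continuous, so the closure of a *-subalgebra is closed under them. It is
  complete because a limit of elements that are close to \<open>H\<close> is close to \<open>H\<close>.\<close>

theorem cstar_closure:
  assumes H: "H \<subseteq> carrier A" and H_one: "\<one> \<in> H"
    and H_add: "\<And>a b. a \<in> H \<Longrightarrow> b \<in> H \<Longrightarrow> a \<oplus> b \<in> H"
    and H_mult: "\<And>a b. a \<in> H \<Longrightarrow> b \<in> H \<Longrightarrow> a \<otimes> b \<in> H"
    and H_smult: "\<And>c a. a \<in> H \<Longrightarrow> c \<odot> a \<in> H"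
    and H_invol: "\<And>a. a \<in> H \<Longrightarrow> invol A a \<in> H"
  shows "unital_cstar_algebra (A\<lparr>carrier := nrm_topology A closure_of H\<rparr>)"
proof -
  define C where "C = nrm_topology A closure_of H"
  have C_iff: "a \<in> C \<longleftrightarrow> a \<in> carrier A \<and> (\<forall>e>0. \<exists>b\<in>H. nrm A (a \<ominus> b) < e)" for a
    unfolding C_def topology_closure_of[OF H] by simp
  have CA: "a \<in> carrier A" if "a \<in> C" for a using that C_iff by blast
  have HA: "a \<in> carrier A" if "a \<in> H" for a using that H by blast
  have HC: "a \<in> C" if a: "a \<in> H" for a
    unfolding C_iff using HA[OF a] a nrm_zero minus_eq_zero[of a a] by (metis order_refl)
  have approx: "\<exists>b\<in>H. nrm A (a \<ominus> b) < e" if "a \<in> C" "0 < e" for a e using that C_iff by blast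
  have C_add: "a \<oplus> b \<in> C" if a: "a \<in> C" and b: "b \<in> C" for a b
  proof -
    have "\<exists>c\<in>H. nrm A ((a \<oplus> b) \<ominus> c) < e" if e: "0 < e" for e
    proof -
      obtain a' b' where a': "a' \<in> H" "nrm A (a \<ominus> a') < e / 2" and b': "b' \<in> H" "nrm A (b \<ominus> b') < e / 2"
        using approx[OF a, of "e / 2"] approx[OF b, of "e / 2"] e by auto
      note c = CA[OF a] CA[OF b] HA[OF a'(1)] HA[OF b'(1)]
      have "(a \<oplus> b) \<ominus> (a' \<oplus> b') = (a \<ominus> a') \<oplus> (b \<ominus> b')"
        using c by (simp add: minus_smult smult_distr(2) A_a_assoc A_a_comm A_a_lcomm)
      then have "nrm A ((a \<oplus> b) \<ominus> (a' \<oplus> b')) < e"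
        using c norm_triangle[of "a \<ominus> a'" "b \<ominus> b'"] a'(2) b'(2) by (simp add: A_minus_closed)
      then show ?thesis using H_add[OF a'(1) b'(1)] by blast
    qed
    then show ?thesis using CA a b C_iff by auto
  qed
  have C_smult: "c \<odot> a \<in> C" if a: "a \<in> C" for c a
  proof -
    have "\<exists>b\<in>H. nrm A (c \<odot> a \<ominus> b) < e" if e: "0 < e" for e
    proof -
      have p: "0 < cmod c + 1" by (simp add: add_nonneg_pos)
      obtain a' where a': "a' \<in> H" "nrm A (a \<ominus> a') < e / (cmod c + 1)"
        using approx[OF a, of "e / (cmod c + 1)"] e p by auto
      have "nrm A (c \<odot> a \<ominus> c \<odot> a') = cmod c * nrm A (a \<ominus> a')"
        using CA[OF a] HA[OF a'(1)] by (simp add: norm_smult A_minus_closed flip: smult_minus_right)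
      also have "\<dots> \<le> (cmod c + 1) * nrm A (a \<ominus> a')"
        using norm_nonneg[of "a \<ominus> a'"] CA[OF a] HA[OF a'(1)]
        by (intro mult_right_mono) (auto simp: A_minus_closed)
      also have "\<dots> < e" using a'(2) p by (simp add: field_simps)
      finally show ?thesis using H_smult[OF a'(1)] by blast
    qed
    then show ?thesis using CA[OF a] C_iff by auto
  qed
  have C_mult: "a \<otimes> b \<in> C" if a: "a \<in> C" and b: "b \<in> C" for a b
  proof -
    have "\<exists>c\<in>H. nrm A ((a \<otimes> b) \<ominus> c) < e" if e: "0 < e" for e
    proof -
      have na: "0 < nrm A a + 1" and nb: "0 < nrm A b + 2"
        using nrm_nonneg[OF CA[OF a]] nrm_nonneg[OF CA[OF b]] by auto
      obtain b' where b': "b' \<in> H" "nrm A (b \<ominus> b') < min 1 (e / 2 / (nrm A a + 1))"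
        using approx[OF b, of "min 1 (e / 2 / (nrm A a + 1))"] e na by auto
      obtain a' where a': "a' \<in> H" "nrm A (a \<ominus> a') < e / 2 / (nrm A b + 2)"
        using approx[OF a, of "e / 2 / (nrm A b + 2)"] e nb by auto
      note c = CA[OF a] CA[OF b] HA[OF a'(1)] HA[OF b'(1)]
      note d = A_minus_closed[OF c(1) c(3)] A_minus_closed[OF c(2) c(4)]
      have "nrm A b' \<le> nrm A b + nrm A (b \<ominus> b')"
      proof -
        have "b' = b \<ominus> (b \<ominus> b')"
          using c by (simp add: a_minus_def A_minus_add A_minus_minus A_r_neg A_r_neg1 A_r_neg2 A_a_assoc A_a_comm A_a_lcomm)
        then show ?thesis using norm_minus_le[OF c(2) d(2)] by simp
      qed
      then have b2: "nrm A b' \<le> nrm A b + 2" using b'(2) by simp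
      have eq: "(a \<otimes> b) \<ominus> (a' \<otimes> b') = (a \<otimes> (b \<ominus> b')) \<oplus> ((a \<ominus> a') \<otimes> b')"
        using c by (simp add: a_minus_def A_r_distr A_l_distr A_r_minus A_l_minus A_a_assoc A_r_neg1)
      have "nrm A ((a \<otimes> b) \<ominus> (a' \<otimes> b'))
          \<le> nrm A a * nrm A (b \<ominus> b') + nrm A (a \<ominus> a') * nrm A b'"
        unfolding eq using c d
        by (intro order_trans[OF norm_triangle] add_mono nrm_mult) auto
      also have "\<dots> \<le> (nrm A a + 1) * nrm A (b \<ominus> b') + nrm A (a \<ominus> a') * (nrm A b + 2)"
        using b2 nrm_nonneg[OF d(1)] nrm_nonneg[OF d(2)] by (intro add_mono mult_mono) (auto simp: nrm_nonneg c)
      also have "\<dots> < e / 2 + e / 2"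
      proof (rule add_strict_mono)
        show "(nrm A a + 1) * nrm A (b \<ominus> b') < e / 2"
          using b'(2) na by (simp add: pos_less_divide_eq algebra_simps)
        show "nrm A (a \<ominus> a') * (nrm A b + 2) < e / 2"
          using a'(2) nb by (simp add: pos_less_divide_eq algebra_simps)
      qed
      finally show ?thesis using H_mult[OF a'(1) b'(1)] by auto
    qed
    then show ?thesis using CA a b C_iff by auto
  qed
  have C_invol: "invol A a \<in> C" if a: "a \<in> C" for a
  proof -
    have "\<exists>b\<in>H. nrm A (invol A a \<ominus> b) < e" if e: "0 < e" for e
    proof -
      obtain a' where a': "a' \<in> H" "nrm A (a \<ominus> a') < e"
        using approx[OF a e] by blast
      note c = CA[OF a] HA[OF a'(1)]
      have "invol A a \<ominus> invol A a' = invol A (a \<ominus> a')"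
        using c by (simp add: minus_smult invol_add invol_smult invol_closed)
      then have "nrm A (invol A a \<ominus> invol A a') < e"
        using a'(2) norm_invol[OF A_minus_closed[OF c]] by simp
      then show ?thesis using H_invol[OF a'(1)] by blast
    qed
    then show ?thesis using invol_closed[OF CA[OF a]] C_iff by auto
  qed
  let ?B = "A\<lparr>carrier := C\<rparr>"
  have C_zero: "\<zero> \<in> C" using C_smult[OF HC[OF H_one], of 0] smult_zero_left by simp
  have grp: "abelian_group ?B"
  proof (rule abelian_groupI)
    fix a assume "a \<in> carrier ?B"
    then have a: "a \<in> C" by simp
    show "\<exists>b\<in>carrier ?B. b \<oplus>\<^bsub>?B\<^esub> a = \<zero>\<^bsub>?B\<^esub>"
      using C_smult[OF a, of "-1"] A_l_neg[OF CA[OF a]] CA[OF a]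
      by (intro bexI[of _ "(-1) \<odot> a"]) (auto simp: uminus_smult)
  qed (auto simp: C_add C_zero CA A_a_assoc A_a_comm A_a_lcomm)
  have ring: "ring ?B"
  proof (rule ringI[OF grp])
    show "monoid ?B"
      by (rule monoidI) (auto simp: C_mult HC[OF H_one] CA A_m_assoc)
  qed (auto simp: CA A_l_distr A_r_distr)
  have mod: "Module.module complex_ring ?B"
    by (rule moduleI[OF cring_complex_ring grp]) (auto simp: C_smult CA smult_distr)
  interpret B: normed_algebra ?B
    by (intro normed_algebra.intro ring mod normed_algebra_axioms.intro)
       (auto simp: CA norm_nonneg norm_eq_0 norm_smult norm_triangle)
  have B_minus: "a \<ominus>\<^bsub>?B\<^esub> b = a \<ominus> b" if "a \<in> C" "b \<in> C" for a b
    using B.minus_smult[of a b] minus_smult[of a b] that by (simp add: CA)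
  have "Metric_space.mcomplete (carrier ?B) (nrm_dist ?B)"
    unfolding B.mcomplete_iff_Cauchy
  proof (intro allI impI, elim conjE)
    fix \<sigma> :: "nat \<Rightarrow> _" assume \<sigma>: "\<forall>n. \<sigma> n \<in> carrier ?B"
      and c: "\<forall>e>0. \<exists>N. \<forall>m n. N \<le> m \<longrightarrow> N \<le> n \<longrightarrow> nrm ?B (\<sigma> m \<ominus>\<^bsub>?B\<^esub> \<sigma> n) < e"
    from \<sigma> have \<sigma>C: "\<sigma> n \<in> C" for n by simp
    have "\<forall>e>0. \<exists>N. \<forall>m n. N \<le> m \<longrightarrow> N \<le> n \<longrightarrow> nrm A (\<sigma> m \<ominus> \<sigma> n) < e"
      using c by (simp add: B_minus \<sigma>C)
    then obtain a where a: "a \<in> carrier A" and lim: "\<And>e. 0 < e \<Longrightarrow> \<exists>N. \<forall>n\<ge>N. nrm A (\<sigma> n \<ominus> a) < e"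
      using Cauchy_limit[of \<sigma>] CA[OF \<sigma>C] by metis
    have "a \<in> C"
      unfolding C_iff
    proof (intro conjI a allI impI)
      fix e :: real assume e: "0 < e"
      obtain N where N: "nrm A (\<sigma> N \<ominus> a) < e / 2" using lim[of "e / 2"] e by auto
      obtain b where b: "b \<in> H" "nrm A (\<sigma> N \<ominus> b) < e / 2"
        using approx[OF \<sigma>C, of "e / 2" N] e by auto
      show "\<exists>b\<in>H. nrm A (a \<ominus> b) < e"
        using norm_triangle_minus[OF a CA[OF \<sigma>C[of N]] HA[OF b(1)]] N b
          nrm_minus_commute[OF a CA[OF \<sigma>C[of N]]]
        by (intro bexI[of _ b]) auto
    qed
    then show "\<exists>a\<in>carrier ?B. \<forall>e>0. \<exists>N. \<forall>n\<ge>N. nrm ?B (\<sigma> n \<ominus>\<^bsub>?B\<^esub> a) < e"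
      using lim by (intro bexI[of _ a]) (simp_all add: B_minus \<sigma>C)
  qed
  then have "unital_cstar_algebra ?B"
    by (intro unital_cstar_algebra.intro ring mod unital_cstar_algebra_axioms.intro)
       (auto simp: CA C_invol smult_mult_left smult_mult_right invol_invol invol_add invol_smult
          invol_mult nrm_nonneg nrm_eq_0 nrm_smult nrm_triangle nrm_mult cstar_identity)
  then show ?thesis by (simp add: C_def)
qed

end

section \<open>States\<close>

lemma self_adjoint_part_iff: "a \<in> self_adjoint_part A \<longleftrightarrow> a \<in> carrier A \<and> invol A a = a"
  by (simp add: self_adjoint_part_def)

context unital_cstar_algebra
begin

lemma invol_one: "invol A \<one> = \<one>"
  using invol_mult[OF A_one_closed invol_closed[OF A_one_closed]]
    invol_invol[OF A_one_closed] A_l_one[OF invol_closed[OF A_one_closed]]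
  by (simp add: A_one_closed invol_closed)

lemma invol_minus:
  "a \<in> carrier A \<Longrightarrow> b \<in> carrier A \<Longrightarrow> invol A (a \<ominus> b) = invol A a \<ominus> invol A b"
  by (simp add: minus_smult invol_add invol_smult invol_closed)

lemma add_minus_cancel:
  assumes "a \<in> carrier A" "b \<in> carrier A" "c \<in> carrier A"
  shows "(a \<oplus> b) \<ominus> (a \<oplus> c) = b \<ominus> c"
proof -
  have "(a \<oplus> b) \<ominus> (a \<oplus> c) = (a \<oplus> \<ominus> a) \<oplus> (b \<oplus> \<ominus> c)"
    using assms by (simp only: a_minus_def A_minus_add)
      (simp add: A_a_assoc A_a_comm A_a_lcomm A_a_inv_closed A_a_closed)
  then show ?thesis
    using assms by (simp add: A_r_neg A_l_zero A_a_closed A_a_inv_closed a_minus_def)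
qed

lemma square_diff:
  assumes "a \<in> carrier A" "b \<in> carrier A"
  shows "a \<otimes> a \<ominus> b \<otimes> b = a \<otimes> (a \<ominus> b) \<oplus> (a \<ominus> b) \<otimes> b"
  using assms
  by (simp add: a_minus_def A_r_distr A_l_distr A_r_minus A_l_minus A_a_assoc A_r_neg1
      A_m_closed A_a_inv_closed A_a_closed)

lemma norm_square_diff:
  assumes a: "a \<in> carrier A" and b: "b \<in> carrier A"
  shows "nrm A (a \<otimes> a \<ominus> b \<otimes> b) \<le> (nrm A a + nrm A b) * nrm A (a \<ominus> b)"
proof -
  note d = A_minus_closed[OF a b]
  have "nrm A (a \<otimes> (a \<ominus> b) \<oplus> (a \<ominus> b) \<otimes> b) \<le> nrm A a * nrm A (a \<ominus> b) + nrm A (a \<ominus> b) * nrm A b"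
    using a b d by (intro order_trans[OF norm_triangle] add_mono nrm_mult) auto
  then show ?thesis by (simp add: square_diff[OF a b] algebra_simps)
qed

lemma eq_of_norm_small:
  assumes "a \<in> carrier A" "b \<in> carrier A" "\<And>e. 0 < e \<Longrightarrow> nrm A (a \<ominus> b) \<le> e"
  shows "a = b"
proof -
  have "nrm A (a \<ominus> b) \<le> 0" by (rule field_le_epsilon) (use assms(3) in simp)
  then have "nrm A (a \<ominus> b) = 0" using norm_nonneg[of "a \<ominus> b"] assms(1,2) by (simp add: A_minus_closed)
  then show ?thesis using assms(1,2) by (simp add: norm_eq_0 minus_eq_zero A_minus_closed)
qed

text \<open>The square root of \<open>1 - h\<close> is obtained without functional calculus: \<open>(1 - b)\<^sup>2 = 1 - h\<close> is
  the fixed point equation \<open>b = (h + b\<^sup>2) / 2\<close>. On the ball of radius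
  \<open>\<rho> = 1 - sqrt (1 - norm h)\<close>, which the right hand side maps to itself, it is a contraction with
  constant \<open>\<rho>\<close>.\<close>

lemma sqrt_one_minus:
  assumes h: "h \<in> carrier A" "invol A h = h" and less: "nrm A h < 1"
  obtains b where "b \<in> carrier A" "invol A b = b" "(\<one> \<ominus> b) \<otimes> (\<one> \<ominus> b) = \<one> \<ominus> h"
proof -
  define \<rho> where "\<rho> = 1 - sqrt (1 - nrm A h)"
  have h0: "0 \<le> nrm A h" by (rule nrm_nonneg[OF h(1)])
  have \<rho>0: "0 \<le> \<rho>" and \<rho>1: "\<rho> < 1" using h0 less by (auto simp: \<rho>_def)
  have \<rho>eq: "(nrm A h + \<rho>\<^sup>2) / 2 = \<rho>"
    using less by (simp add: \<rho>_def power2_diff)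
  define F where "F b = (1/2) \<odot> (h \<oplus> b \<otimes> b)" for b
  have Fc: "F b \<in> carrier A" if "b \<in> carrier A" for b
    using that h by (simp add: F_def A_m_closed A_a_closed)
  have Fsa: "invol A (F b) = F b" if "b \<in> carrier A" "invol A b = b" for b
    using that h by (simp add: F_def A_m_closed A_a_closed invol_smult invol_add invol_mult)
  have Fdiff: "nrm A (F a \<ominus> F b) \<le> (nrm A a + nrm A b) / 2 * nrm A (a \<ominus> b)"
    if a: "a \<in> carrier A" and b: "b \<in> carrier A" for a b
  proof -
    have aa: "a \<otimes> a \<in> carrier A" and bb: "b \<otimes> b \<in> carrier A" using a b by (auto intro: A_m_closed)
    have "(h \<oplus> a \<otimes> a) \<ominus> (h \<oplus> b \<otimes> b) = a \<otimes> a \<ominus> b \<otimes> b"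
      by (rule add_minus_cancel[OF h(1) aa bb])
    then have "F a \<ominus> F b = (1/2) \<odot> (a \<otimes> a \<ominus> b \<otimes> b)"
      using h aa bb by (simp add: F_def A_a_closed flip: smult_minus_right)
    then have "nrm A (F a \<ominus> F b) = 1/2 * nrm A (a \<otimes> a \<ominus> b \<otimes> b)"
      using aa bb by (simp add: norm_smult A_minus_closed norm_divide)
    then show ?thesis using norm_square_diff[OF a b] by simp
  qed
  define \<beta> where "\<beta> n = (F ^^ n) \<zero>" for n
  have \<beta>0: "\<beta> 0 = \<zero>" and \<beta>Suc: "\<beta> (Suc n) = F (\<beta> n)" for n by (simp_all add: \<beta>_def)
  have \<beta>c: "\<beta> n \<in> carrier A" for n
    by (induction n) (simp_all add: \<beta>0 \<beta>Suc Fc A_zero_closed)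
  have \<beta>sa: "invol A (\<beta> n) = \<beta> n" for n
  proof (induction n)
    case 0
    have "invol A \<zero> = \<zero>"
      using invol_smult[OF A_one_closed, of 0] by (simp add: smult_zero_left A_one_closed invol_closed)
    then show ?case by (simp add: \<beta>0)
  qed (simp add: \<beta>Suc Fsa \<beta>c)
  have \<beta>n: "nrm A (\<beta> n) \<le> \<rho>" for n
  proof (induction n)
    case (Suc n)
    have "nrm A (\<beta> (Suc n)) = 1/2 * nrm A (h \<oplus> \<beta> n \<otimes> \<beta> n)"
      using h \<beta>c by (simp add: \<beta>Suc F_def norm_smult A_m_closed A_a_closed norm_divide)
    also have "\<dots> \<le> 1/2 * (nrm A h + nrm A (\<beta> n) * nrm A (\<beta> n))"
      using h \<beta>c nrm_mult[OF \<beta>c \<beta>c, of n n] norm_triangle[OF h(1) A_m_closed[OF \<beta>c \<beta>c], of n n] by simp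
    also have "\<dots> \<le> 1/2 * (nrm A h + \<rho> * \<rho>)"
      using Suc \<rho>0 nrm_nonneg[OF \<beta>c, of n] by (intro mult_left_mono add_left_mono mult_mono) auto
    also have "\<dots> = \<rho>" using \<rho>eq by (simp add: power2_eq_square)
    finally show ?case .
  qed (use \<rho>0 in \<open>simp add: \<beta>0 nrm_zero\<close>)
  have contr: "nrm A (\<beta> (n + k) \<ominus> \<beta> n) \<le> \<rho> ^ n" for n k
  proof (induction n)
    case 0
    have "\<beta> k \<ominus> \<zero> = \<beta> k"
      using \<beta>c by (simp add: minus_smult A_zero_closed smult_zero_left[of \<zero>] flip: uminus_smult)
    then show ?case using \<beta>n[of k] \<rho>1 by (simp add: \<beta>0)
  next
    case (Suc n)
    have "nrm A (\<beta> (Suc n + k) \<ominus> \<beta> (Suc n))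
        \<le> (nrm A (\<beta> (n + k)) + nrm A (\<beta> n)) / 2 * nrm A (\<beta> (n + k) \<ominus> \<beta> n)"
      using Fdiff[OF \<beta>c \<beta>c, of "n + k" n] by (simp add: \<beta>Suc)
    also have "\<dots> \<le> \<rho> * \<rho> ^ n"
      using \<beta>n[of n] \<beta>n[of "n + k"] Suc \<rho>0 norm_nonneg[OF A_minus_closed[OF \<beta>c \<beta>c]]
      by (intro mult_mono) auto
    finally show ?case by simp
  qed
  have "\<forall>e>0. \<exists>N. \<forall>m n. N \<le> m \<longrightarrow> N \<le> n \<longrightarrow> nrm A (\<beta> m \<ominus> \<beta> n) < e"
  proof (intro allI impI)
    fix e :: real assume e: "0 < e"
    obtain N where N: "\<rho> ^ N < e / 2"
      using real_arch_pow_inv[of "e / 2" \<rho>] e \<rho>1 by auto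
    have "nrm A (\<beta> m \<ominus> \<beta> n) < e" if mn: "N \<le> m" "N \<le> n" for m n
    proof -
      have "nrm A (\<beta> m \<ominus> \<beta> n) \<le> nrm A (\<beta> m \<ominus> \<beta> N) + nrm A (\<beta> n \<ominus> \<beta> N)"
        using norm_triangle_minus[OF \<beta>c \<beta>c \<beta>c] nrm_minus_commute[OF \<beta>c \<beta>c] by metis
      also have "\<dots> \<le> \<rho> ^ N + \<rho> ^ N"
        using contr[of N "m - N"] contr[of N "n - N"] mn by simp
      finally show ?thesis using N by simp
    qed
    then show "\<exists>N. \<forall>m n. N \<le> m \<longrightarrow> N \<le> n \<longrightarrow> nrm A (\<beta> m \<ominus> \<beta> n) < e" by blast
  qed
  then obtain b where b: "b \<in> carrier A" and lim: "\<And>e. 0 < e \<Longrightarrow> \<exists>N. \<forall>n\<ge>N. nrm A (\<beta> n \<ominus> b) < e"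
    using Cauchy_limit[of \<beta>] \<beta>c by metis
  have bsa: "invol A b = b"
  proof (rule eq_of_norm_small[OF invol_closed[OF b] b])
    fix e :: real assume e: "0 < e"
    obtain n where n: "nrm A (\<beta> n \<ominus> b) < e / 2" using lim[of "e / 2"] e by auto
    have "nrm A (invol A b \<ominus> \<beta> n) = nrm A (b \<ominus> \<beta> n)"
      using norm_invol[OF A_minus_closed[OF b \<beta>c]] invol_minus[OF b \<beta>c] \<beta>sa by metis
    then show "nrm A (invol A b \<ominus> b) \<le> e"
      using norm_triangle_minus[OF invol_closed[OF b] \<beta>c b, of n] n nrm_minus_commute[OF b \<beta>c, of n] by simp
  qed
  have Fb: "F b = b"
  proof (rule eq_of_norm_small[OF Fc[OF b] b])
    fix e :: real assume e: "0 < e"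
    define K where "K = (nrm A b + \<rho>) / 2 + 1"
    have K: "1 \<le> K" using \<rho>0 nrm_nonneg[OF b] by (simp add: K_def)
    obtain N where N: "\<And>n. N \<le> n \<Longrightarrow> nrm A (\<beta> n \<ominus> b) < e / (2 * K)" using lim[of "e / (2 * K)"] e K by auto
    have eK: "e / (2 * K) \<le> e / 2" using e K by (simp add: field_simps)
    have nb: "0 \<le> nrm A (b \<ominus> \<beta> N)" by (rule norm_nonneg[OF A_minus_closed[OF b \<beta>c]])
    have "nrm A (F b \<ominus> \<beta> (Suc N)) \<le> (nrm A b + nrm A (\<beta> N)) / 2 * nrm A (b \<ominus> \<beta> N)"
      using Fdiff[OF b \<beta>c, of N] by (simp add: \<beta>Suc)
    also have "\<dots> \<le> K * nrm A (b \<ominus> \<beta> N)"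
      using \<beta>n[of N] nb by (intro mult_right_mono) (auto simp: K_def field_simps)
    also have "\<dots> \<le> K * (e / (2 * K))"
      using N[of N] nrm_minus_commute[OF b \<beta>c, of N] K by (intro mult_left_mono) auto
    also have "\<dots> = e / 2" using K by simp
    finally show "nrm A (F b \<ominus> b) \<le> e"
      using norm_triangle_minus[OF Fc[OF b] \<beta>c b, of "Suc N"] N[of "Suc N"] eK by simp
  qed
  have "(\<one> \<ominus> b) \<otimes> (\<one> \<ominus> b) = \<one> \<ominus> h"
  proof -
    have bb: "b \<otimes> b \<in> carrier A" using b by (intro A_m_closed)
    have hbb: "h \<oplus> b \<otimes> b \<in> carrier A" using h bb by (intro A_a_closed)
    have "b \<oplus> b = (1/2 + 1/2) \<odot> (h \<oplus> b \<otimes> b)"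
      using Fb smult_distr(1)[OF hbb, of "1/2" "1/2"] by (simp only: F_def)
    then have two: "b \<oplus> b = h \<oplus> b \<otimes> b" using smult_distr(4)[OF hbb] by simp
    have "(\<one> \<ominus> b) \<otimes> (\<one> \<ominus> b) = (\<one> \<ominus> (b \<oplus> b)) \<oplus> b \<otimes> b"
      using b bb by (simp add: a_minus_def A_r_distr A_l_distr A_r_minus A_l_minus A_a_assoc
          A_a_inv_closed A_minus_add A_one_closed A_l_one A_r_one A_a_closed A_minus_minus)
    also have "\<dots> = \<one> \<ominus> h"
      unfolding two using h bb
      by (simp add: a_minus_def A_minus_add A_a_assoc A_a_inv_closed A_l_neg A_one_closed
         A_r_zero)
    finally show ?thesis .
  qed
  with b bsa show ?thesis by (rule that)
qed

context
  fixes \<phi> assumes \<phi>: "\<phi> \<in> state_space A"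
begin

lemma state_add: "a \<in> carrier A \<Longrightarrow> b \<in> carrier A \<Longrightarrow> \<phi> (a \<oplus> b) = \<phi> a + \<phi> b"
  using \<phi> by (simp add: state_space_def)

lemma state_smult: "a \<in> carrier A \<Longrightarrow> \<phi> (c \<odot> a) = c * \<phi> a"
  using \<phi> by (simp add: state_space_def)

lemma state_one: "\<phi> \<one> = 1"
  using \<phi> by (simp add: state_space_def)

lemma state_minus: "a \<in> carrier A \<Longrightarrow> b \<in> carrier A \<Longrightarrow> \<phi> (a \<ominus> b) = \<phi> a - \<phi> b"
  by (simp add: minus_smult state_add state_smult)

text \<open>Both \<open>1 - h\<close> and \<open>1 + h\<close> are squares of self-adjoint elements, so positivity of the state bounds
  its value at \<open>h\<close> from both sides.\<close>

lemma state_less_one: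
  assumes h: "h \<in> self_adjoint_part A" "nrm A h < 1"
  shows "\<phi> h \<in> \<real>" "\<bar>Re (\<phi> h)\<bar> \<le> 1"
proof -
  have pos: "1 - \<phi> k \<in> \<real>\<^sub>\<ge>\<^sub>0" if k: "k \<in> self_adjoint_part A" "nrm A k < 1" for k
  proof -
    have kc: "k \<in> carrier A" "invol A k = k" using k by (auto simp: self_adjoint_part_iff)
    obtain b where b: "b \<in> carrier A" "invol A b = b" "(\<one> \<ominus> b) \<otimes> (\<one> \<ominus> b) = \<one> \<ominus> k"
      by (rule sqrt_one_minus[OF kc k(2)])
    have c: "\<one> \<ominus> b \<in> carrier A" using b by (intro A_minus_closed A_one_closed)
    have "\<phi> (invol A (\<one> \<ominus> b) \<otimes> (\<one> \<ominus> b)) \<in> \<real>\<^sub>\<ge>\<^sub>0"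
      using \<phi> c by (simp add: state_space_def)
    then have "\<phi> (\<one> \<ominus> k) \<in> \<real>\<^sub>\<ge>\<^sub>0"
      using b by (simp add: invol_minus A_one_closed invol_one)
    then show ?thesis by (simp add: state_minus A_one_closed kc state_one)
  qed
  have hc: "h \<in> carrier A" "invol A h = h" using h by (auto simp: self_adjoint_part_iff)
  have m: "(-1) \<odot> h \<in> self_adjoint_part A" "nrm A ((-1) \<odot> h) < 1"
    using hc h(2) by (auto simp: self_adjoint_part_iff invol_smult norm_smult)
  show "\<phi> h \<in> \<real>" "\<bar>Re (\<phi> h)\<bar> \<le> 1"
    using pos[OF h] pos[OF m] state_smult[OF hc(1), of "-1"]
    by (auto simp: complex_nonneg_Reals_iff complex_is_Real_iff)
qed

lemma state_bound_sa:
  assumes h: "h \<in> self_adjoint_part A"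
  shows "cmod (\<phi> h) \<le> nrm A h"
proof (rule field_le_epsilon)
  fix e :: real assume e: "0 < e"
  define t where "t = nrm A h + e"
  have hc: "h \<in> carrier A" "invol A h = h" using h by (auto simp: self_adjoint_part_iff)
  have t: "0 < t" "nrm A h < t" using e nrm_nonneg[OF hc(1)] by (auto simp: t_def)
  let ?k = "complex_of_real (1 / t) \<odot> h"
  have k: "?k \<in> self_adjoint_part A" "nrm A ?k < 1"
    using hc t by (auto simp: self_adjoint_part_iff invol_smult norm_smult norm_divide)
  have kk: "\<phi> ?k = complex_of_real (1 / t) * \<phi> h" by (rule state_smult[OF hc(1)])
  have "cmod (\<phi> ?k) \<le> 1"
    using state_less_one[OF k] by (auto simp: complex_is_Real_iff cmod_eq_Re)
  then show "cmod (\<phi> h) \<le> nrm A h + e"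
    unfolding kk t_def[symmetric] using t(1) by (simp add: norm_mult norm_divide field_simps)
qed

end

lemma cartesian_decomposition:
  assumes a: "a \<in> carrier A"
  obtains x y where "x \<in> self_adjoint_part A" "y \<in> self_adjoint_part A" "a = x \<oplus> \<i> \<odot> y"
proof
  have ia: "invol A a \<in> carrier A" by (rule invol_closed[OF a])
  let ?x = "(1/2) \<odot> (a \<oplus> invol A a)" and ?y = "(- \<i>/2) \<odot> (a \<oplus> (-1) \<odot> invol A a)"
  show "?x \<in> self_adjoint_part A"
    using a ia by (auto simp: self_adjoint_part_iff invol_smult invol_add invol_invol A_a_closed A_a_comm)
  show "?y \<in> self_adjoint_part A"
  proof -
    have "invol A ?y = (\<i>/2) \<odot> invol A a \<oplus> (- \<i>/2) \<odot> a"
      using a ia by (simp add: invol_smult invol_add invol_invol A_a_closed smult_distr(2) flip: smult_distr(3))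
    also have "\<dots> = ?y"
      using a ia by (simp add: smult_distr(2) A_a_comm flip: smult_distr(3))
    finally show ?thesis using a ia by (auto simp: self_adjoint_part_iff A_a_closed)
  qed
  have "?x \<oplus> \<i> \<odot> ?y = ((1/2) \<odot> a \<oplus> (1/2) \<odot> invol A a) \<oplus> ((1/2) \<odot> a \<oplus> (-1/2) \<odot> invol A a)"
    using a ia by (simp add: smult_distr(2) A_a_closed flip: smult_distr(3))
  also have "\<dots> = ((1/2) \<odot> a \<oplus> (1/2) \<odot> a) \<oplus> ((1/2) \<odot> invol A a \<oplus> (-1/2) \<odot> invol A a)"
    using a ia by (simp add: A_a_assoc A_a_comm A_a_lcomm A_a_closed)
  also have "\<dots> = (1/2 + 1/2) \<odot> a \<oplus> (1/2 + -1/2) \<odot> invol A a"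
    using a ia by (simp only: smult_distr(1))
  also have "\<dots> = a" using a ia by (simp add: smult_distr(4) smult_zero_left A_r_zero)
  finally show "a = ?x \<oplus> \<i> \<odot> ?y" by simp
qed

section \<open>Rieffel's criterion\<close>

lemma sa_add: "a \<in> self_adjoint_part A \<Longrightarrow> b \<in> self_adjoint_part A \<Longrightarrow> a \<oplus> b \<in> self_adjoint_part A"
  by (simp add: self_adjoint_part_iff A_a_closed invol_add)

lemma sa_smult: "a \<in> self_adjoint_part A \<Longrightarrow> complex_of_real r \<odot> a \<in> self_adjoint_part A"
  by (simp add: self_adjoint_part_iff invol_smult)

lemma sa_one: "\<one> \<in> self_adjoint_part A"
  by (simp add: self_adjoint_part_iff invol_one A_one_closed)

lemma sa_minus: "a \<in> self_adjoint_part A \<Longrightarrow> b \<in> self_adjoint_part A \<Longrightarrow> a \<ominus> b \<in> self_adjoint_part A"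
  by (simp add: self_adjoint_part_iff A_minus_closed invol_minus)

text \<open>If the unit ball of the seminorm is totally bounded modulo the scalars, then on states the
  distance is controlled, up to any prescribed error, by finitely many elements. This makes it finite
  and weak*-continuous. Conversely the distance controls the elements of finite seminorm, hence by
  density everything.\<close>

theorem rieffel_criterion:
  assumes scale: "\<And>a r. a \<in> self_adjoint_part A \<Longrightarrow> L (complex_of_real r \<odot> a) = ennreal \<bar>r\<bar> * L a"
    and triangle: "\<And>a b. \<lbrakk>a \<in> self_adjoint_part A; b \<in> self_adjoint_part A\<rbrakk> \<Longrightarrow> L (a \<oplus> b) \<le> L a + L b"
    and kernel: "\<And>a. a \<in> self_adjoint_part A \<Longrightarrow> L a = 0 \<longleftrightarrow> (\<exists>r. a = complex_of_real r \<odot> \<one>)"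
    and dense: "self_adjoint_part A \<subseteq> nrm_topology A closure_of {a \<in> self_adjoint_part A. L a < \<infinity>}"
    and bounded: "\<And>e. 0 < e \<Longrightarrow> \<exists>F. finite F \<and> F \<subseteq> self_adjoint_part A \<and>
      (\<forall>a\<in>self_adjoint_part A. L a \<le> 1 \<longrightarrow>
        (\<exists>r. \<exists>b\<in>F. nrm A (a \<ominus> (complex_of_real r \<odot> \<one> \<oplus> b)) \<le> e))"
  shows "compact_quantum_metric_space A L"
proof -
  let ?S = "state_space A" and ?sa = "self_adjoint_part A"
  define D where "D \<phi> \<psi> = enn2real (state_dist A L \<phi> \<psi>)" for \<phi> \<psi>
  have saA: "a \<in> carrier A" if "a \<in> ?sa" for a using that by (simp add: self_adjoint_part_iff)
  have D_le: "state_dist A L \<phi> \<psi> \<le> ennreal c"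
    if "\<And>a. a \<in> ?sa \<Longrightarrow> L a \<le> 1 \<Longrightarrow> cmod (\<phi> a - \<psi> a) \<le> c" for \<phi> \<psi> c
    unfolding state_dist_def by (rule SUP_least) (use that in \<open>auto intro: ennreal_leI\<close>)
  have net: "\<exists>F. finite F \<and> F \<subseteq> ?sa \<and> (\<forall>a\<in>?sa. L a \<le> 1 \<longrightarrow>
      (\<forall>\<phi>\<in>?S. \<forall>\<psi>\<in>?S. \<exists>b\<in>F. cmod (\<phi> a - \<psi> a) \<le> cmod (\<phi> b - \<psi> b) + 2 * e))" if e: "0 < e" for e
  proof -
    obtain F where F: "finite F" "F \<subseteq> ?sa"
      and near: "\<And>a. a \<in> ?sa \<Longrightarrow> L a \<le> 1 \<Longrightarrow> \<exists>r. \<exists>b\<in>F. nrm A (a \<ominus> (complex_of_real r \<odot> \<one> \<oplus> b)) \<le> e"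
      using bounded[OF e] by blast
    have net_F: "\<exists>b\<in>F. cmod (\<phi> a - \<psi> a) \<le> cmod (\<phi> b - \<psi> b) + 2 * e"
      if a: "a \<in> ?sa" "L a \<le> 1" and S: "\<phi> \<in> ?S" "\<psi> \<in> ?S" for a \<phi> \<psi>
    proof -
      obtain r b where b: "b \<in> F" "nrm A (a \<ominus> (complex_of_real r \<odot> \<one> \<oplus> b)) \<le> e"
        using near[OF a] by blast
      have bs: "b \<in> ?sa" using b F by blast
      let ?d = "a \<ominus> (complex_of_real r \<odot> \<one> \<oplus> b)"
      have d: "?d \<in> ?sa" by (intro sa_minus sa_add sa_smult sa_one a bs)
      have v: "\<theta> ?d = \<theta> a - (complex_of_real r + \<theta> b)" if "\<theta> \<in> ?S" for \<theta>
        using saA[OF bs] saA[OF a(1)]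
        by (simp add: state_minus[OF that] state_add[OF that] state_smult[OF that] state_one[OF that]
            A_a_closed A_one_closed)
      have "\<phi> a - \<psi> a = (\<phi> b - \<psi> b) + (\<phi> ?d - \<psi> ?d)" using v[OF S(1)] v[OF S(2)] by simp
      then have "cmod (\<phi> a - \<psi> a) \<le> cmod (\<phi> b - \<psi> b) + cmod (\<phi> ?d - \<psi> ?d)"
        by (simp only: norm_triangle_ineq)
      also have "cmod (\<phi> ?d - \<psi> ?d) \<le> cmod (\<phi> ?d) + cmod (\<psi> ?d)" by (rule norm_triangle_ineq4)
      also have "\<dots> \<le> 2 * e"
        using state_bound_sa[OF S(1) d] state_bound_sa[OF S(2) d] b(2) by simp
      finally show ?thesis using b(1) by auto
    qed
    show ?thesis by (intro exI[of _ F] conjI ballI impI F net_F)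
  qed
  have fin: "state_dist A L \<phi> \<psi> < \<infinity>" if S: "\<phi> \<in> ?S" "\<psi> \<in> ?S" for \<phi> \<psi>
  proof -
    obtain F where F: "finite F" and le: "\<And>a. a \<in> ?sa \<Longrightarrow> L a \<le> 1 \<Longrightarrow>
        \<exists>b\<in>F. cmod (\<phi> a - \<psi> a) \<le> cmod (\<phi> b - \<psi> b) + 2 * 1"
      using net[of 1] S by (metis zero_less_one)
    have "cmod (\<phi> a - \<psi> a) \<le> (\<Sum>b\<in>F. cmod (\<phi> b - \<psi> b)) + 2" if a: "a \<in> ?sa" "L a \<le> 1" for a
    proof -
      obtain b where b: "b \<in> F" "cmod (\<phi> a - \<psi> a) \<le> cmod (\<phi> b - \<psi> b) + 2" using le[OF a] by auto
      have "cmod (\<phi> b - \<psi> b) \<le> (\<Sum>b\<in>F. cmod (\<phi> b - \<psi> b))" by (rule member_le_sum) (use F b in auto)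
      then show ?thesis using b by simp
    qed
    from le_less_trans[OF D_le[OF this] ennreal_less_top]
    show ?thesis by (simp only: infinity_ennreal_def)
  qed
  have D_ge: "cmod (\<phi> a - \<psi> a) \<le> D \<phi> \<psi>"
    if S: "\<phi> \<in> ?S" "\<psi> \<in> ?S" and a: "a \<in> ?sa" "L a \<le> 1" for \<phi> \<psi> a
  proof -
    have "ennreal (cmod (\<phi> a - \<psi> a)) \<le> state_dist A L \<phi> \<psi>"
      unfolding state_dist_def by (rule SUP_upper) (use a in auto)
    also have "\<dots> = ennreal (D \<phi> \<psi>)" using fin[OF S] by (simp add: D_def)
    finally show ?thesis by (simp add: D_def)
  qed
  have D_leI: "D \<phi> \<psi> \<le> c"
    if "0 \<le> c" "\<And>a. a \<in> ?sa \<Longrightarrow> L a \<le> 1 \<Longrightarrow> cmod (\<phi> a - \<psi> a) \<le> c" for \<phi> \<psi> c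
    unfolding D_def using D_le[of \<phi> \<psi> c] that by (simp add: enn2real_leI)
  have D_fin: "\<exists>K>0. \<forall>\<phi>\<in>?S. \<forall>\<psi>\<in>?S. cmod (\<phi> a - \<psi> a) \<le> K * D \<phi> \<psi>"
    if a: "a \<in> ?sa" "L a < \<infinity>" for a
  proof -
    define l where "l = enn2real (L a)"
    have l: "L a = ennreal l" "0 \<le> l" using a(2) by (auto simp: l_def)
    let ?b = "complex_of_real (1 / (l + 1)) \<odot> a"
    have b: "?b \<in> ?sa" by (rule sa_smult[OF a(1)])
    have "L ?b = ennreal (1 / (l + 1) * l)"
      using l by (simp only: scale[OF a(1)]) (simp add: ennreal_mult[symmetric])
    also have "\<dots> \<le> ennreal 1" using l(2) by (intro ennreal_leI) simp
    finally have Lb: "L ?b \<le> 1" by simp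
    have "cmod (\<phi> a - \<psi> a) \<le> (l + 1) * D \<phi> \<psi>" if S: "\<phi> \<in> ?S" "\<psi> \<in> ?S" for \<phi> \<psi>
    proof -
      have "\<phi> ?b - \<psi> ?b = complex_of_real (1 / (l + 1)) * (\<phi> a - \<psi> a)"
        by (simp only: state_smult[OF S(1) saA[OF a(1)]] state_smult[OF S(2) saA[OF a(1)]] right_diff_distrib)
      then have "cmod (\<phi> ?b - \<psi> ?b) = cmod (\<phi> a - \<psi> a) / (l + 1)"
        using l(2) by (simp only: norm_mult norm_of_real) simp
      then have "cmod (\<phi> a - \<psi> a) / (l + 1) \<le> D \<phi> \<psi>"
        using D_ge[OF S b Lb] by simp
      then show ?thesis using l(2) by (simp add: pos_divide_le_eq mult.commute)
    qed
    then show ?thesis using l(2) by (intro exI[of _ "l + 1"]) auto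
  qed
  have D_sa: "\<exists>\<delta>>0. \<forall>\<phi>\<in>?S. \<forall>\<psi>\<in>?S. D \<phi> \<psi> < \<delta> \<longrightarrow> cmod (\<phi> a - \<psi> a) < e"
    if a: "a \<in> ?sa" and e: "0 < e" for a e
  proof -
    have sub: "{a \<in> ?sa. L a < \<infinity>} \<subseteq> carrier A" using saA by auto
    have "a \<in> nrm_topology A closure_of {a \<in> ?sa. L a < \<infinity>}" using dense a by blast
    moreover have "0 < e / 4" using e by simp
    ultimately obtain b where b: "b \<in> ?sa" "L b < \<infinity>" "nrm A (a \<ominus> b) < e / 4"
      unfolding topology_closure_of[OF sub] by blast
    obtain K where K: "0 < K" "\<And>\<phi> \<psi>. \<phi> \<in> ?S \<Longrightarrow> \<psi> \<in> ?S \<Longrightarrow> cmod (\<phi> b - \<psi> b) \<le> K * D \<phi> \<psi>"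
      using D_fin[OF b(1,2)] by blast
    have "cmod (\<phi> a - \<psi> a) < e" if S: "\<phi> \<in> ?S" "\<psi> \<in> ?S" and lt: "D \<phi> \<psi> < e / 2 / K" for \<phi> \<psi>
    proof -
      let ?d = "a \<ominus> b"
      have d: "?d \<in> ?sa" by (rule sa_minus[OF a b(1)])
      have v: "\<theta> ?d = \<theta> a - \<theta> b" if "\<theta> \<in> ?S" for \<theta>
        by (rule state_minus[OF that saA[OF a] saA[OF b(1)]])
      have "\<phi> a - \<psi> a = (\<phi> b - \<psi> b) + (\<phi> ?d - \<psi> ?d)" using v[OF S(1)] v[OF S(2)] by simp
      then have "cmod (\<phi> a - \<psi> a) \<le> cmod (\<phi> b - \<psi> b) + cmod (\<phi> ?d - \<psi> ?d)"
        by (simp only: norm_triangle_ineq)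
      also have "cmod (\<phi> ?d - \<psi> ?d) \<le> cmod (\<phi> ?d) + cmod (\<psi> ?d)" by (rule norm_triangle_ineq4)
      also have "cmod (\<phi> b - \<psi> b) < e / 2"
        using K(2)[OF S] mult_strict_left_mono[OF lt K(1)] K(1) by simp
      finally show ?thesis
        using state_bound_sa[OF S(1) d] state_bound_sa[OF S(2) d] b(3) by simp
    qed
    then show ?thesis using K(1) e by (intro exI[of _ "e / 2 / K"]) auto
  qed
  have D_all: "\<exists>\<delta>>0. \<forall>\<phi>\<in>?S. \<forall>\<psi>\<in>?S. D \<phi> \<psi> < \<delta> \<longrightarrow> cmod (\<phi> a - \<psi> a) < e"
    if a: "a \<in> carrier A" and e: "0 < e" for a e
  proof -
    obtain x y where xy: "x \<in> ?sa" "y \<in> ?sa" "a = x \<oplus> \<i> \<odot> y"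
      by (rule cartesian_decomposition[OF a])
    obtain \<delta>1 where 1: "0 < \<delta>1" "\<And>\<phi> \<psi>. \<phi> \<in> ?S \<Longrightarrow> \<psi> \<in> ?S \<Longrightarrow> D \<phi> \<psi> < \<delta>1 \<Longrightarrow> cmod (\<phi> x - \<psi> x) < e / 2"
      using D_sa[OF xy(1), of "e / 2"] e by auto
    obtain \<delta>2 where 2: "0 < \<delta>2" "\<And>\<phi> \<psi>. \<phi> \<in> ?S \<Longrightarrow> \<psi> \<in> ?S \<Longrightarrow> D \<phi> \<psi> < \<delta>2 \<Longrightarrow> cmod (\<phi> y - \<psi> y) < e / 2"
      using D_sa[OF xy(2), of "e / 2"] e by auto
    have "cmod (\<phi> a - \<psi> a) < e" if S: "\<phi> \<in> ?S" "\<psi> \<in> ?S" and lt: "D \<phi> \<psi> < min \<delta>1 \<delta>2" for \<phi> \<psi>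
    proof -
      have v: "\<theta> a = \<theta> x + \<i> * \<theta> y" if "\<theta> \<in> ?S" for \<theta>
        using saA[OF xy(1)] saA[OF xy(2)] xy(3) by (simp add: state_add[OF that] state_smult[OF that])
      have "\<phi> a - \<psi> a = (\<phi> x - \<psi> x) + \<i> * (\<phi> y - \<psi> y)"
        using v[OF S(1)] v[OF S(2)] by (simp add: algebra_simps)
      then have "cmod (\<phi> a - \<psi> a) \<le> cmod (\<phi> x - \<psi> x) + cmod (\<i> * (\<phi> y - \<psi> y))"
        by (simp only: norm_triangle_ineq)
      then show ?thesis using 1(2)[OF S] 2(2)[OF S] lt by (simp add: norm_mult)
    qed
    then show ?thesis using 1(1) 2(1) by (intro exI[of _ "min \<delta>1 \<delta>2"]) auto
  qed
  have D_nonneg: "0 \<le> D \<phi> \<psi>" for \<phi> \<psi> by (simp add: D_def)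
  have D_self: "D \<phi> \<phi> = 0" for \<phi>
    using D_leI[of 0 \<phi> \<phi>] D_nonneg[of \<phi> \<phi>] by simp
  have met: "Metric_space ?S D"
  proof
    show "0 \<le> D \<phi> \<psi>" for \<phi> \<psi> by (rule D_nonneg)
    show "D \<phi> \<psi> = D \<psi> \<phi>" for \<phi> \<psi> by (simp add: D_def state_dist_def norm_minus_commute)
    show "D \<phi> \<psi> = 0 \<longleftrightarrow> \<phi> = \<psi>" if S: "\<phi> \<in> ?S" "\<psi> \<in> ?S" for \<phi> \<psi>
    proof
      assume 0: "D \<phi> \<psi> = 0"
      have "\<phi> a = \<psi> a" if a: "a \<in> carrier A" for a
      proof -
        have "cmod (\<phi> a - \<psi> a) \<le> 0 + e" if e: "0 < e" for e
          using D_all[OF a e] S 0 by fastforce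
        then have "cmod (\<phi> a - \<psi> a) \<le> 0" by (rule field_le_epsilon)
        then show ?thesis by simp
      qed
      then show "\<phi> = \<psi>"
        using S by (intro extensionalityI[of _ "carrier A"]) (auto simp: state_space_def)
    qed (simp add: D_self)
    show "D \<phi> \<theta> \<le> D \<phi> \<psi> + D \<psi> \<theta>" if S: "\<phi> \<in> ?S" "\<psi> \<in> ?S" "\<theta> \<in> ?S" for \<phi> \<psi> \<theta>
    proof (rule D_leI)
      fix a assume a: "a \<in> ?sa" "L a \<le> 1"
      show "cmod (\<phi> a - \<theta> a) \<le> D \<phi> \<psi> + D \<psi> \<theta>"
        using D_ge[OF S(1,2) a] D_ge[OF S(2,3) a] norm_triangle_ineq[of "\<phi> a - \<psi> a" "\<psi> a - \<theta> a"] by simp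
    qed (simp add: D_nonneg)
  qed
  interpret M: Metric_space ?S D by (rule met)
  let ?w = "weak_star_topology A"
  have topw: "topspace ?w = ?S"
    by (auto simp: weak_star_topology_def state_space_def extensional_def PiE_def)
  have proj: "continuous_map ?w euclidean (\<lambda>\<phi>. \<phi> b)" if "b \<in> carrier A" for b
    unfolding weak_star_topology_def
    by (intro continuous_map_from_subtopology)
       (use continuous_map_product_projection[OF that, of "\<lambda>_. euclidean"] in simp)
  have weak_to_metric: "continuous_map ?w M.mtopology (\<lambda>\<phi>. \<phi>)"
    unfolding M.continuous_map_to_metric
  proof (intro ballI allI impI)
    fix \<phi> and e :: real assume "\<phi> \<in> topspace ?w" and e: "0 < e"
    then have \<phi>: "\<phi> \<in> ?S" by (simp add: topw)
    have e8: "0 < e / 8" using e by simp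
    obtain F where F: "finite F" "F \<subseteq> ?sa" and le_F: "\<forall>a\<in>?sa. L a \<le> 1 \<longrightarrow>
        (\<forall>\<phi>\<in>?S. \<forall>\<psi>\<in>?S. \<exists>b\<in>F. cmod (\<phi> a - \<psi> a) \<le> cmod (\<phi> b - \<psi> b) + 2 * (e / 8))"
      using net[OF e8] by (elim exE conjE) (rule that)
    have le: "\<exists>b\<in>F. cmod (\<phi> a - \<psi> a) \<le> cmod (\<phi> b - \<psi> b) + 2 * (e / 8)"
      if "a \<in> ?sa" "L a \<le> 1" "\<psi> \<in> ?S" for a \<psi>
      using le_F[rule_format, OF that(1,2) \<phi> that(3)] .
    define U where "U = {\<psi> \<in> topspace ?w. \<forall>b\<in>F. \<psi> b \<in> ball (\<phi> b) (e / 4)}"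
    have "openin ?w {\<psi> \<in> topspace ?w. \<forall>b\<in>G. \<psi> b \<in> ball (\<phi> b) (e / 4)}" if "finite G" "G \<subseteq> ?sa" for G
      using that
    proof (induction G rule: finite_induct)
      case (insert b G)
      have 1: "openin ?w {\<psi> \<in> topspace ?w. \<psi> b \<in> ball (\<phi> b) (e / 4)}"
        by (rule openin_continuous_map_preimage[OF proj]) (use insert.prems saA in auto)
      have 2: "openin ?w {\<psi> \<in> topspace ?w. \<forall>b\<in>G. \<psi> b \<in> ball (\<phi> b) (e / 4)}"
        using insert by simp
      have eq: "{\<psi> \<in> topspace ?w. \<forall>c\<in>insert b G. \<psi> c \<in> ball (\<phi> c) (e / 4)}
          = {\<psi> \<in> topspace ?w. \<psi> b \<in> ball (\<phi> b) (e / 4)}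
            \<inter> {\<psi> \<in> topspace ?w. \<forall>b\<in>G. \<psi> b \<in> ball (\<phi> b) (e / 4)}" by blast
      show ?case by (subst eq) (rule openin_Int[OF 1 2])
    qed simp
    then have U: "openin ?w U" unfolding U_def using F by blast
    have "\<phi> \<in> U" using \<phi> e by (simp add: U_def topw)
    moreover have "\<psi> \<in> M.mball \<phi> e" if "\<psi> \<in> U" for \<psi>
    proof -
      have \<psi>: "\<psi> \<in> ?S" and close: "\<And>b. b \<in> F \<Longrightarrow> cmod (\<phi> b - \<psi> b) < e / 4"
        using that by (auto simp: U_def topw dist_norm)
      have "D \<phi> \<psi> \<le> e / 2"
      proof (rule D_leI)
        fix a assume a: "a \<in> ?sa" "L a \<le> 1"
        then obtain b where b: "b \<in> F" "cmod (\<phi> a - \<psi> a) \<le> cmod (\<phi> b - \<psi> b) + 2 * (e / 8)"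
          using le[OF a \<psi>] by blast
        with close[OF b(1)] show "cmod (\<phi> a - \<psi> a) \<le> e / 2" by simp
      qed (use e in simp)
      then show ?thesis using \<phi> \<psi> e by simp
    qed
    ultimately show "\<exists>U. openin ?w U \<and> \<phi> \<in> U \<and> (\<forall>\<psi>\<in>U. \<psi> \<in> M.mball \<phi> e)"
      using U by blast
  qed
  have metric_to_weak: "continuous_map M.mtopology ?w (\<lambda>\<phi>. \<phi>)"
    unfolding weak_star_topology_def continuous_map_in_subtopology continuous_map_componentwise
  proof (intro conjI ballI)
    show "(\<lambda>\<phi>. \<phi>) \<in> topspace M.mtopology \<rightarrow> ?S" by simp
    show "(\<lambda>\<phi>. \<phi>) ` topspace M.mtopology \<subseteq> extensional (carrier A)"
      unfolding M.topspace_mtopology by (auto simp: state_space_def)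
    fix a assume a: "a \<in> carrier A"
    show "continuous_map M.mtopology euclidean (\<lambda>\<phi>. \<phi> a)"
      unfolding M.continuous_map_from_metric
    proof (intro conjI ballI allI impI)
      show "(\<lambda>\<phi>. \<phi> a) \<in> ?S \<rightarrow> topspace euclidean" by simp
      fix \<phi> U assume \<phi>: "\<phi> \<in> ?S" and U: "openin euclidean U \<and> \<phi> a \<in> U"
      then obtain e where e: "0 < e" "ball (\<phi> a) e \<subseteq> U"
        by (auto simp: open_contains_ball)
      obtain \<delta> where "0 < \<delta>" "\<And>\<psi>. \<psi> \<in> ?S \<Longrightarrow> D \<phi> \<psi> < \<delta> \<Longrightarrow> cmod (\<phi> a - \<psi> a) < e"
        using D_all[OF a e(1)] \<phi> by blast
      then show "\<exists>d>0. \<forall>x. x \<in> ?S \<and> D \<phi> x < d \<longrightarrow> x a \<in> U"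
        using e(2) by (intro exI[of _ \<delta>]) (auto simp: dist_norm subset_iff)
    qed
  qed
  have eq: "M.mtopology = ?w"
    unfolding topology_eq
  proof (intro allI iffI)
    fix U assume U: "openin M.mtopology U"
    have "{x \<in> topspace ?w. x \<in> U} = U" using openin_subset[OF U] by (auto simp: topw)
    then show "openin ?w U" using openin_continuous_map_preimage[OF weak_to_metric U] by simp
  next
    fix U assume U: "openin ?w U"
    have "{x \<in> topspace M.mtopology. x \<in> U} = U" using openin_subset[OF U] by (auto simp: topw)
    then show "openin M.mtopology U" using openin_continuous_map_preimage[OF metric_to_weak U] by simp
  qed
  show ?thesis
    by (intro compact_quantum_metric_space.intro compact_quantum_metric_space_axioms.intro
        unital_cstar_algebra_axioms scale triangle kernel dense fin
        met[unfolded D_def[abs_def]] eq[unfolded D_def[abs_def]])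
qed

end

section \<open>Words in a right-angled Coxeter group\<close>

locale right_angled_coxeter = coxeter_system +
  assumes ra: "right_angled S m"
begin

lemma m_cases: "s \<in> S \<Longrightarrow> t \<in> S \<Longrightarrow> s \<noteq> t \<Longrightarrow> m s t \<noteq> 2 \<Longrightarrow> m s t = \<infinity>"
  using ra by (auto simp: right_angled_def)

lemma m_self_ne_2: "s \<in> S \<Longrightarrow> m s s \<noteq> 2"
  by (simp add: m_diag)

lemma m_2_neq: "s \<in> S \<Longrightarrow> m s t = 2 \<Longrightarrow> s \<noteq> t"
  using m_self_ne_2 by auto

lemma relator_value:
  assumes "r \<in> coxeter_relators S m"
  shows "word_value W r = \<one>"
proof -
  have p: "r \<in> lists (S \<times> UNIV)"
    "word_value W r = \<one> \<longleftrightarrow> equivclp (presentation_step S (coxeter_relators S m)) r []"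
    using presentation assms by (auto simp: has_presentation_def)
  have "presentation_step S (coxeter_relators S m) ([] @ r @ []) ([] @ [])"
    by (rule presentation_step.relator) (use assms in auto)
  then show ?thesis using p(2) by (simp add: r_into_equivclp)
qed

lemma m_2_commute:
  assumes s: "s \<in> S" and t: "t \<in> S" and 2: "m s t = 2"
  shows "s \<otimes> t = t \<otimes> s"
proof -
  have "m s t = enat 2" using 2 by (simp add: numeral_eq_enat)
  then have "concat (replicate 2 [(s, True), (t, True)]) \<in> coxeter_relators S m"
    unfolding coxeter_relators_def using s t by blast
  from relator_value[OF this] have "s \<otimes> (t \<otimes> (s \<otimes> t)) = \<one>"
    using S_closed s t by (simp add: word_value_def list_mult_def numeral_2_eq_2)
  then have "(s \<otimes> t) \<otimes> (s \<otimes> t) = \<one>" using S_closed s t by (simp add: m_assoc)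
  moreover have "(t \<otimes> s) \<otimes> (s \<otimes> t) = \<one>"
    using S_closed s t S_square by (metis inv_solve_right' m_assoc m_closed r_inv r_one)
  ultimately show ?thesis using S_closed s t by (metis m_closed right_cancel)
qed

text \<open>A letter is in front of a word if it can be moved to the front by exchanging commuting
  neighbours.\<close>

fun front :: "'a \<Rightarrow> 'a list \<Rightarrow> bool" where
  "front s [] = False"
| "front s (t # u) = (s = t \<or> m s t = 2 \<and> front s u)"

fun red :: "'a list \<Rightarrow> bool" where
  "red [] = True"
| "red (s # u) = (\<not> front s u \<and> red u)"

text \<open>Two words are related by exchanges of commuting neighbours if and only if they have the same
  projections to any two letters that do not commute. Taking this as the definition makes the
  relation an equality of functions, so that no sequences of exchanges have to be manipulated.\<close>

definition proj :: "'a list \<Rightarrow> 'a \<Rightarrow> 'a \<Rightarrow> 'a list" where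
  "proj u a b = filter (\<lambda>x. x = a \<or> x = b) u"

definition eqv :: "'a list \<Rightarrow> 'a list \<Rightarrow> bool" where
  "eqv u v \<longleftrightarrow> (\<forall>a\<in>S. \<forall>b\<in>S. m a b \<noteq> 2 \<longrightarrow> proj u a b = proj v a b)"

lemma eqv_refl [simp]: "eqv u u"
  and eqv_sym: "eqv u v \<Longrightarrow> eqv v u"
  and eqv_trans [trans]: "eqv u v \<Longrightarrow> eqv v w \<Longrightarrow> eqv u w"
  by (auto simp: eqv_def)

lemma eqv_set:
  assumes "eqv u v" "set u \<subseteq> S" "set v \<subseteq> S"
  shows "mset u = mset v" "set u = set v" "length u = length v"
proof -
  have "count (mset u) a = count (mset v) a" for a
  proof (cases "a \<in> S")
    case True
    then have "proj u a a = proj v a a" using assms(1) m_self_ne_2 by (simp add: eqv_def)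
    then have "count (mset (filter (\<lambda>x. x = a) u)) a = count (mset (filter (\<lambda>x. x = a) v)) a"
      by (simp add: proj_def)
    then show ?thesis by simp
  next
    case False
    then have "a \<notin> set u" "a \<notin> set v" using assms by auto
    then have "count (mset u) a = 0" "count (mset v) a = 0" by (simp_all add: count_eq_zero_iff)
    then show ?thesis by (simp only:)
  qed
  then show "mset u = mset v" by (rule multiset_eqI)
  then show "set u = set v" "length u = length v" by (metis set_mset_mset, metis size_mset)
qed

lemma front_iff:
  assumes "s \<in> S" "set u \<subseteq> S"
  shows "front s u \<longleftrightarrow> s \<in> set u \<and> (\<forall>b\<in>S. m s b \<noteq> 2 \<longrightarrow> hd (proj u s b) = s)"
  using assms(2)
proof (induction u)
  case (Cons t u)
  show ?case
  proof (cases "s = t")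
    case True
    then show ?thesis by (simp add: proj_def)
  next
    case st: False
    show ?thesis
    proof (cases "m s t = 2")
      case True
      have "proj (t # u) s b = proj u s b" if "m s b \<noteq> 2" for b
        using that st True by (auto simp: proj_def)
      then show ?thesis using Cons True st by auto
    next
      case False
      have "hd (proj (t # u) s t) = t" by (simp add: proj_def)
      then show ?thesis using Cons.prems False st by auto
    qed
  qed
qed simp

lemma front_set: "front s u \<Longrightarrow> s \<in> set u"
  by (induction u) auto

lemma front_cong: "eqv u v \<Longrightarrow> set u \<subseteq> S \<Longrightarrow> set v \<subseteq> S \<Longrightarrow> s \<in> S \<Longrightarrow> front s u = front s v"
  using eqv_set(2)[of u v] by (auto simp: front_iff eqv_def)

lemma proj_remove1: "proj (remove1 s u) a b = remove1 s (proj u a b)"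
  by (simp add: proj_def filter_remove1)

lemma proj_Cons: "proj (s # u) a b = (if s = a \<or> s = b then s # proj u a b else proj u a b)"
  by (simp add: proj_def)

lemma eqv_Cons: "eqv u v \<Longrightarrow> eqv (s # u) (s # v)"
  by (simp add: eqv_def proj_Cons)

lemma eqv_remove1: "eqv u v \<Longrightarrow> eqv (remove1 s u) (remove1 s v)"
  by (simp add: eqv_def proj_remove1)

lemma lists_remove1: "set u \<subseteq> S \<Longrightarrow> set (remove1 s u) \<subseteq> S"
  using set_remove1_subset[of s u] by (rule subset_trans)

text \<open>If \<open>s\<close> is in front then every projection that sees \<open>s\<close> starts with it, and the other projections
  are not affected by moving it.\<close>

lemma front_eqv:
  assumes "front s u" "s \<in> S" "set u \<subseteq> S"
  shows "eqv u (s # remove1 s u)"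
  unfolding eqv_def
proof (intro ballI impI)
  fix a b assume ab: "a \<in> S" "b \<in> S" "m a b \<noteq> 2"
  show "proj u a b = proj (s # remove1 s u) a b"
  proof (cases "s = a \<or> s = b")
    case True
    then obtain c where c: "c \<in> S" "m s c \<noteq> 2" "proj v a b = proj v s c" for v
      using ab m_sym unfolding proj_def by (metis (no_types, lifting) filter_cong)
    have h: "hd (proj u s c) = s" "s \<in> set u" using assms c front_iff by auto
    then have "s \<in> set (proj u s c)" by (simp add: proj_def)
    then obtain l where "proj u s c = s # l" using h(1) by (metis list.exhaust_sel list.set(1) empty_iff)
    then show ?thesis using True c(3)[of u] c(3)[of "remove1 s u"]
      by (simp add: proj_Cons proj_remove1)
  next
    case False
    then have "s \<notin> set (proj u a b)" by (auto simp: proj_def)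
    then show ?thesis using False by (auto simp: proj_Cons proj_remove1 remove1_idem)
  qed
qed

lemma front_Cons_commute: "s \<in> S \<Longrightarrow> m s t = 2 \<Longrightarrow> front s (t # u) = front s u"
  using m_2_neq by auto

lemma front_remove1_commute:
  assumes "s \<in> S" "m s t = 2"
  shows "front s (remove1 t u) = front s u"
  using m_2_neq[OF assms] assms(2) by (induction u) auto

lemma red_remove1:
  assumes "red u" "front s u" "s \<in> S" "set u \<subseteq> S"
  shows "red (remove1 s u) \<and> \<not> front s (remove1 s u)"
  using assms
proof (induction u)
  case (Cons t u)
  show ?case
  proof (cases "t = s")
    case True
    then show ?thesis using Cons.prems by simp
  next
    case False
    then have st: "m s t = 2" and f: "front s u" using Cons.prems by auto
    have t: "t \<in> S" using Cons.prems by auto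
    have ts: "m t s = 2" using st m_sym t Cons.prems by simp
    have IH: "red (remove1 s u) \<and> \<not> front s (remove1 s u)"
      using Cons f by auto
    then show ?thesis
      using False st Cons.prems front_remove1_commute[OF t ts] by auto
  qed
qed simp

subsection \<open>The action on words\<close>

text \<open>Multiplication by a letter, cancelling it if it is in front. That this defines an action of the
  presented group on words up to \<^const>\<open>eqv\<close> solves the word problem.\<close>

definition act :: "'a \<Rightarrow> 'a list \<Rightarrow> 'a list" where
  "act s u = (if front s u then remove1 s u else s # u)"

lemma act_lists: "s \<in> S \<Longrightarrow> set u \<subseteq> S \<Longrightarrow> set (act s u) \<subseteq> S"
  by (simp add: act_def lists_remove1)

lemma act_red: "red u \<Longrightarrow> s \<in> S \<Longrightarrow> set u \<subseteq> S \<Longrightarrow> red (act s u)"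
  using red_remove1 by (simp add: act_def)

lemma act_cong:
  "eqv u v \<Longrightarrow> set u \<subseteq> S \<Longrightarrow> set v \<subseteq> S \<Longrightarrow> s \<in> S \<Longrightarrow> eqv (act s u) (act s v)"
  using front_cong[of u v s] by (simp add: act_def eqv_Cons eqv_remove1)

lemma act_act:
  assumes "red u" "s \<in> S" "set u \<subseteq> S"
  shows "eqv (act s (act s u)) u"
  using assms red_remove1[OF assms(1) _ assms(2,3)] front_eqv[OF _ assms(2,3)]
  by (auto simp: act_def eqv_sym)

lemma act_commute:
  assumes "s \<in> S" "t \<in> S" "m s t = 2" "set u \<subseteq> S"
  shows "eqv (act s (act t u)) (act t (act s u))"
proof -
  have ts: "m t s = 2" using assms m_sym by simp
  have ne: "s \<noteq> t" using m_2_neq assms by blast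
  have f: "front s (act t u) = front s u" "front t (act s u) = front t u"
    using assms ts front_remove1_commute front_Cons_commute by (auto simp: act_def)
  have sw: "eqv (s # t # u) (t # s # u)"
    using assms(3) ts ne by (auto simp: eqv_def proj_Cons)
  show ?thesis
    using sw ne by (simp add: act_def f[unfolded act_def] remove1_commute)
qed

abbreviation acts :: "'a list \<Rightarrow> 'a list \<Rightarrow> 'a list" where
  "acts w u \<equiv> foldr act w u"

lemma acts_props:
  assumes "set w \<subseteq> S" "set u \<subseteq> S"
  shows "set (acts w u) \<subseteq> S" "red u \<Longrightarrow> red (acts w u)"
proof -
  have "set (acts w u) \<subseteq> S \<and> (red u \<longrightarrow> red (acts w u))"
    using assms(1)
  proof (induction w)
    case (Cons s w)
    then show ?case using act_lists[of s "acts w u"] act_red[of "acts w u" s] by simp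
  qed (use assms in simp)
  then show "set (acts w u) \<subseteq> S" "red u \<Longrightarrow> red (acts w u)" by blast+
qed

lemma acts_cong:
  assumes "set w \<subseteq> S" "set u \<subseteq> S" "set v \<subseteq> S" "eqv u v"
  shows "eqv (acts w u) (acts w v)"
  using assms(1)
proof (induction w)
  case (Cons s w)
  then show ?case using act_cong[OF Cons.IH acts_props(1) acts_props(1)] assms by simp
qed (simp add: assms)

lemma acts_red: "set w \<subseteq> S \<Longrightarrow> red w \<Longrightarrow> acts w [] = w"
  by (induction w) (auto simp: act_def)

lemma acts_length: "length (acts w []) \<le> length w" "\<not> red w \<Longrightarrow> set w \<subseteq> S \<Longrightarrow> length (acts w []) < length w"
proof -
  have l: "length (act s u) \<le> Suc (length u)" for s u by (auto simp: act_def length_remove1)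
  show le: "length (acts w []) \<le> length w" for w
  proof (induction w)
    case (Cons s w)
    then show ?case using l[of s "acts w []"] by simp
  qed simp
  show "length (acts w []) < length w" if "\<not> red w" "set w \<subseteq> S"
    using that
  proof (induction w)
    case (Cons s w)
    show ?case
    proof (cases "red w")
      case True
      then have "front s w" "acts w [] = w" using Cons.prems acts_red by auto
      moreover have "w \<noteq> []" using \<open>front s w\<close> by auto
      moreover have "act s w = remove1 s w" using \<open>front s w\<close> by (simp add: act_def)
      ultimately show ?thesis using length_remove1[of s w] by (simp split: if_splits)
    next
      case False
      then have "length (acts w []) < length w" using Cons by simp
      then show ?thesis using l[of s "acts w []"] by simp
    qed
  qed simp
qed

lemma acts_rev_acts:
  assumes "set w \<subseteq> S" "set u \<subseteq> S" "red u"
  shows "eqv (acts w (acts (rev w) u)) u"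
  using assms
proof (induction w arbitrary: u)
  case (Cons s w)
  have s: "s \<in> S" "set w \<subseteq> S" using Cons.prems by auto
  have a: "set (act s u) \<subseteq> S" "red (act s u)" using s Cons.prems act_lists act_red by auto
  have r: "set (rev w) \<subseteq> S" using s by simp
  have "acts (s # w) (acts (rev (s # w)) u) = act s (acts w (acts (rev w) (act s u)))" by simp
  moreover have "eqv (act s (acts w (acts (rev w) (act s u)))) (act s (act s u))"
    by (rule act_cong[OF Cons.IH[OF s(2) a] acts_props(1)[OF s(2) acts_props(1)[OF r a(1)]] a(1) s(1)])
  ultimately show ?case using act_act[of u s] s Cons.prems eqv_trans by metis
qed simp

lemma presentation_step_acts:
  assumes "presentation_step S (coxeter_relators S m) z z'"
  shows "eqv (acts (map fst z) []) (acts (map fst z') [])"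
  using assms
proof cases
  case (cancel u v s b)
  let ?v = "acts (map fst v) []"
  have "set (map fst v) \<subseteq> S" using cancel by (auto simp: lists_eq_set)
  then have v: "set ?v \<subseteq> S" "red ?v" using acts_props[of "map fst v" "[]"] by simp_all
  have "eqv (act s (act s ?v)) ?v" using act_act v cancel by blast
  moreover have "set (map fst u) \<subseteq> S" using cancel by (auto simp: lists_eq_set)
  ultimately have "eqv (acts (map fst u) (act s (act s ?v))) (acts (map fst u) ?v)"
    using cancel(5) v by (intro acts_cong act_lists)
  then show ?thesis using cancel by simp
next
  case (relator u v r)
  let ?v = "acts (map fst v) []"
  have "set (map fst v) \<subseteq> S" using relator by (auto simp: lists_eq_set)
  then have v: "set ?v \<subseteq> S" "red ?v" using acts_props[of "map fst v" "[]"] by simp_all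
  obtain s t n where r: "r = concat (replicate n [(s, True), (t, True)])" "s \<in> S" "t \<in> S" "m s t = enat n"
    using relator by (auto simp: coxeter_relators_def)
  have "set (acts (map fst r) ?v) \<subseteq> S \<and> eqv (acts (map fst r) ?v) ?v"
  proof (cases "s = t")
    case True
    then have "n = 1" using r m_diag[of s] by (simp add: one_enat_def)
    then show ?thesis using r True act_act v act_lists by auto
  next
    case False
    then have 2: "m s t = 2" using m_cases[of s t] r by auto
    then have "n = 2" using r(4) by (simp add: numeral_eq_enat)
    then have eq: "acts (map fst r) ?v = act s (act t (act s (act t ?v)))"
      using r by (simp add: numeral_2_eq_2)
    let ?w = "act t ?v"
    have w: "set ?w \<subseteq> S" "red ?w" using r v act_lists act_red by auto
    have "eqv (act s (act t (act s ?w))) (act s (act s (act t ?w)))"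
      using r w v act_commute[of t s ?w] 2 m_sym[of s t] by (intro act_cong act_lists) auto
    also have "eqv (act s (act s (act t ?w))) (act t ?w)"
      using r w v by (intro act_act act_lists act_red) auto
    also have "eqv (act t ?w) ?v" using r v by (intro act_act) auto
    finally show ?thesis using w(1) act_lists r(2,3) unfolding eq by simp
  qed
  moreover have "set (map fst u) \<subseteq> S" using relator by (auto simp: lists_eq_set)
  ultimately have "eqv (acts (map fst u) (acts (map fst r) ?v)) (acts (map fst u) ?v)"
    using v by (intro acts_cong) simp_all
  then show ?thesis using relator by simp
qed

lemma equivclp_acts:
  assumes "equivclp (presentation_step S (coxeter_relators S m)) z z'"
  shows "eqv (acts (map fst z) []) (acts (map fst z') [])"
  using assms
proof (induction rule: equivclp_induct)
  case (step y z)
  then show ?case using presentation_step_acts eqv_trans eqv_sym by blast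
qed simp

lemma list_mult_simps [simp]:
  "list_mult G [] = \<one>\<^bsub>G\<^esub>" "list_mult G (x # xs) = x \<otimes>\<^bsub>G\<^esub> list_mult G xs"
  by (simp_all add: list_mult_def)

lemma list_mult_closed: "set u \<subseteq> S \<Longrightarrow> list_mult W u \<in> carrier W"
  by (induction u) (auto simp: S_closed)

lemma list_mult_append:
  "set u \<subseteq> S \<Longrightarrow> set v \<subseteq> S \<Longrightarrow> list_mult W (u @ v) = list_mult W u \<otimes> list_mult W v"
  by (induction u) (auto simp: list_mult_closed S_closed m_assoc)

lemma S_cancel: "s \<in> S \<Longrightarrow> w \<in> carrier W \<Longrightarrow> s \<otimes> (s \<otimes> w) = w"
  using S_square S_closed by (metis l_one m_assoc)

lemma inv_S: "s \<in> S \<Longrightarrow> inv s = s"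
  using S_square S_closed by (metis inv_equality)

lemma list_mult_rev: "set u \<subseteq> S \<Longrightarrow> list_mult W (rev u) = inv (list_mult W u)"
  by (induction u) (auto simp: list_mult_append list_mult_closed S_closed inv_mult_group inv_S)

lemma list_mult_front:
  assumes "front s u" "s \<in> S" "set u \<subseteq> S"
  shows "list_mult W u = s \<otimes> list_mult W (remove1 s u)"
  using assms
proof (induction u)
  case (Cons t u)
  show ?case
  proof (cases "t = s")
    case False
    then have st: "m s t = 2" "front s u" "t \<in> S" "set u \<subseteq> S" using Cons.prems by auto
    have c: "list_mult W (remove1 s u) \<in> carrier W"
      using st lists_remove1 list_mult_closed by blast
    have "t \<otimes> (s \<otimes> list_mult W (remove1 s u)) = s \<otimes> (t \<otimes> list_mult W (remove1 s u))"
      using m_2_commute[of s t] st Cons.prems S_closed c by (metis m_assoc)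
    then show ?thesis using Cons False st by simp
  qed simp
qed simp

lemma list_mult_act:
  assumes "s \<in> S" "set u \<subseteq> S"
  shows "list_mult W (act s u) = s \<otimes> list_mult W u"
  using assms list_mult_front[of s u] S_cancel list_mult_closed[OF lists_remove1]
  by (auto simp: act_def)

lemma list_mult_acts: "set w \<subseteq> S \<Longrightarrow> list_mult W (acts w []) = list_mult W w"
  by (induction w) (auto simp: list_mult_act acts_props)

text \<open>The word \<open>u\<close> preceded by the reverse of \<open>v\<close> represents the neutral element, so by the
  presentation it acts trivially on the empty word; on the other hand \<open>u\<close> takes the empty word to
  \<open>u\<close>, and the reverse of \<open>v\<close> undoes the action of \<open>v\<close>.\<close>

theorem red_unique:
  assumes u: "set u \<subseteq> S" "red u" and v: "set v \<subseteq> S" "red v"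
    and eq: "list_mult W u = list_mult W v"
  shows "eqv u v"
proof -
  define z where "z = map (\<lambda>s. (s, True)) (rev v @ u)"
  have zl: "z \<in> lists (S \<times> UNIV)" using u v by (auto simp: z_def lists_eq_set)
  have zf: "map fst z = rev v @ u" by (simp add: z_def comp_def)
  have "word_value W z = list_mult W (rev v @ u)"
    by (simp add: word_value_def z_def comp_def)
  also have "\<dots> = \<one>" using u v eq by (simp add: list_mult_append list_mult_rev list_mult_closed)
  finally have "equivclp (presentation_step S (coxeter_relators S m)) z []"
    using presentation zl by (auto simp: has_presentation_def)
  from equivclp_acts[OF this] have 1: "eqv (acts (rev v) u) []"
    using acts_red u by (simp add: zf)
  have rv: "set (rev v) \<subseteq> S" using v by auto
  have "eqv u (acts v (acts (rev v) u))" using acts_rev_acts v u eqv_sym by blast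
  also have "eqv (acts v (acts (rev v) u)) (acts v [])"
    using v u 1 rv by (intro acts_cong acts_props) auto
  finally show ?thesis using acts_red v by simp
qed

lemma word_exists:
  assumes "w \<in> carrier W"
  shows "\<exists>u. set u \<subseteq> S \<and> list_mult W u = w"
proof -
  have "w \<in> generate W S" using assms presentation by (simp add: has_presentation_def)
  then show ?thesis
  proof (induction rule: generate.induct)
    case one
    show ?case by (rule exI[of _ "[]"]) auto
  next
    case (incl s)
    then show ?case by (intro exI[of _ "[s]"]) (auto simp: S_closed)
  next
    case (inv s)
    then show ?case by (intro exI[of _ "[s]"]) (auto simp: S_closed inv_S)
  next
    case (eng g h)
    then obtain u v where "set u \<subseteq> S" "list_mult W u = g" "set v \<subseteq> S" "list_mult W v = h" by blast
    then show ?case by (intro exI[of _ "u @ v"]) (auto simp: list_mult_append)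
  qed
qed

lemma red_exists:
  assumes "w \<in> carrier W"
  obtains u where "set u \<subseteq> S" "red u" "list_mult W u = w"
proof -
  obtain u where u: "set u \<subseteq> S" "list_mult W u = w" using word_exists[OF assms] by blast
  have "set (acts u []) \<subseteq> S" "red (acts u [])" using acts_props[OF u(1), of "[]"] by auto
  then show ?thesis using that[of "acts u []"] list_mult_acts[OF u(1)] u(2) by simp
qed

abbreviation len :: "'a \<Rightarrow> nat" where "len w \<equiv> word_length W S w"

lemma len_red:
  assumes "set u \<subseteq> S" "red u"
  shows "len (list_mult W u) = length u"
  unfolding word_length_def lists_eq_set
proof (rule Least_equality)
  show "\<exists>ss\<in>{x. set x \<subseteq> S}. length ss = length u \<and> list_mult W ss = list_mult W u" using assms by blast
next
  fix n assume "\<exists>ss\<in>{x. set x \<subseteq> S}. length ss = n \<and> list_mult W ss = list_mult W u"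
  then obtain v where v: "set v \<subseteq> S" "length v = n" "list_mult W v = list_mult W u" by blast
  have a: "set (acts v []) \<subseteq> S" "red (acts v [])" using acts_props[OF v(1), of "[]"] by auto
  have "eqv (acts v []) u" by (rule red_unique) (use a assms list_mult_acts v in auto)
  then have "length (acts v []) = length u" using eqv_set(3) a assms by blast
  then show "length u \<le> n" using acts_length(1)[of v] v by simp
qed

lemma len_le: 
  assumes "set u \<subseteq> S" shows "len (list_mult W u) \<le> length u"
  using acts_length(1)[of u] len_red[of "acts u []"] acts_props[OF assms, of "[]"] list_mult_acts[OF assms]
  by simp

lemma red_iff_len:
  assumes "set u \<subseteq> S" shows "red u \<longleftrightarrow> len (list_mult W u) = length u"
  using acts_length(2)[OF _ assms] len_red[of "acts u []"] acts_props[OF assms, of "[]"]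
    list_mult_acts[OF assms] len_red[OF assms]
  by (cases "red u") auto

lemma reduced_word_iff:
  "reduced_word W S w u \<longleftrightarrow> set u \<subseteq> S \<and> red u \<and> list_mult W u = w"
  unfolding reduced_word_def lists_eq_set mem_Collect_eq using red_iff_len[of u] by auto

lemma len_one: "len \<one> = 0" using len_red[of "[]"] by simp

lemma len_eq_0: "w \<in> carrier W \<Longrightarrow> len w = 0 \<longleftrightarrow> w = \<one>"
  using len_one len_red by (metis length_0_conv list_mult_simps(1) red_exists)

lemma len_mult_le:
  assumes "v \<in> carrier W" "w \<in> carrier W" shows "len (v \<otimes> w) \<le> len v + len w"
proof -
  obtain a b where "set a \<subseteq> S" "red a" "list_mult W a = v" "set b \<subseteq> S" "red b" "list_mult W b = w"
    using red_exists assms by metis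
  then show ?thesis using len_le[of "a @ b"] len_red[of a] len_red[of b] by (simp add: list_mult_append)
qed

lemma len_inv:
  assumes "w \<in> carrier W" shows "len (inv w) = len w"
proof -
  have le: "len (inv v) \<le> len v" if v: "v \<in> carrier W" for v
  proof -
    obtain a where a: "set a \<subseteq> S" "red a" "list_mult W a = v" using red_exists[OF v] by blast
    then show ?thesis using len_le[of "rev a"] len_red[of a] by (simp add: list_mult_rev)
  qed
  show ?thesis using le[OF assms] le[of "inv w"] assms by simp
qed

lemma descent_iff_front:
  assumes "s \<in> S" "set u \<subseteq> S" "red u"
  shows "len (s \<otimes> list_mult W u) < len (list_mult W u) \<longleftrightarrow> front s u"
    and "front s u \<Longrightarrow> Suc (len (s \<otimes> list_mult W u)) = len (list_mult W u)"
    and "\<not> front s u \<Longrightarrow> len (s \<otimes> list_mult W u) = Suc (len (list_mult W u))"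
proof -
  have l: "len (s \<otimes> list_mult W u) = length (act s u)"
    using len_red[of "act s u"] act_lists act_red assms list_mult_act by metis
  have r: "Suc (length (remove1 s u)) = length u" if "front s u"
    using front_set[OF that] by (simp add: length_remove1) (metis Suc_pred length_pos_if_in_set)
  show 2: "front s u \<Longrightarrow> Suc (len (s \<otimes> list_mult W u)) = len (list_mult W u)"
    using l r len_red assms by (simp add: act_def)
  show 3: "\<not> front s u \<Longrightarrow> len (s \<otimes> list_mult W u) = Suc (len (list_mult W u))"
    using l len_red assms by (simp add: act_def)
  show "len (s \<otimes> list_mult W u) < len (list_mult W u) \<longleftrightarrow> front s u"
    using 2 3 by fastforce
qed

lemma len_S_mult:
  assumes "s \<in> S" "w \<in> carrier W"
  shows "len (s \<otimes> w) = Suc (len w) \<or> Suc (len (s \<otimes> w)) = len w"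
proof -
  obtain u where "set u \<subseteq> S" "red u" "list_mult W u = w" using red_exists assms by blast
  then show ?thesis using descent_iff_front[of s u] assms by metis
qed

text \<open>The following lemmas translate between words and group elements: a concatenation is reduced
  when lengths add up, and a letter reaches the front by starting in the left word or passing
  through it.\<close>

lemma red_append_iff:
  assumes "set a \<subseteq> S" "set b \<subseteq> S" "red a" "red b"
  shows "red (a @ b) \<longleftrightarrow>
    len (list_mult W a \<otimes> list_mult W b) = len (list_mult W a) + len (list_mult W b)"
  using red_iff_len[of "a @ b"] assms len_red by (simp add: list_mult_append)

lemma red_appendD: "red (a @ b) \<Longrightarrow> red b"
  by (induction a) auto

lemma front_append:
  "front s (a @ b) \<longleftrightarrow> front s a \<or> (\<forall>c\<in>set a. m s c = 2) \<and> front s b"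
  by (induction a) auto

end

subsection \<open>Common prefixes\<close>

locale square_free_coxeter = right_angled_coxeter +
  assumes fin_S: "finite S" and no_square: "\<not> has_induced_square S m"
begin

text \<open>The first letter \<open>s\<close> of \<open>a\<close> is in front of the common word but not of \<open>b\<close>, so it has to pass
  through \<open>b\<close> and commutes with all letters of \<open>b\<close>. Removing it, one argues in the same way for the
  next letter of \<open>a\<close>.\<close>

lemma prefixes_commute:
  assumes "set a \<subseteq> S" "set b \<subseteq> S" "set a' \<subseteq> S" "set b' \<subseteq> S"
    and "eqv (a @ a') (b @ b')" and "\<And>s. s \<in> S \<Longrightarrow> front s a \<Longrightarrow> \<not> front s b"
  shows "\<forall>s\<in>set a. \<forall>t\<in>set b. m s t = 2"
  using assms
proof (induction a arbitrary: b')
  case (Cons s a)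
  have s: "s \<in> S" "set a \<subseteq> S" using Cons.prems by auto
  have "front s (b @ b')"
    using front_cong[OF Cons.prems(5) _ _ s(1)] Cons.prems by auto
  then have c: "\<forall>t\<in>set b. m s t = 2" and f: "front s b'"
    using Cons.prems(6)[OF s(1)] by (auto simp: front_append)
  have sb: "s \<notin> set b" using c m_self_ne_2 s by auto
  have "eqv (remove1 s ((s # a) @ a')) (remove1 s (b @ b'))"
    using Cons.prems(5) by (rule eqv_remove1)
  then have "eqv (a @ a') (b @ remove1 s b')" using sb by (simp add: remove1_append)
  moreover have "\<not> front t b" if "t \<in> S" "front t a" for t
  proof
    assume t: "front t b"
    then have "m t s = 2" using c front_set m_sym s that by metis
    then have "front t (s # a)" using that by simp
    then show False using Cons.prems(6) that t by blast
  qed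
  ultimately have "\<forall>s\<in>set a. \<forall>t\<in>set b. m s t = 2"
    using Cons.prems s lists_remove1[of b' s] by (intro Cons.IH) simp_all
  then show ?case using c by simp
qed simp

text \<open>Splitting off common first letters as long as there are any.\<close>

lemma prefixes_meet:
  assumes "set a \<subseteq> S" "set b \<subseteq> S" "set a' \<subseteq> S" "set b' \<subseteq> S"
    and "eqv (a @ a') (b @ b')"
  shows "\<exists>z x y. set z \<subseteq> S \<and> set x \<subseteq> S \<and> set y \<subseteq> S \<and> eqv a (z @ x) \<and> eqv b (z @ y) \<and>
    (\<forall>s\<in>set x. \<forall>t\<in>set y. m s t = 2)"
  using assms
proof (induction "length a" arbitrary: a b)
  case 0
  then show ?case by (intro exI[of _ "[]"] exI[of _ b]) auto
next
  case (Suc n)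
  show ?case
  proof (cases "\<exists>s\<in>S. front s a \<and> front s b")
    case False
    then have "\<forall>s\<in>set a. \<forall>t\<in>set b. m s t = 2"
      using prefixes_commute[of a b a' b'] Suc.prems by blast
    then show ?thesis using Suc.prems by (intro exI[of _ "[]"] exI[of _ a] exI[of _ b]) auto
  next
    case True
    then obtain s where s: "s \<in> S" "front s a" "front s b" by blast
    let ?a = "remove1 s a" and ?b = "remove1 s b"
    have l: "set ?a \<subseteq> S" "set ?b \<subseteq> S" using Suc.prems lists_remove1 by auto
    have ea: "eqv a (s # ?a)" and eb: "eqv b (s # ?b)" using front_eqv s Suc.prems by auto
    have "eqv (remove1 s (a @ a')) (remove1 s (b @ b'))" using Suc.prems by (intro eqv_remove1)
    then have "eqv (?a @ a') (?b @ b')" using s front_set by (simp add: remove1_append)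
    moreover have "n = length ?a" using Suc(2) front_set[OF s(2)] by (simp add: length_remove1)
    ultimately obtain z x y where z: "set z \<subseteq> S" "set x \<subseteq> S" "set y \<subseteq> S" "eqv ?a (z @ x)"
      "eqv ?b (z @ y)" "\<forall>s\<in>set x. \<forall>t\<in>set y. m s t = 2"
      using Suc.hyps(1)[of ?a ?b] l Suc.prems by blast
    have "eqv a ((s # z) @ x)" "eqv b ((s # z) @ y)"
      using eqv_trans[OF ea eqv_Cons[OF z(4)]] eqv_trans[OF eb eqv_Cons[OF z(5)]] by auto
    then show ?thesis using z s by (intro exI[of _ "s # z"] exI[of _ x] exI[of _ y]) auto
  qed
qed

lemma red_clique_length:
  assumes "set u \<subseteq> S" "red u" "\<And>s t. s \<in> set u \<Longrightarrow> t \<in> set u \<Longrightarrow> s \<noteq> t \<Longrightarrow> m s t = 2"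
  shows "distinct u" "length u \<le> card S"
proof -
  have f: "front s u" if "s \<in> set u" "\<And>t. t \<in> set u \<Longrightarrow> s \<noteq> t \<Longrightarrow> m s t = 2" for s u
    using that by (induction u) auto
  show d: "distinct u"
    using assms
  proof (induction u)
    case (Cons s u)
    have "s \<notin> set u" using f[of s u] Cons.prems by auto
    then show ?case using Cons by auto
  qed simp
  have "length u = card (set u)" using d by (simp add: distinct_card)
  also have "\<dots> \<le> card S" using assms(1) fin_S by (intro card_mono) auto
  finally show "length u \<le> card S" .
qed

lemma eqv_red: "eqv u v \<Longrightarrow> set u \<subseteq> S \<Longrightarrow> set v \<subseteq> S \<Longrightarrow> list_mult W u = list_mult W v"
proof (induction u arbitrary: v)
  case Nil
  then show ?case using eqv_set(3)[of "[]" v] by simp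
next
  case (Cons s u)
  have s: "s \<in> S" "set u \<subseteq> S" using Cons.prems by auto
  have f: "front s v" using front_cong[OF Cons.prems s(1)] by simp
  have "eqv u (remove1 s v)" using eqv_remove1[OF Cons.prems(1), of s] by simp
  then have "list_mult W u = list_mult W (remove1 s v)"
    using Cons.IH s lists_remove1 Cons.prems by blast
  then show ?case using list_mult_front[OF f s(1)] Cons.prems by simp
qed

text \<open>This is where the absence of squares enters: two prefixes of the same length differ by commuting
  words, one of which consists of pairwise commuting letters because otherwise there would be an
  induced square, and is therefore short.\<close>

theorem prefixes_close:
  assumes x: "x \<in> carrier W" "len w = len x + len (inv x \<otimes> w)"
    and y: "y \<in> carrier W" "len w = len y + len (inv y \<otimes> w)"
    and w: "w \<in> carrier W" and xy: "len x = len y"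
  shows "len (inv x \<otimes> y) \<le> 2 * card S"
proof -
  obtain a where a: "set a \<subseteq> S" "red a" "list_mult W a = x" using red_exists[OF x(1)] by blast
  obtain b where b: "set b \<subseteq> S" "red b" "list_mult W b = y" using red_exists[OF y(1)] by blast
  obtain a' where a': "set a' \<subseteq> S" "red a'" "list_mult W a' = inv x \<otimes> w"
    using red_exists[of "inv x \<otimes> w"] x w by auto
  obtain b' where b': "set b' \<subseteq> S" "red b'" "list_mult W b' = inv y \<otimes> w"
    using red_exists[of "inv y \<otimes> w"] y w by auto
  have cx: "x \<otimes> (inv x \<otimes> w) = w" and cy: "y \<otimes> (inv y \<otimes> w) = w"
    using x y w by (simp_all flip: m_assoc)
  have ra: "red (a @ a')" "red (b @ b')"
    using red_append_iff[of a a'] red_append_iff[of b b'] a b a' b' x y cx cy by auto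
  have "eqv (a @ a') (b @ b')"
    using ra a b a' b' cx cy by (intro red_unique) (auto simp: list_mult_append)
  then obtain z p r where z: "set z \<subseteq> S" "set p \<subseteq> S" "set r \<subseteq> S" "eqv a (z @ p)" "eqv b (z @ r)"
    and comm: "\<And>s t. s \<in> set p \<Longrightarrow> t \<in> set r \<Longrightarrow> m s t = 2"
    using prefixes_meet[of a b a' b'] a b a' b' by blast
  have la: "list_mult W (z @ p) = x" "list_mult W (z @ r) = y"
    using eqv_red[OF z(4)] eqv_red[OF z(5)] a b z by auto
  have len: "length a = length (z @ p)" "length b = length (z @ r)"
    using eqv_set(3)[OF z(4)] eqv_set(3)[OF z(5)] a b z by auto
  have lx: "length a = len x" "length b = len y" using len_red a b by auto
  have rp: "red (z @ p)" "red (z @ r)" using red_iff_len[of "z @ p"] red_iff_len[of "z @ r"] la len lx z by auto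
  then have red: "red p" "red r" using red_appendD by blast+
  have pr: "length p = length r" using len lx xy by simp
  have "length p \<le> card S"
  proof (cases "\<forall>s\<in>set p. \<forall>t\<in>set p. s \<noteq> t \<longrightarrow> m s t = 2")
    case True
    then show ?thesis using red_clique_length(2)[OF z(2) red(1)] by blast
  next
    case False
    then obtain s1 s3 where s: "s1 \<in> set p" "s3 \<in> set p" "s1 \<noteq> s3" "m s1 s3 \<noteq> 2" by blast
    have sS: "s1 \<in> S" "s3 \<in> S" using s z by auto
    have "m t u = 2" if tu: "t \<in> set r" "u \<in> set r" "t \<noteq> u" for t u
    proof (rule ccontr)
      assume "m t u \<noteq> 2"
      have tS: "t \<in> S" "u \<in> S" using tu z by auto
      have "m s1 t = 2 \<and> m t s3 = 2 \<and> m s3 u = 2 \<and> m u s1 = 2"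
        using comm[OF s(1) tu(1)] comm[OF s(2) tu(1)] comm[OF s(2) tu(2)] comm[OF s(1) tu(2)]
          m_sym sS tS by metis
      moreover have "m s1 s3 = \<infinity>" "m t u = \<infinity>"
        using m_cases[OF sS s(3,4)] m_cases[OF tS tu(3) \<open>m t u \<noteq> 2\<close>] by auto
      ultimately show False using no_square sS tS unfolding has_induced_square_def by blast
    qed
    then show ?thesis using red_clique_length(2)[OF z(3) red(2)] pr by auto
  qed
  moreover have "inv x \<otimes> y = inv (list_mult W p) \<otimes> list_mult W r"
    using la z by (simp add: list_mult_append list_mult_closed inv_mult_group m_assoc flip: la)
       (metis (no_types, lifting) inv_closed l_inv l_one list_mult_closed m_assoc m_closed)
  moreover have "len (inv (list_mult W p) \<otimes> list_mult W r) \<le> length p + length r"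
    using len_mult_le[of "inv (list_mult W p)" "list_mult W r"] len_inv[of "list_mult W p"]
      len_le[OF z(2)] len_le[OF z(3)] list_mult_closed[OF z(2)] list_mult_closed[OF z(3)] by simp
  ultimately show ?thesis using pr by simp
qed

lemma finite_ball: "finite {w \<in> carrier W. len w \<le> n}"
proof -
  have "{w \<in> carrier W. len w \<le> n} \<subseteq> list_mult W ` {u. set u \<subseteq> S \<and> length u \<le> n}"
  proof
    fix w assume w: "w \<in> {w \<in> carrier W. len w \<le> n}"
    then obtain u where "set u \<subseteq> S" "red u" "list_mult W u = w" using red_exists by blast
    then show "w \<in> list_mult W ` {u. set u \<subseteq> S \<and> length u \<le> n}" using len_red[of u] w by auto
  qed
  then show ?thesis
    using finite_lists_length_le[OF fin_S, of n] finite_subset by blast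
qed

text \<open>By closeness, a quotient of two prefixes of the same length lies in a fixed ball, and one of the two
  prefixes together with the quotient determines the other.\<close>

definition prefix_bound :: nat where
  "prefix_bound = card {w \<in> carrier W. len w \<le> 2 * card S}"

lemma card_prefixes:
  assumes w: "w \<in> carrier W"
  shows "finite {x \<in> carrier W. len x = i \<and> len w = len x + len (inv x \<otimes> w)}" (is "finite ?P")
    and "card {x \<in> carrier W. len x = i \<and> len w = len x + len (inv x \<otimes> w)} \<le> prefix_bound"
proof -
  show fin: "finite ?P" by (rule finite_subset[OF _ finite_ball[of i]]) auto
  show "card ?P \<le> prefix_bound"
  proof (cases "?P = {}")
    case False
    then obtain x where x: "x \<in> ?P" by blast
    have xc: "x \<in> carrier W" "len x = i" "len w = len x + len (inv x \<otimes> w)" using x by blast+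
    have "inj_on (\<lambda>y. inv x \<otimes> y) ?P"
    proof (rule inj_onI)
      fix y z assume "y \<in> ?P" "z \<in> ?P" and e: "inv x \<otimes> y = inv x \<otimes> z"
      then have "y \<in> carrier W" "z \<in> carrier W" by blast+
      then show "y = z" using e Units_l_cancel[of "inv x" y z] xc(1) Units_eq by simp
    qed
    moreover have "(\<lambda>y. inv x \<otimes> y) ` ?P \<subseteq> {w \<in> carrier W. len w \<le> 2 * card S}"
    proof safe
      fix y assume y: "y \<in> carrier W" "len w = len y + len (inv y \<otimes> w)" "i = len y"
      show "len (inv x \<otimes> y) \<le> 2 * card S"
        by (rule prefixes_close[OF xc(1,3) y(1,2) w]) (simp only: xc y)
    next
      fix y assume "y \<in> carrier W"
      then show "inv x \<otimes> y \<in> carrier W" using x by blast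
    qed
    ultimately show ?thesis
      unfolding prefix_bound_def using card_inj_on_le finite_ball by blast
  next
    case True
    then show ?thesis by (simp only: card.empty le0)
  qed
qed

end

lemma sum_le_image:
  fixes f :: "'x \<Rightarrow> real" and g :: "'y \<Rightarrow> real"
  assumes "finite B" "inj_on h A" "h ` A \<subseteq> B" "\<And>x. x \<in> A \<Longrightarrow> f x \<le> g (h x)" "\<And>y. y \<in> B \<Longrightarrow> 0 \<le> g y"
  shows "sum f A \<le> sum g B"
proof -
  have "sum f A \<le> (\<Sum>x\<in>A. g (h x))" using assms(4) by (rule sum_mono)
  also have "\<dots> = sum g (h ` A)" using sum.reindex[OF assms(2), of g] by simp
  also have "\<dots> \<le> sum g B" using assms by (intro sum_mono2) auto
  finally show ?thesis .
qed

context square_free_coxeter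
begin

lemma commuting_word:
  assumes "set u \<subseteq> S" "s \<in> S" "\<forall>c\<in>set u. m s c = 2"
  shows "s \<otimes> list_mult W u = list_mult W u \<otimes> s"
  using assms
proof (induction u)
  case (Cons c u)
  have c: "c \<in> carrier W" "s \<in> carrier W" "list_mult W u \<in> carrier W"
    using Cons.prems S_closed list_mult_closed by auto
  have "s \<otimes> (c \<otimes> list_mult W u) = c \<otimes> (s \<otimes> list_mult W u)"
    using m_2_commute[of s c] Cons.prems c by (simp flip: m_assoc)
  also have "\<dots> = c \<otimes> (list_mult W u \<otimes> s)" using Cons by simp
  finally show ?case using c by (simp add: m_assoc)
qed (simp add: S_closed)

lemma descent_commute:
  assumes "s \<in> S" "t \<in> S" "m s t = 2" "w \<in> carrier W"
  shows "len (t \<otimes> (s \<otimes> w)) < len (s \<otimes> w) \<longleftrightarrow> len (t \<otimes> w) < len w"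
proof -
  obtain u where u: "set u \<subseteq> S" "red u" "list_mult W u = w" using red_exists assms(4) by blast
  have ts: "m t s = 2" using assms m_sym by simp
  have a: "set (act s u) \<subseteq> S" "red (act s u)" "list_mult W (act s u) = s \<otimes> w"
    using act_lists act_red list_mult_act u assms by auto
  have "front t (act s u) = front t u"
    using front_remove1_commute[OF assms(2) ts] front_Cons_commute[OF assms(2) ts] by (simp add: act_def)
  then show ?thesis
    using descent_iff_front(1)[OF assms(2) u(1,2)] descent_iff_front(1)[OF assms(2) a(1,2)] u a by simp
qed

text \<open>For concatenated reduced words, the letter \<open>s\<close> reaches the front by passing through the left
  word, as it is not in front of that word itself.\<close>

lemma descent_through:
  assumes s: "s \<in> S" and a: "a \<in> carrier W" and g: "g \<in> carrier W"
    and red: "len (a \<otimes> g) = len a + len g"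
    and desc: "len (s \<otimes> (a \<otimes> g)) < len (a \<otimes> g)" and ndesc: "\<not> len (s \<otimes> a) < len a"
  shows "len (s \<otimes> g) < len g" "s \<otimes> a = a \<otimes> s"
    "\<And>u. set u \<subseteq> S \<Longrightarrow> red u \<Longrightarrow> list_mult W u = a \<Longrightarrow> \<forall>c\<in>set u. m s c = 2"
proof -
  have *: "(\<forall>c\<in>set u. m s c = 2) \<and> len (s \<otimes> g) < len g"
    if u: "set u \<subseteq> S" "red u" "list_mult W u = a" for u
  proof -
    obtain v where v: "set v \<subseteq> S" "red v" "list_mult W v = g" using red_exists g by blast
    have uv: "red (u @ v)" using red_append_iff[of u v] u v red by simp
    have "front s (u @ v)"
      using descent_iff_front(1)[OF s _ uv] u v desc by (simp add: list_mult_append)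
    moreover have "\<not> front s u" using descent_iff_front(1)[OF s u(1,2)] u ndesc by simp
    ultimately show ?thesis
      using descent_iff_front(1)[OF s v(1,2)] v by (simp add: front_append)
  qed
  obtain u where u: "set u \<subseteq> S" "red u" "list_mult W u = a" using red_exists a by blast
  show "len (s \<otimes> g) < len g" using * u by blast
  show "s \<otimes> a = a \<otimes> s" using commuting_word[OF u(1) s] * u by auto
  show "\<And>u. set u \<subseteq> S \<Longrightarrow> red u \<Longrightarrow> list_mult W u = a \<Longrightarrow> \<forall>c\<in>set u. m s c = 2" using * by blast
qed

text \<open>The products of pairwise commuting letters, which are involutions of bounded length. They will
  be the parts of group elements on which the Hecke deformation is visible.\<close>

definition clique :: "'a \<Rightarrow> bool" where
  "clique t \<longleftrightarrow> (\<exists>c. set c \<subseteq> S \<and> red c \<and> list_mult W c = t \<and>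
     (\<forall>x\<in>set c. \<forall>y\<in>set c. x \<noteq> y \<longrightarrow> m x y = 2))"

lemma clique_carrier: "clique t \<Longrightarrow> t \<in> carrier W"
  by (auto simp: clique_def list_mult_closed)

lemma clique_one: "clique \<one>"
  unfolding clique_def by (rule exI[of _ "[]"]) simp

lemma clique_len: "clique t \<Longrightarrow> len t \<le> card S"
  unfolding clique_def using red_clique_length(2) len_red by fastforce

lemma clique_square:
  assumes "clique t" shows "t \<otimes> t = \<one>"
proof -
  obtain c where c: "set c \<subseteq> S" "red c" "list_mult W c = t"
    "\<forall>x\<in>set c. \<forall>y\<in>set c. x \<noteq> y \<longrightarrow> m x y = 2"
    using assms by (auto simp: clique_def)
  have "list_mult W c \<otimes> list_mult W c = \<one>"
    using c(1,2,4)
  proof (induction c)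
    case (Cons s c)
    let ?t = "list_mult W c"
    have cl: "s \<in> carrier W" "?t \<in> carrier W" using Cons.prems S_closed list_mult_closed by auto
    have "s \<notin> set c" using red_clique_length(1)[of "s # c"] Cons.prems by auto
    then have "s \<otimes> ?t = ?t \<otimes> s" using Cons.prems by (intro commuting_word) auto
    then have "(s \<otimes> ?t) \<otimes> (s \<otimes> ?t) = (s \<otimes> (s \<otimes> (?t \<otimes> ?t)))"
      using cl by (metis m_assoc m_closed)
    also have "\<dots> = \<one>" using Cons S_square cl by simp
    finally show ?case by simp
  qed simp
  then show ?thesis using c by simp
qed

lemma clique_cancel: "clique t \<Longrightarrow> w \<in> carrier W \<Longrightarrow> t \<otimes> (t \<otimes> w) = w"
  using clique_square clique_carrier by (metis l_one m_assoc)

lemma clique_mult: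
  assumes t: "clique t" and s: "s \<in> S" and ndesc: "\<not> len (s \<otimes> t) < len t"
    and comm: "\<And>u. set u \<subseteq> S \<Longrightarrow> red u \<Longrightarrow> list_mult W u = t \<Longrightarrow> \<forall>c\<in>set u. m s c = 2"
  shows "clique (s \<otimes> t)"
proof -
  obtain c where c: "set c \<subseteq> S" "red c" "list_mult W c = t"
    "\<forall>x\<in>set c. \<forall>y\<in>set c. x \<noteq> y \<longrightarrow> m x y = 2"
    using t by (auto simp: clique_def)
  have sc: "\<forall>x\<in>set c. m s x = 2 \<and> m x s = 2" using comm[OF c(1-3)] m_sym s c(1) by (metis subsetD)
  have "\<not> front s c" using descent_iff_front(1)[OF s c(1,2)] ndesc c(3) by simp
  then show ?thesis
    unfolding clique_def using c s sc by (intro exI[of _ "s # c"]) auto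
qed

end

section \<open>The Hecke algebra\<close>

lemma adjoint_entries:
  assumes T: "T \<in> bounded_operators I" and U: "U \<in> bounded_operators I"
    and eq: "\<And>x y. x \<in> I \<Longrightarrow> y \<in> I \<Longrightarrow> U (delta x) y = cnj (T (delta y) x)"
  shows "adjoint_operator I T = U"
  unfolding adjoint_operator_eq[OF T]
proof (rule op_eqI_delta[OF matrix_adjoint_bounded[OF T] U])
  fix x assume x: "x \<in> I"
  show "matrix_adjoint I T (delta x) = U (delta x)"
  proof
    fix y
    show "matrix_adjoint I T (delta x) y = U (delta x) y"
    proof (cases "y \<in> I")
      case True
      then have "matrix_adjoint I T (delta x) y = cnj (ell2_inner I (delta x) (T (delta y)))"
        using x by (simp add: matrix_adjoint_def delta_in_ell2 ell2_inner_cnj)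
      then show ?thesis using eq[OF x True] ell2_inner_delta[OF x, of "T (delta y)"] by simp
    next
      case False
      then show ?thesis using x ell2_outside[OF op_closed[OF U delta_in_ell2[OF x]]]
        by (simp add: matrix_adjoint_def delta_in_ell2)
    qed
  qed
qed

locale hecke_system = square_free_coxeter +
  fixes q :: "'a \<Rightarrow> real"
begin

definition Op :: "'a operator star_algebra" where
  "Op = operator_algebra (carrier W)"

lemma Op_carrier: "carrier Op = bounded_operators (carrier W)" by (simp add: Op_def)

sublocale B: unital_cstar_algebra Op
  unfolding Op_def by (rule cstar_operator_algebra)

abbreviation p :: "'a \<Rightarrow> complex" where "p s \<equiv> complex_of_real (hecke_p q s)"
abbreviation gen :: "'a \<Rightarrow> 'a operator" where "gen s \<equiv> hecke_generator W S q s"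
abbreviation T :: "'a \<Rightarrow> 'a operator" where "T w \<equiv> hecke_basis W S q w"
abbreviation desc :: "'a \<Rightarrow> 'a \<Rightarrow> bool" where "desc s w \<equiv> len (s \<otimes> w) < len w"
abbreviation l2 :: "('a \<Rightarrow> complex) set" where "l2 \<equiv> ell2 (carrier W)"

lemma gen_bounded: "s \<in> S \<Longrightarrow> gen s \<in> bounded_operators (carrier W)"
  by (rule hecke_generator_bounded)

lemma gen_carrier: "s \<in> S \<Longrightarrow> gen s \<in> carrier Op"
  by (simp add: gen_bounded Op_carrier)

lemma gen_apply:
  "f \<in> l2 \<Longrightarrow> w \<in> carrier W \<Longrightarrow> gen s f w = f (s \<otimes> w) + (if desc s w then p s * f w else 0)"
  by (simp add: hecke_generator_def)

lemma Op_mult_apply: "f \<in> l2 \<Longrightarrow> (x \<otimes>\<^bsub>Op\<^esub> y) f = x (y f)"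
  by (simp add: Op_def compose_def)

lemma Op_add_apply: "f \<in> l2 \<Longrightarrow> (x \<oplus>\<^bsub>Op\<^esub> y) f = (\<lambda>v. x f v + y f v)"
  by (simp add: Op_def)

lemma Op_smult_apply: "f \<in> l2 \<Longrightarrow> (c \<odot>\<^bsub>Op\<^esub> x) f = (\<lambda>v. c * x f v)"
  by (simp add: Op_def)

lemma Op_one_apply: "f \<in> l2 \<Longrightarrow> \<one>\<^bsub>Op\<^esub> f = f"
  by (simp add: Op_def)

lemma Op_zero_apply: "f \<in> l2 \<Longrightarrow> \<zero>\<^bsub>Op\<^esub> f = (\<lambda>v. 0)"
  by (simp add: Op_def)

lemma Op_apply_closed: "x \<in> carrier Op \<Longrightarrow> f \<in> l2 \<Longrightarrow> x f \<in> l2"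
  by (simp add: Op_carrier op_closed)

lemma Op_eqI:
  assumes "x \<in> carrier Op" "y \<in> carrier Op"
    and "\<And>f w. f \<in> l2 \<Longrightarrow> w \<in> carrier W \<Longrightarrow> x f w = y f w"
  shows "x = y"
proof (rule op_ext)
  show "x f = y f" if f: "f \<in> l2" for f
  proof
    fix w show "x f w = y f w"
    proof (cases "w \<in> carrier W")
      case False
      then show ?thesis
        using ell2_outside[OF Op_apply_closed[OF assms(1) f]] ell2_outside[OF Op_apply_closed[OF assms(2) f]]
        by simp
    qed (rule assms(3)[OF f])
  qed
qed (use assms op_extensional in \<open>auto simp: Op_carrier\<close>)

lemma gen_commute:
  assumes s: "s \<in> S" and t: "t \<in> S" and 2: "m s t = 2"
  shows "gen s \<otimes>\<^bsub>Op\<^esub> gen t = gen t \<otimes>\<^bsub>Op\<^esub> gen s"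
proof (rule Op_eqI)
  fix f w assume f: "f \<in> l2" and w: "w \<in> carrier W"
  have ts: "m t s = 2" using 2 s t m_sym by simp
  have c: "s \<otimes> w \<in> carrier W" "t \<otimes> w \<in> carrier W" using S_closed s t w by auto
  have st: "t \<otimes> (s \<otimes> w) = s \<otimes> (t \<otimes> w)"
    using m_2_commute[OF s t 2] S_closed s t w by (simp flip: m_assoc)
  show "(gen s \<otimes>\<^bsub>Op\<^esub> gen t) f w = (gen t \<otimes>\<^bsub>Op\<^esub> gen s) f w"
    using f w c st descent_commute[OF s t 2 w] descent_commute[OF t s ts w]
      op_closed[OF gen_bounded[OF s] f] op_closed[OF gen_bounded[OF t] f]
    by (simp add: Op_mult_apply gen_apply algebra_simps)
qed (auto intro!: B.A_m_closed gen_carrier s t)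

lemma gen_square:
  assumes s: "s \<in> S"
  shows "gen s \<otimes>\<^bsub>Op\<^esub> gen s = \<one>\<^bsub>Op\<^esub> \<oplus>\<^bsub>Op\<^esub> p s \<odot>\<^bsub>Op\<^esub> gen s"
proof (rule Op_eqI)
  fix f w assume f: "f \<in> l2" and w: "w \<in> carrier W"
  have c: "s \<otimes> w \<in> carrier W" using S_closed s w by auto
  have d: "desc s (s \<otimes> w) \<longleftrightarrow> \<not> desc s w"
    using len_S_mult[OF s w] S_cancel[OF s w] by auto
  show "(gen s \<otimes>\<^bsub>Op\<^esub> gen s) f w = (\<one>\<^bsub>Op\<^esub> \<oplus>\<^bsub>Op\<^esub> p s \<odot>\<^bsub>Op\<^esub> gen s) f w"
    using f w c d S_cancel[OF s w] op_closed[OF gen_bounded[OF s] f]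
    by (auto simp: Op_mult_apply Op_add_apply Op_smult_apply Op_one_apply gen_apply algebra_simps)
qed (auto intro!: B.A_m_closed B.A_a_closed B.A_one_closed gen_carrier s)

definition Tword :: "'a list \<Rightarrow> 'a operator" where
  "Tword u = list_mult Op (map gen u)"

lemma Tword_simps [simp]: "Tword [] = \<one>\<^bsub>Op\<^esub>" "Tword (s # u) = gen s \<otimes>\<^bsub>Op\<^esub> Tword u"
  by (simp_all add: Tword_def)

lemma Tword_carrier: "set u \<subseteq> S \<Longrightarrow> Tword u \<in> carrier Op"
  by (induction u) (auto intro!: B.A_m_closed B.A_one_closed gen_carrier)

text \<open>Commuting letters give commuting generators, so \<open>Tword\<close> only depends on the word up to
  \<^const>\<open>eqv\<close>, and the choice of the reduced word in the definition of \<open>T\<close> is irrelevant.\<close>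

lemma Tword_front:
  assumes "front s u" "s \<in> S" "set u \<subseteq> S"
  shows "Tword u = gen s \<otimes>\<^bsub>Op\<^esub> Tword (remove1 s u)"
  using assms
proof (induction u)
  case (Cons t u)
  show ?case
  proof (cases "t = s")
    case False
    then have st: "m s t = 2" "front s u" "t \<in> S" "set u \<subseteq> S" using Cons.prems by auto
    let ?x = "Tword (remove1 s u)"
    have c: "?x \<in> carrier Op" using st lists_remove1 Tword_carrier by blast
    have "gen t \<otimes>\<^bsub>Op\<^esub> (gen s \<otimes>\<^bsub>Op\<^esub> ?x) = (gen t \<otimes>\<^bsub>Op\<^esub> gen s) \<otimes>\<^bsub>Op\<^esub> ?x"
      using c gen_carrier st Cons.prems by (simp add: B.A_m_assoc)
    also have "\<dots> = gen s \<otimes>\<^bsub>Op\<^esub> (gen t \<otimes>\<^bsub>Op\<^esub> ?x)"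
      using c gen_carrier st Cons.prems by (simp add: gen_commute[of s t, symmetric] B.A_m_assoc)
    finally show ?thesis using Cons False st by simp
  qed simp
qed simp

lemma Tword_eqv: "eqv u v \<Longrightarrow> set u \<subseteq> S \<Longrightarrow> set v \<subseteq> S \<Longrightarrow> Tword u = Tword v"
proof (induction u arbitrary: v)
  case Nil
  then show ?case using eqv_set(3)[of "[]" v] by simp
next
  case (Cons s u)
  have s: "s \<in> S" "set u \<subseteq> S" using Cons.prems by auto
  have f: "front s v" using front_cong[OF Cons.prems s(1)] by simp
  have "eqv u (remove1 s v)" using eqv_remove1[OF Cons.prems(1), of s] by simp
  then have "Tword u = Tword (remove1 s v)"
    using Cons.IH s lists_remove1 Cons.prems by blast
  then show ?case using Tword_front[OF f s(1)] Cons.prems by simp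
qed

lemma T_eq:
  assumes u: "set u \<subseteq> S" "red u" "list_mult W u = w"
  shows "T w = Tword u"
proof -
  define v where "v = (SOME ss. reduced_word W S w ss)"
  have "reduced_word W S w u" using reduced_word_iff u by simp
  then have "reduced_word W S w v" unfolding v_def by (rule someI)
  then have v: "set v \<subseteq> S" "red v" "list_mult W v = w" using reduced_word_iff by auto
  have "T w = Tword v" by (simp add: hecke_basis_def v_def Tword_def Op_def)
  also have "\<dots> = Tword u" using red_unique[OF v(1,2) u(1,2)] v u Tword_eqv by simp
  finally show ?thesis .
qed

lemma T_carrier: "w \<in> carrier W \<Longrightarrow> T w \<in> carrier Op"
  using red_exists T_eq Tword_carrier by metis

lemma T_one: "T \<one> = \<one>\<^bsub>Op\<^esub>"
  using T_eq[of "[]"] by simp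

lemma gen_T_up:
  assumes s: "s \<in> S" and w: "w \<in> carrier W" and nd: "\<not> desc s w"
  shows "gen s \<otimes>\<^bsub>Op\<^esub> T w = T (s \<otimes> w)"
proof -
  obtain u where u: "set u \<subseteq> S" "red u" "list_mult W u = w" using red_exists w by blast
  have "red (s # u)" using descent_iff_front(1)[OF s u(1,2)] u nd by simp
  then show ?thesis using T_eq[OF u] T_eq[of "s # u"] u s by simp
qed

lemma gen_T_down:
  assumes s: "s \<in> S" and w: "w \<in> carrier W" and d: "desc s w"
  shows "gen s \<otimes>\<^bsub>Op\<^esub> T w = T (s \<otimes> w) \<oplus>\<^bsub>Op\<^esub> p s \<odot>\<^bsub>Op\<^esub> T w"
proof -
  let ?v = "s \<otimes> w"
  have v: "?v \<in> carrier W" "s \<otimes> ?v = w" using s w S_closed S_cancel by auto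
  have g: "gen s \<otimes>\<^bsub>Op\<^esub> T ?v = T w" using gen_T_up[OF s v(1)] d v(2) by simp
  note c = gen_carrier[OF s] T_carrier[OF v(1)] B.A_one_closed
  have "gen s \<otimes>\<^bsub>Op\<^esub> T w = (gen s \<otimes>\<^bsub>Op\<^esub> gen s) \<otimes>\<^bsub>Op\<^esub> T ?v"
    using c by (simp add: B.A_m_assoc flip: g)
  also have "\<dots> = T ?v \<oplus>\<^bsub>Op\<^esub> p s \<odot>\<^bsub>Op\<^esub> (gen s \<otimes>\<^bsub>Op\<^esub> T ?v)"
    using c by (simp add: gen_square[OF s] B.A_l_distr B.A_l_one B.smult_mult_left)
  finally show ?thesis by (simp add: g)
qed

lemma T_delta_one: 
  assumes "w \<in> carrier W" shows "T w (delta \<one>) = delta w"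
proof -
  obtain u where u: "set u \<subseteq> S" "red u" "list_mult W u = w" using red_exists assms by blast
  have "Tword u (delta \<one>) = delta (list_mult W u)"
    using u(1,2)
  proof (induction u)
    case Nil
    then show ?case by (simp add: Op_one_apply delta_in_ell2)
  next
    case (Cons s u)
    have s: "s \<in> S" "set u \<subseteq> S" "red u" "\<not> front s u" using Cons.prems by auto
    have "len (list_mult W u) < len (s \<otimes> list_mult W u)"
      using descent_iff_front(3)[OF s(1,2,3)] s(4) by simp
    then show ?case
      using Cons s hecke_generator_delta(1)[OF s(1) list_mult_closed[OF s(2)], of q]
      by (simp add: Op_mult_apply delta_in_ell2)
  qed
  then show ?thesis using T_eq[OF u] u by simp
qed

lemma gen_adjoint:
  assumes s: "s \<in> S" shows "invol Op (gen s) = gen s"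
proof -
  have "gen s (delta x) y = cnj (gen s (delta y) x)" if x: "x \<in> carrier W" and y: "y \<in> carrier W" for x y
  proof -
    have "s \<otimes> y = x \<longleftrightarrow> s \<otimes> x = y" using S_cancel[OF s] x y by metis
    then show ?thesis using x y by (auto simp: gen_apply delta_in_ell2) (auto simp: delta_def)
  qed
  then have "adjoint_operator (carrier W) (gen s) = gen s"
    by (rule adjoint_entries[OF gen_bounded[OF s] gen_bounded[OF s]])
  then show ?thesis by (simp only: Op_def operator_algebra_simps)
qed

lemma Tword_append:
  "set u \<subseteq> S \<Longrightarrow> set v \<subseteq> S \<Longrightarrow> Tword (u @ v) = Tword u \<otimes>\<^bsub>Op\<^esub> Tword v"
  by (induction u) (auto simp: B.A_l_one B.A_m_assoc Tword_carrier gen_carrier)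

lemma T_adjoint:
  assumes w: "w \<in> carrier W" shows "invol Op (T w) = T (inv w)"
proof -
  have a: "invol Op (Tword u) = Tword (rev u)" if "set u \<subseteq> S" for u
    using that
    by (induction u)
      (auto simp: B.invol_one B.invol_mult gen_carrier Tword_carrier gen_adjoint Tword_append B.A_r_one)
  obtain u where u: "set u \<subseteq> S" "red u" "list_mult W u = w" using red_exists w by blast
  have "red (rev u)" using red_iff_len[of "rev u"] list_mult_rev[OF u(1)] len_inv[OF w] u len_red[OF u(1,2)] by simp
  then have "T (inv w) = Tword (rev u)" using T_eq[of "rev u"] u list_mult_rev by simp
  then show ?thesis using T_eq[OF u] a u by simp
qed

subsection \<open>The Hecke algebra as a *-subalgebra\<close>

abbreviation H :: "'a operator set" where "H \<equiv> hecke_algebra W S q"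

definition comb :: "'a set \<Rightarrow> ('a \<Rightarrow> complex) \<Rightarrow> 'a operator" where
  "comb F c = (\<Oplus>\<^bsub>Op\<^esub>w\<in>F. c w \<odot>\<^bsub>Op\<^esub> T w)"

lemma H_eq: "H = {comb F c | F c. finite F \<and> F \<subseteq> carrier W}"
  by (simp add: hecke_algebra_def comb_def Op_def Let_def)

lemma comb_simps:
  shows "comb {} c = \<zero>\<^bsub>Op\<^esub>"
    and "finite F \<Longrightarrow> insert w F \<subseteq> carrier W \<Longrightarrow> w \<notin> F \<Longrightarrow>
      comb (insert w F) c = c w \<odot>\<^bsub>Op\<^esub> T w \<oplus>\<^bsub>Op\<^esub> comb F c"
proof -
  have Op: "abelian_monoid Op"
    by (intro abelian_group.axioms(1) ring.axioms(1) unital_cstar_algebra.axioms(1)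
        B.unital_cstar_algebra_axioms)
  show "comb {} c = \<zero>\<^bsub>Op\<^esub>"
    unfolding comb_def by (rule abelian_monoid.finsum_empty[OF Op])
  assume F: "finite F" "insert w F \<subseteq> carrier W" "w \<notin> F"
  show "comb (insert w F) c = c w \<odot>\<^bsub>Op\<^esub> T w \<oplus>\<^bsub>Op\<^esub> comb F c"
    unfolding comb_def
    by (rule abelian_monoid.finsum_insert[OF Op F(1,3)]) (use F T_carrier in \<open>auto intro!: B.smult_cl\<close>)
qed

lemma comb_carrier: "finite F \<Longrightarrow> F \<subseteq> carrier W \<Longrightarrow> comb F c \<in> carrier Op"
proof (induction F rule: finite_induct)
  case empty
  then show ?case by (simp add: comb_simps B.A_zero_closed)
next
  case (insert w F)
  then show ?case by (simp add: comb_simps T_carrier B.A_a_closed)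
qed

lemma comb_apply:
  assumes "finite F" "F \<subseteq> carrier W" "f \<in> l2"
  shows "comb F c f v = (\<Sum>w\<in>F. c w * T w f v)"
  using assms(1,2)
  by (induction F rule: finite_induct) (auto simp: comb_simps Op_zero_apply Op_add_apply Op_smult_apply assms(3))

lemma H_carrier: "x \<in> H \<Longrightarrow> x \<in> carrier Op"
  by (auto simp: H_eq comb_carrier)

lemma H_zero: "\<zero>\<^bsub>Op\<^esub> \<in> H"
  unfolding H_eq
  by (intro CollectI exI[of _ "{}"] exI[of _ "\<lambda>_. 0"]) (simp add: comb_simps)

lemma H_T: 
  assumes w: "w \<in> carrier W" shows "T w \<in> H"
proof -
  have "comb {w} (\<lambda>_. 1) = T w"
    using comb_simps(2)[of "{}" w "\<lambda>_. 1"] w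
    by (simp add: comb_simps(1) B.smult_distr(4) T_carrier B.A_r_zero)
  then show ?thesis unfolding H_eq using w by (intro CollectI exI[of _ "{w}"] exI[of _ "\<lambda>_. 1"]) auto
qed

lemma H_add:
  assumes "x \<in> H" "y \<in> H" shows "x \<oplus>\<^bsub>Op\<^esub> y \<in> H"
proof -
  obtain F c G d where x: "x = comb F c" "finite F" "F \<subseteq> carrier W"
    and y: "y = comb G d" "finite G" "G \<subseteq> carrier W" using assms unfolding H_eq by blast
  define e where "e w = (if w \<in> F then c w else 0) + (if w \<in> G then d w else 0)" for w
  have FG: "finite (F \<union> G)" "F \<union> G \<subseteq> carrier W" using x y by auto
  have "x \<oplus>\<^bsub>Op\<^esub> y = comb (F \<union> G) e"
  proof (rule Op_eqI)
    fix f v assume f: "f \<in> l2" "v \<in> carrier W"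
    have "(\<Sum>w\<in>F. c w * T w f v) = (\<Sum>w\<in>F \<union> G. (if w \<in> F then c w else 0) * T w f v)"
      by (rule sum.mono_neutral_cong_left) (use FG in auto)
    moreover have "(\<Sum>w\<in>G. d w * T w f v) = (\<Sum>w\<in>F \<union> G. (if w \<in> G then d w else 0) * T w f v)"
      by (rule sum.mono_neutral_cong_left) (use FG in auto)
    ultimately show "(x \<oplus>\<^bsub>Op\<^esub> y) f v = comb (F \<union> G) e f v"
      using x y FG f
      by (simp add: Op_add_apply comb_apply e_def distrib_right sum.distrib)
  qed (use x y FG comb_carrier in \<open>auto intro: B.A_a_closed\<close>)
  then show ?thesis unfolding H_eq using FG by blast
qed

lemma H_smult:
  assumes "x \<in> H" shows "a \<odot>\<^bsub>Op\<^esub> x \<in> H"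
proof -
  obtain F c where x: "x = comb F c" "finite F" "F \<subseteq> carrier W"
    using assms unfolding H_eq by blast
  have "a \<odot>\<^bsub>Op\<^esub> x = comb F (\<lambda>w. a * c w)"
    by (rule Op_eqI)
       (use x comb_carrier in \<open>auto simp: Op_smult_apply comb_apply sum_distrib_left mult.assoc\<close>)
  then show ?thesis unfolding H_eq using x by blast
qed

lemma H_induct [consumes 1, case_names zero add]:
  assumes x: "x \<in> H" and z: "P \<zero>\<^bsub>Op\<^esub>"
    and step: "\<And>c w y. w \<in> carrier W \<Longrightarrow> y \<in> H \<Longrightarrow> P y \<Longrightarrow> P (c \<odot>\<^bsub>Op\<^esub> T w \<oplus>\<^bsub>Op\<^esub> y)"
  shows "P x"
proof -
  obtain F c where F: "x = comb F c" "finite F" "F \<subseteq> carrier W" using x unfolding H_eq by blast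
  have "P (comb F c)"
    using F(2,3)
  proof (induction F rule: finite_induct)
    case empty
    then show ?case using z by (simp add: comb_simps)
  next
    case (insert w F)
    have "comb F c \<in> H" unfolding H_eq using insert by blast
    then show ?case using insert by (simp add: comb_simps step)
  qed
  then show ?thesis using F by simp
qed

lemma H_gen_mult:
  assumes s: "s \<in> S" and x: "x \<in> H" shows "gen s \<otimes>\<^bsub>Op\<^esub> x \<in> H"
  using x
proof (induction rule: H_induct)
  case zero
  then show ?case using H_zero gen_carrier[OF s] by (simp add: B.A_r_null)
next
  case (add c w y)
  have sw: "s \<otimes> w \<in> carrier W" using s S_closed add by auto
  have "gen s \<otimes>\<^bsub>Op\<^esub> T w \<in> H"
    using gen_T_up[OF s add(1)] gen_T_down[OF s add(1)] H_T add sw H_add H_smult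
    by (cases "desc s w") auto
  moreover have "gen s \<otimes>\<^bsub>Op\<^esub> (c \<odot>\<^bsub>Op\<^esub> T w \<oplus>\<^bsub>Op\<^esub> y)
      = c \<odot>\<^bsub>Op\<^esub> (gen s \<otimes>\<^bsub>Op\<^esub> T w) \<oplus>\<^bsub>Op\<^esub> gen s \<otimes>\<^bsub>Op\<^esub> y"
    using gen_carrier[OF s] T_carrier add H_carrier
    by (simp add: B.A_r_distr B.smult_mult_right)
  ultimately show ?case using add H_add H_smult by simp
qed

lemma H_T_mult:
  assumes w: "w \<in> carrier W" and x: "x \<in> H" shows "T w \<otimes>\<^bsub>Op\<^esub> x \<in> H"
proof -
  obtain u where u: "set u \<subseteq> S" "red u" "list_mult W u = w" using red_exists w by blast
  have "Tword u \<otimes>\<^bsub>Op\<^esub> x \<in> H"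
    using u(1)
  proof (induction u)
    case (Cons s u)
    then show ?case using H_gen_mult[of s "Tword u \<otimes>\<^bsub>Op\<^esub> x"] H_carrier[OF x]
      by (simp add: B.A_m_assoc gen_carrier Tword_carrier)
  qed (simp add: B.A_l_one H_carrier x)
  then show ?thesis using T_eq[OF u] by simp
qed

lemma H_mult:
  assumes x: "x \<in> H" and y: "y \<in> H" shows "x \<otimes>\<^bsub>Op\<^esub> y \<in> H"
  using x
proof (induction rule: H_induct)
  case zero
  then show ?case using H_zero H_carrier[OF y] by (simp add: B.A_l_null)
next
  case (add c w z)
  have "(c \<odot>\<^bsub>Op\<^esub> T w \<oplus>\<^bsub>Op\<^esub> z) \<otimes>\<^bsub>Op\<^esub> y = c \<odot>\<^bsub>Op\<^esub> (T w \<otimes>\<^bsub>Op\<^esub> y) \<oplus>\<^bsub>Op\<^esub> z \<otimes>\<^bsub>Op\<^esub> y"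
    using T_carrier add H_carrier H_carrier[OF y] by (simp add: B.A_l_distr B.smult_mult_left)
  then show ?case using add H_add H_smult H_T_mult y by simp
qed

lemma H_invol:
  assumes x: "x \<in> H" shows "invol Op x \<in> H"
  using x
proof (induction rule: H_induct)
  case zero
  have "invol Op \<zero>\<^bsub>Op\<^esub> = \<zero>\<^bsub>Op\<^esub>"
    using B.invol_smult[OF B.A_one_closed, of 0] by (simp add: B.smult_zero_left B.A_one_closed B.invol_closed)
  then show ?case using H_zero by simp
next
  case (add c w y)
  then show ?case
    using T_carrier H_carrier H_T H_add H_smult by (simp add: B.invol_add B.invol_smult T_adjoint)
qed

lemma H_one: "\<one>\<^bsub>Op\<^esub> \<in> H"
  using H_T[of \<one>] T_one by simp

text \<open>The coefficients of an element are its values at the unit vector of the neutral element.\<close>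

lemma H_expansion:
  assumes x: "x \<in> H"
  obtains F where "finite F" "F \<subseteq> carrier W" "\<And>w. w \<notin> F \<Longrightarrow> x (delta \<one>) w = 0"
    "\<And>f v. f \<in> l2 \<Longrightarrow> x f v = (\<Sum>w\<in>F. x (delta \<one>) w * T w f v)"
proof -
  obtain F c where F: "x = comb F c" "finite F" "F \<subseteq> carrier W" using x unfolding H_eq by blast
  have v: "x (delta \<one>) w = (if w \<in> F then c w else 0)" for w
  proof -
    have "x (delta \<one>) w = (\<Sum>y\<in>F. c y * delta y w)"
      using F by (simp add: comb_apply delta_in_ell2) (intro sum.cong, auto simp: T_delta_one subset_iff)
    also have "\<dots> = (\<Sum>y\<in>F. if y = w then c y else 0)" by (intro sum.cong) (auto simp: delta_def)
    also have "\<dots> = (if w \<in> F then c w else 0)" using F by simp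
    finally show ?thesis .
  qed
  show ?thesis
  proof (rule that[of F])
    show "x f v = (\<Sum>w\<in>F. x (delta \<one>) w * T w f v)" if "f \<in> l2" for f v
    proof -
      have "x f v = (\<Sum>w\<in>F. c w * T w f v)" using F that by (simp add: comb_apply)
      also have "\<dots> = (\<Sum>w\<in>F. x (delta \<one>) w * T w f v)" by (rule sum.cong) (simp_all only: v if_True)
      finally show ?thesis .
    qed
  qed (use F v in auto)
qed

section \<open>Matrix entries of the basis elements\<close>

text \<open>Applying \<open>T w\<close> to a basis vector, every letter of \<open>w\<close> either cancels a letter, or creates one, or
  acts diagonally by \<open>p s\<close>. The letters of the three kinds form factors \<open>b\<close>, \<open>a\<close>, \<open>t\<close> of a reduced
  factorisation \<open>w = a t b\<close>, and the letters of \<open>t\<close> commute pairwise. The following set collects the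
  factorisations that lead from \<open>v\<close> to \<open>x\<close>.\<close>

definition routes :: "'a \<Rightarrow> 'a \<Rightarrow> 'a \<Rightarrow> ('a \<times> 'a \<times> 'a) set" where
  "routes w v x = {(a, t, b). a \<in> carrier W \<and> b \<in> carrier W \<and> clique t \<and>
     w = a \<otimes> (t \<otimes> b) \<and> len w = len a + len t + len b \<and>
     len v = len b + len (b \<otimes> v) \<and> len (b \<otimes> v) = len t + len (t \<otimes> (b \<otimes> v)) \<and>
     len (a \<otimes> (b \<otimes> v)) = len a + len (b \<otimes> v) \<and> x = a \<otimes> (b \<otimes> v)}"

lemma finite_routes: "finite (routes w v x)"
proof -
  have "routes w v x \<subseteq> {a \<in> carrier W. len a \<le> len w} \<times> {a \<in> carrier W. len a \<le> len w} \<times>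
      {a \<in> carrier W. len a \<le> len w}"
    by (auto simp: routes_def clique_carrier)
  then show ?thesis by (rule finite_subset) (intro finite_cartesian_product finite_ball)
qed

text \<open>A common bound for the parameters, at least \<open>1\<close> so that its powers increase.\<close>

definition pmax :: real where
  "pmax = 1 + (\<Sum>s\<in>S. \<bar>hecke_p q s\<bar>)"

lemma pmax_ge: "1 \<le> pmax" "s \<in> S \<Longrightarrow> \<bar>hecke_p q s\<bar> \<le> pmax"
proof -
  show "1 \<le> pmax" by (simp add: pmax_def sum_nonneg)
  show "\<bar>hecke_p q s\<bar> \<le> pmax" if "s \<in> S"
    using member_le_sum[of s S "\<lambda>s. \<bar>hecke_p q s\<bar>"] that fin_S by (simp add: pmax_def)
qed

context
  fixes s w v x
  assumes s: "s \<in> S" and w: "w \<in> carrier W" and v: "v \<in> carrier W" and x: "x \<in> carrier W"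
    and up: "\<not> desc s w"
begin

lemma sw: "len (s \<otimes> w) = Suc (len w)"
  using len_S_mult[OF s w] up by auto

text \<open>If \<open>s\<close> shortened the first factor of \<open>w\<close> then the factorisation would yield too short a word
  for \<open>s \<otimes> w\<close>.\<close>

lemma route_up:
  assumes r: "(a, t, b) \<in> routes w v y"
  shows "\<not> desc s a" "len (s \<otimes> a) = Suc (len a)" "s \<in> carrier W" "t \<in> carrier W"
proof -
  show sc: "s \<in> carrier W" using s S_closed by simp
  show tc: "t \<in> carrier W" using r clique_carrier by (auto simp: routes_def)
  have ac: "a \<in> carrier W" "b \<in> carrier W" "w = a \<otimes> (t \<otimes> b)" "len w = len a + len t + len b"
    using r by (auto simp: routes_def)
  have "s \<otimes> w = (s \<otimes> a) \<otimes> (t \<otimes> b)" using ac sc tc by (simp add: m_assoc)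
  then have "len (s \<otimes> w) \<le> len (s \<otimes> a) + (len t + len b)"
    using len_mult_le[of "s \<otimes> a" "t \<otimes> b"] len_mult_le[of t b] ac sc tc by simp
  then show "\<not> desc s a" "len (s \<otimes> a) = Suc (len a)"
    using sw ac(4) len_S_mult[OF s ac(1)] by auto
qed

text \<open>If \<open>s\<close> shortens the target \<open>a b v\<close> then it passes through \<open>a\<close>, which it does not shorten, and for
  the same reason through \<open>t\<close>. Hence it can be moved next to \<open>t\<close> or \<open>b\<close>, which is how a route of \<open>w\<close>
  gives routes of \<open>s \<otimes> w\<close> in the lemmas below.\<close>

lemma route_through:
  assumes r: "(a, t, b) \<in> routes w v y" and d: "desc s y"
  shows "s \<otimes> a = a \<otimes> s" "s \<otimes> t = t \<otimes> s" "\<not> desc s t" "clique (s \<otimes> t)"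
    "Suc (len (s \<otimes> (b \<otimes> v))) = len (b \<otimes> v)"
    "Suc (len (s \<otimes> (t \<otimes> (b \<otimes> v)))) = len (t \<otimes> (b \<otimes> v))"
    "len (s \<otimes> t) = Suc (len t)" "len (s \<otimes> b) = Suc (len b)"
proof -
  note u = route_up[OF r]
  have rr: "a \<in> carrier W" "b \<in> carrier W" "clique t" "w = a \<otimes> (t \<otimes> b)" "len w = len a + len t + len b"
    "len v = len b + len (b \<otimes> v)" "len (b \<otimes> v) = len t + len (t \<otimes> (b \<otimes> v))"
    "len (a \<otimes> (b \<otimes> v)) = len a + len (b \<otimes> v)" "y = a \<otimes> (b \<otimes> v)"
    using r by (auto simp: routes_def)
  have bv: "b \<otimes> v \<in> carrier W" and tbv: "t \<otimes> (b \<otimes> v) \<in> carrier W" using rr v u by auto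
  have 1: "desc s (b \<otimes> v)" "s \<otimes> a = a \<otimes> s"
    using descent_through(1,2)[OF s rr(1) bv rr(8) _ u(1)] d rr(9) by auto
  then show "s \<otimes> a = a \<otimes> s" by simp
  have sw1: "s \<otimes> w = a \<otimes> ((s \<otimes> t) \<otimes> b)"
    using 1(2) rr u by (metis m_assoc m_closed)
  then have "len (s \<otimes> w) \<le> len a + (len (s \<otimes> t) + len b)"
    using len_mult_le[of a "(s \<otimes> t) \<otimes> b"] len_mult_le[of "s \<otimes> t" b] rr u by auto
  then show nt: "\<not> desc s t" and lt: "len (s \<otimes> t) = Suc (len t)"
    using sw rr(5) len_S_mult[OF s u(4)] by auto
  have tt: "t \<otimes> (t \<otimes> (b \<otimes> v)) = b \<otimes> v" by (rule clique_cancel[OF rr(3) bv])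
  note dt = descent_through[OF s u(4) tbv _ _ nt, unfolded tt, OF rr(7) 1(1)]
  show st: "s \<otimes> t = t \<otimes> s" by (rule dt(2))
  show "clique (s \<otimes> t)" by (rule clique_mult[OF rr(3) s nt dt(3)])
  show "Suc (len (s \<otimes> (b \<otimes> v))) = len (b \<otimes> v)" using len_S_mult[OF s bv] 1(1) by auto
  show "Suc (len (s \<otimes> (t \<otimes> (b \<otimes> v)))) = len (t \<otimes> (b \<otimes> v))"
    using len_S_mult[OF s tbv] dt(1) by auto
  have "s \<otimes> w = a \<otimes> (t \<otimes> (s \<otimes> b))" using sw1 st rr u by (metis m_assoc)
  then have "len (s \<otimes> w) \<le> len a + (len t + len (s \<otimes> b))"
    using len_mult_le[of a "t \<otimes> (s \<otimes> b)"] len_mult_le[of t "s \<otimes> b"] rr u by auto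
  then show "len (s \<otimes> b) = Suc (len b)" using sw rr(5) len_S_mult[OF s rr(2)] by auto
qed

lemma route_cancel:
  assumes r: "(a, t, b) \<in> routes w v (s \<otimes> x)" and nd: "\<not> desc s x"
  shows "(a, t, s \<otimes> b) \<in> routes (s \<otimes> w) v x"
proof -
  have ssx: "s \<otimes> (s \<otimes> x) = x" by (rule S_cancel[OF s x])
  have lx: "len (s \<otimes> x) = Suc (len x)" using len_S_mult[OF s x] nd by auto
  have d: "desc s (s \<otimes> x)" using ssx lx by simp
  note u = route_up[OF r] and th = route_through[OF r d]
  have rr: "a \<in> carrier W" "b \<in> carrier W" "clique t" "w = a \<otimes> (t \<otimes> b)" "len w = len a + len t + len b"
    "len v = len b + len (b \<otimes> v)" "len (b \<otimes> v) = len t + len (t \<otimes> (b \<otimes> v))"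
    "len (a \<otimes> (b \<otimes> v)) = len a + len (b \<otimes> v)" "s \<otimes> x = a \<otimes> (b \<otimes> v)"
    using r by (auto simp: routes_def)
  have bv: "b \<otimes> v \<in> carrier W" using rr v by simp
  have e1: "(s \<otimes> b) \<otimes> v = s \<otimes> (b \<otimes> v)" using rr u v by (simp add: m_assoc)
  have e2: "t \<otimes> (s \<otimes> (b \<otimes> v)) = s \<otimes> (t \<otimes> (b \<otimes> v))" using th(2) u bv by (metis m_assoc)
  have e3: "a \<otimes> (s \<otimes> (b \<otimes> v)) = x" using th(1) rr u bv ssx by (metis m_assoc)
  have e4: "a \<otimes> (t \<otimes> (s \<otimes> b)) = s \<otimes> w" using th(1,2) rr u by (metis m_assoc m_closed)
  show ?thesis
    unfolding routes_def using rr u e1 e2 e3 e4 th lx sw s by (auto simp: S_closed)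
qed

lemma route_create:
  assumes r: "(a, t, b) \<in> routes w v (s \<otimes> x)" and d: "desc s x"
  shows "(s \<otimes> a, t, b) \<in> routes (s \<otimes> w) v x"
proof -
  have ssx: "s \<otimes> (s \<otimes> x) = x" by (rule S_cancel[OF s x])
  have lx: "Suc (len (s \<otimes> x)) = len x" using len_S_mult[OF s x] d by auto
  note u = route_up[OF r]
  have rr: "a \<in> carrier W" "b \<in> carrier W" "clique t" "w = a \<otimes> (t \<otimes> b)" "len w = len a + len t + len b"
    "len v = len b + len (b \<otimes> v)" "len (b \<otimes> v) = len t + len (t \<otimes> (b \<otimes> v))"
    "len (a \<otimes> (b \<otimes> v)) = len a + len (b \<otimes> v)" "s \<otimes> x = a \<otimes> (b \<otimes> v)"
    using r by (auto simp: routes_def)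
  have bv: "b \<otimes> v \<in> carrier W" using rr v by simp
  have e1: "(s \<otimes> a) \<otimes> (b \<otimes> v) = x" using rr u bv ssx by (simp add: m_assoc)
  have e2: "(s \<otimes> a) \<otimes> (t \<otimes> b) = s \<otimes> w" using rr u by (simp add: m_assoc)
  show ?thesis
    unfolding routes_def using rr u e1 e2 lx sw by auto
qed

lemma route_diagonal:
  assumes r: "(a, t, b) \<in> routes w v x" and d: "desc s x"
  shows "(a, s \<otimes> t, b) \<in> routes (s \<otimes> w) v x"
proof -
  note u = route_up[OF r] and th = route_through[OF r d]
  have rr: "a \<in> carrier W" "b \<in> carrier W" "clique t" "w = a \<otimes> (t \<otimes> b)" "len w = len a + len t + len b"
    "len v = len b + len (b \<otimes> v)" "len (b \<otimes> v) = len t + len (t \<otimes> (b \<otimes> v))"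
    "len (a \<otimes> (b \<otimes> v)) = len a + len (b \<otimes> v)" "x = a \<otimes> (b \<otimes> v)"
    using r by (auto simp: routes_def)
  have bv: "b \<otimes> v \<in> carrier W" using rr v by simp
  have e1: "(s \<otimes> t) \<otimes> (b \<otimes> v) = s \<otimes> (t \<otimes> (b \<otimes> v))" using u bv by (simp add: m_assoc)
  have e2: "a \<otimes> ((s \<otimes> t) \<otimes> b) = s \<otimes> w" using th(1) rr u by (metis m_assoc m_closed)
  show ?thesis
    unfolding routes_def using rr u e1 e2 th sw by auto
qed

end

lemma S_mult_inj: "s \<in> S \<Longrightarrow> a \<in> carrier W \<Longrightarrow> b \<in> carrier W \<Longrightarrow> s \<otimes> a = s \<otimes> b \<Longrightarrow> a = b"
  using S_cancel by metis

definition route_weight :: "'a \<Rightarrow> 'a \<Rightarrow> 'a \<Rightarrow> real" where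
  "route_weight w v x = (\<Sum>(a, t, b)\<in>routes w v x. pmax ^ len t)"

text \<open>The recursion satisfied by the matrix entries of \<open>T (s \<otimes> w)\<close>. The routes on the left hand side
  are continued to distinct routes of \<open>s \<otimes> w\<close>: the new letter cancels, creates, or acts diagonally, in
  which case the middle factor and with it the weight grows.\<close>

lemma route_weight_step:
  assumes s: "s \<in> S" and w: "w \<in> carrier W" and v: "v \<in> carrier W" and x: "x \<in> carrier W"
    and up: "\<not> desc s w"
  shows "route_weight w v (s \<otimes> x) + (if desc s x then pmax * route_weight w v x else 0)
    \<le> route_weight (s \<otimes> w) v x"
proof -
  note ctx = s w v x up
  let ?f = "\<lambda>(a, t, b). pmax ^ len t :: real"
  have cl: "a \<in> carrier W" "b \<in> carrier W" "t \<in> carrier W" if "(a, t, b) \<in> routes u v y" for a t b u y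
    using that clique_carrier by (auto simp: routes_def)
  have pm: "0 \<le> ?f z" for z using pmax_ge(1) by (auto split: prod.split)
  show ?thesis
  proof (cases "desc s x")
    case False
    have "sum ?f (routes w v (s \<otimes> x)) \<le> sum ?f (routes (s \<otimes> w) v x)"
    proof (rule sum_le_image[where h = "\<lambda>(a, t, b). (a, t, s \<otimes> b)"])
      show "inj_on (\<lambda>(a, t, b). (a, t, s \<otimes> b)) (routes w v (s \<otimes> x))"
        using S_mult_inj[OF s] cl by (auto simp: inj_on_def)
      show "(\<lambda>(a, t, b). (a, t, s \<otimes> b)) ` routes w v (s \<otimes> x) \<subseteq> routes (s \<otimes> w) v x"
        using route_cancel[OF ctx _ False] by auto
    qed (use finite_routes pm in auto)
    then show ?thesis using False by (simp add: route_weight_def)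
  next
    case True
    let ?A = "(\<lambda>(a, t, b). (s \<otimes> a, t, b)) ` routes w v (s \<otimes> x)"
    let ?B = "(\<lambda>(a, t, b). (a, s \<otimes> t, b)) ` routes w v x"
    have A: "?A \<subseteq> routes (s \<otimes> w) v x" using route_create[OF ctx _ True] by auto
    have B: "?B \<subseteq> routes (s \<otimes> w) v x" using route_diagonal[OF ctx _ True] by auto
    have fin: "finite ?A" "finite ?B" using finite_routes by auto
    \<comment> \<open>the first factor starts with \<open>s\<close> in \<open>?A\<close> but not in \<open>?B\<close>\<close>
    have disj: "?A \<inter> ?B = {}"
    proof (rule ccontr)
      assume "?A \<inter> ?B \<noteq> {}"
      then obtain z where z: "z \<in> ?A" "z \<in> ?B" by blast
      obtain a t b where z1: "(a, t, b) \<in> routes w v (s \<otimes> x)" "z = (s \<otimes> a, t, b)" using z(1) by auto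
      obtain a' t' b' where z2: "(a', t', b') \<in> routes w v x" "z = (a', s \<otimes> t', b')" using z(2) by auto
      have 1: "(a, t, b) \<in> routes w v (s \<otimes> x)" "(a', t', b') \<in> routes w v x" "s \<otimes> a = a'"
        using z1 z2 by auto
      have "desc s (s \<otimes> a)"
        using route_up(2)[OF ctx 1(1)] S_cancel[OF s cl(1)[OF 1(1)]] by simp
      then show False using route_up(1)[OF ctx 1(2)] 1(3) by simp
    qed
    have iA: "sum ?f (routes w v (s \<otimes> x)) \<le> sum ?f ?A"
      by (rule sum_le_image[where h = "\<lambda>(a, t, b). (s \<otimes> a, t, b)"])
        (use fin pm S_mult_inj[OF s] cl in \<open>auto simp: inj_on_def\<close>)
    have iB: "(\<Sum>z\<in>routes w v x. pmax * ?f z) \<le> sum ?f ?B"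
    proof (rule sum_le_image[where h = "\<lambda>(a, t, b). (a, s \<otimes> t, b)"])
      fix z assume z: "z \<in> routes w v x"
      obtain a t b where [simp]: "z = (a, t, b)" by (cases z)
      have "len (s \<otimes> t) = Suc (len t)" using route_through(7)[OF ctx _ True] z by simp
      then show "pmax * ?f z \<le> ?f ((\<lambda>(a, t, b). (a, s \<otimes> t, b)) z)" by simp
    qed (use fin pm S_mult_inj[OF s] cl in \<open>auto simp: inj_on_def\<close>)
    have "sum ?f (routes w v (s \<otimes> x)) + (\<Sum>z\<in>routes w v x. pmax * ?f z) \<le> sum ?f (?A \<union> ?B)"
      using iA iB sum.union_disjoint[OF fin disj, of ?f] by linarith
    also have "\<dots> \<le> sum ?f (routes (s \<otimes> w) v x)"
      using A B pm by (intro sum_mono2 finite_routes) auto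
    finally show ?thesis using True by (simp add: route_weight_def sum_distrib_left)
  qed
qed

theorem entry_bound:
  assumes w: "w \<in> carrier W" and v: "v \<in> carrier W" and x: "x \<in> carrier W"
  shows "cmod (T w (delta v) x) \<le> route_weight w v x"
proof -
  obtain u where u: "set u \<subseteq> S" "red u" "list_mult W u = w" using red_exists w by blast
  have pm: "0 \<le> pmax" using pmax_ge(1) by simp
  have nn: "0 \<le> route_weight w v x" for w v x
    unfolding route_weight_def by (rule sum_nonneg) (use pm in auto)
  have "cmod (Tword u (delta v) x) \<le> route_weight (list_mult W u) v x"
    using u(1,2) x
  proof (induction u arbitrary: x)
    case Nil
    have "(\<one>, \<one>, \<one>) \<in> routes \<one> v v" using clique_one v len_one by (simp add: routes_def)
    then have "pmax ^ len \<one> \<le> route_weight \<one> v v"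
      unfolding route_weight_def
      using member_le_sum[of "(\<one>, \<one>, \<one>)" "routes \<one> v v" "\<lambda>(a, t, b). pmax ^ len t"] finite_routes pm
      by auto
    then show ?case using nn[of \<one> v x] v
      by (auto simp: Op_one_apply delta_in_ell2 len_one) (auto simp: delta_def)
  next
    case (Cons s u)
    have s: "s \<in> S" "set u \<subseteq> S" "red u" "\<not> front s u" using Cons.prems by auto
    let ?w = "list_mult W u"
    have wc: "?w \<in> carrier W" by (rule list_mult_closed[OF s(2)])
    have nd: "\<not> desc s ?w" using descent_iff_front(1)[OF s(1,2,3)] s(4) by simp
    have sx: "s \<otimes> x \<in> carrier W" using s S_closed Cons.prems by auto
    have g: "Tword u (delta v) \<in> l2" using Op_apply_closed[OF Tword_carrier[OF s(2)] delta_in_ell2[OF v]] .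
    have IH: "cmod (Tword u (delta v) y) \<le> route_weight ?w v y" if "y \<in> carrier W" for y
      using Cons.IH s that by blast
    have "cmod (Tword (s # u) (delta v) x)
        \<le> cmod (Tword u (delta v) (s \<otimes> x)) + (if desc s x then cmod (p s * Tword u (delta v) x) else 0)"
      using gen_apply[OF g Cons.prems(3), of s] norm_triangle_ineq[of "Tword u (delta v) (s \<otimes> x)"]
      by (simp add: Op_mult_apply delta_in_ell2 v)
    also have "\<dots> \<le> route_weight ?w v (s \<otimes> x) + (if desc s x then pmax * route_weight ?w v x else 0)"
      using IH[OF sx] IH[OF Cons.prems(3)] pmax_ge(2)[OF s(1)] pm
      by (auto simp: norm_mult intro!: add_mono mult_mono)
    also have "\<dots> \<le> route_weight (s \<otimes> ?w) v x"
      by (rule route_weight_step[OF s(1) wc v Cons.prems(3) nd])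
    finally show ?case by simp
  qed
  then show ?thesis using T_eq[OF u] u by simp
qed

end

section \<open>A Haagerup inequality\<close>

lemma triple_Cauchy_Schwarz:
  fixes f :: "'x \<Rightarrow> 'y \<Rightarrow> real"
  assumes fin: "finite A" "finite B" "finite G"
  shows "(\<Sum>(a, b, g)\<in>A \<times> B \<times> G. \<bar>f a b\<bar> * \<bar>k b g\<bar> * \<bar>h a g\<bar>)
    \<le> sqrt (\<Sum>(a, b)\<in>A \<times> B. (f a b)\<^sup>2) * sqrt (\<Sum>(b, g)\<in>B \<times> G. (k b g)\<^sup>2)
      * sqrt (\<Sum>(a, g)\<in>A \<times> G. (h a g)\<^sup>2)"
proof -
  define K where "K a b = L2_set (k b) G * L2_set (h a) G" for a b
  have K0: "0 \<le> K a b" for a b by (simp add: K_def)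
  have "(\<Sum>(a, b, g)\<in>A \<times> B \<times> G. \<bar>f a b\<bar> * \<bar>k b g\<bar> * \<bar>h a g\<bar>)
      = (\<Sum>(a, b)\<in>A \<times> B. \<bar>f a b\<bar> * (\<Sum>g\<in>G. \<bar>k b g\<bar> * \<bar>h a g\<bar>))"
    by (simp add: sum.cartesian_product' sum_distrib_left mult.assoc)
  also have "\<dots> \<le> (\<Sum>(a, b)\<in>A \<times> B. \<bar>f a b\<bar> * \<bar>K a b\<bar>)"
    using K0 by (intro sum_mono) (auto simp: K_def intro!: mult_left_mono L2_set_mult_ineq)
  also have "\<dots> = (\<Sum>z\<in>A \<times> B. \<bar>case_prod f z\<bar> * \<bar>case_prod K z\<bar>)"
    by (intro sum.cong) auto
  also have "\<dots> \<le> L2_set (case_prod f) (A \<times> B) * L2_set (case_prod K) (A \<times> B)"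
    by (rule L2_set_mult_ineq)
  also have "L2_set (case_prod K) (A \<times> B) =
      sqrt (\<Sum>(b, g)\<in>B \<times> G. (k b g)\<^sup>2) * sqrt (\<Sum>(a, g)\<in>A \<times> G. (h a g)\<^sup>2)"
  proof -
    have "(\<Sum>z\<in>A \<times> B. (case_prod K z)\<^sup>2)
        = (\<Sum>a\<in>A. \<Sum>b\<in>B. (\<Sum>g\<in>G. (k b g)\<^sup>2) * (\<Sum>g\<in>G. (h a g)\<^sup>2))"
      by (simp add: sum.cartesian_product' K_def power_mult_distrib L2_set_def sum_nonneg)
    also have "\<dots> = (\<Sum>a\<in>A. (\<Sum>b\<in>B. \<Sum>g\<in>G. (k b g)\<^sup>2) * (\<Sum>g\<in>G. (h a g)\<^sup>2))"
      by (simp add: sum_distrib_right)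
    also have "\<dots> = (\<Sum>(b, g)\<in>B \<times> G. (k b g)\<^sup>2) * (\<Sum>(a, g)\<in>A \<times> G. (h a g)\<^sup>2)"
      by (simp add: sum.cartesian_product' sum_distrib_left)
    finally show ?thesis by (simp add: L2_set_def real_sqrt_mult)
  qed
  finally show ?thesis by (simp add: L2_set_def case_prod_unfold mult.assoc)
qed

context square_free_coxeter
begin

definition sph :: "nat \<Rightarrow> 'a set" where
  "sph n = {w \<in> carrier W. len w = n}"

lemma finite_sph: "finite (sph n)"
  by (rule finite_subset[OF _ finite_ball[of n]]) (auto simp: sph_def)

text \<open>The left factor of a reduced factorisation is a prefix. So there are boundedly many of them if its
  length is given, and together with the middle factor it determines the right factor.\<close>

lemma factorisation_sum:
  fixes \<beta> :: "'a \<Rightarrow> real"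
  assumes t: "t \<in> carrier W" and k: "k = i + len t + j"
  shows "(\<Sum>(a, b)\<in>sph i \<times> sph j.
      (if len (a \<otimes> (t \<otimes> b)) = k then \<beta> (a \<otimes> (t \<otimes> b)) else 0)\<^sup>2)
    \<le> real prefix_bound * (\<Sum>w\<in>sph k. (\<beta> w)\<^sup>2)"
proof -
  define Z where "Z = {(a, b) \<in> sph i \<times> sph j. len (a \<otimes> (t \<otimes> b)) = k}"
  let ?g = "\<lambda>(a, b). a \<otimes> (t \<otimes> b)"
  have finZ: "finite Z"
    by (rule finite_subset[of _ "sph i \<times> sph j"]) (auto simp: Z_def finite_sph)
  have "(\<Sum>(a, b)\<in>sph i \<times> sph j. (if len (a \<otimes> (t \<otimes> b)) = k then \<beta> (a \<otimes> (t \<otimes> b)) else 0)\<^sup>2)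
      = (\<Sum>z\<in>Z. (\<beta> (?g z))\<^sup>2)"
    by (rule sum.mono_neutral_cong_right) (auto simp: Z_def finite_sph split: if_splits)
  also have "\<dots> = (\<Sum>w\<in>sph k. \<Sum>z\<in>{z \<in> Z. ?g z = w}. (\<beta> (?g z))\<^sup>2)"
    by (rule sum.group[symmetric]) (use t finZ finite_sph in \<open>auto, auto simp: Z_def sph_def\<close>)
  also have "\<dots> = (\<Sum>w\<in>sph k. real (card {z \<in> Z. ?g z = w}) * (\<beta> w)\<^sup>2)"
    by (intro sum.cong) simp_all
  also have "\<dots> \<le> (\<Sum>w\<in>sph k. real prefix_bound * (\<beta> w)\<^sup>2)"
  proof (intro sum_mono mult_right_mono)
    fix w assume w: "w \<in> sph k"
    then have wc: "w \<in> carrier W" by (simp add: sph_def)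
    let ?P = "{x \<in> carrier W. len x = i \<and> len w = len x + len (inv x \<otimes> w)}"
    have "inj_on fst {z \<in> Z. ?g z = w}"
    proof (rule inj_onI)
      fix z z' assume z: "z \<in> {z \<in> Z. ?g z = w}" "z' \<in> {z \<in> Z. ?g z = w}" "fst z = fst z'"
      obtain a b b' where zz: "z = (a, b)" "z' = (a, b')" using z(3) by (cases z; cases z') auto
      have c: "a \<in> carrier W" "b \<in> carrier W" "b' \<in> carrier W" "a \<otimes> (t \<otimes> b) = a \<otimes> (t \<otimes> b')"
        using z zz by (auto simp: Z_def sph_def)
      have "t \<otimes> b = t \<otimes> b'" using c t Units_l_cancel[of a "t \<otimes> b" "t \<otimes> b'"] Units_eq by simp
      then have "b = b'" using c t Units_l_cancel[of t b b'] Units_eq by simp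
      then show "z = z'" using zz by simp
    qed
    moreover have "fst ` {z \<in> Z. ?g z = w} \<subseteq> ?P"
    proof
      fix a assume "a \<in> fst ` {z \<in> Z. ?g z = w}"
      then obtain b where b: "a \<in> carrier W" "b \<in> carrier W" "len a = i" "len b = j"
        "len (a \<otimes> (t \<otimes> b)) = k" "a \<otimes> (t \<otimes> b) = w"
        by (auto simp: Z_def sph_def)
      have e: "inv a \<otimes> w = t \<otimes> b" using b t by (metis inv_solve_left m_closed)
      have "len (t \<otimes> b) \<le> len t + j" using len_mult_le[OF t b(2)] b(4) by simp
      moreover have "k \<le> i + len (t \<otimes> b)"
        using len_mult_le[of a "t \<otimes> b"] b t by simp
      ultimately have "len w = i + len (inv a \<otimes> w)" unfolding e using b k by simp
      then show "a \<in> ?P" using b by simp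
    qed
    ultimately have "card {z \<in> Z. ?g z = w} \<le> card ?P"
      using card_inj_on_le card_prefixes(1)[OF wc] by blast
    then show "real (card {z \<in> Z. ?g z = w}) \<le> real prefix_bound"
      using card_prefixes(2)[OF wc, of i] by simp
  qed simp
  finally show ?thesis by (simp add: sum_distrib_left)
qed

lemma sum_sph_inv: 
  fixes F :: "'a \<Rightarrow> 'a \<Rightarrow> real"
  shows "(\<Sum>(b, g)\<in>sph j \<times> A. F (inv b) g) = (\<Sum>(b, g)\<in>sph j \<times> A. F b g)"
  by (rule sum.reindex_bij_witness[of _ "\<lambda>(b, g). (inv b, g)" "\<lambda>(b, g). (inv b, g)"])
     (auto simp: sph_def len_inv)

definition cliques :: "'a set" where "cliques = {t. clique t}"

lemma finite_cliques: "finite cliques"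
  by (rule finite_subset[OF _ finite_ball[of "card S"]])
     (auto simp: cliques_def clique_carrier clique_len)

end

context hecke_system
begin

definition haagerup_const :: real where
  "haagerup_const = real (card cliques) * (pmax ^ card S * sqrt (real prefix_bound) ^ 3)"

lemma haagerup_const_nonneg: "0 \<le> haagerup_const"
  using pmax_ge(1) by (simp add: haagerup_const_def)

text \<open>For a route with middle factor \<open>t\<close> the lengths of all factors are determined by those of \<open>w\<close>,
  \<open>v\<close>, \<open>x\<close> and \<open>t\<close>. Hence the sum over the routes through \<open>t\<close> is a trace of a product of three
  matrices, to which the Cauchy-Schwarz inequality applies.\<close>

lemma routes_through_clique:
  fixes \<alpha> \<xi> \<eta> :: "'a \<Rightarrow> real"
  assumes t: "clique t" and k: "k = i + len t + j" and n: "n = j + len t + l" and r: "r = i + len t + l"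
  shows "(\<Sum>(a, b, g)\<in>sph i \<times> sph j \<times> sph l.
      \<bar>if len (a \<otimes> (t \<otimes> b)) = k then \<alpha> (a \<otimes> (t \<otimes> b)) else 0\<bar> *
      \<bar>if len (inv b \<otimes> (t \<otimes> g)) = n then \<xi> (inv b \<otimes> (t \<otimes> g)) else 0\<bar> *
      \<bar>if len (a \<otimes> (t \<otimes> g)) = r then \<eta> (a \<otimes> (t \<otimes> g)) else 0\<bar>)
    \<le> sqrt (real prefix_bound) ^ 3 * L2_set \<alpha> (sph k) * L2_set \<xi> (sph n) * L2_set \<eta> (sph r)"
    (is "?L \<le> _")
proof -
  have tc: "t \<in> carrier W" by (rule clique_carrier[OF t])
  let ?F = "\<lambda>\<beta> N a b. if len (a \<otimes> (t \<otimes> b)) = N then \<beta> (a \<otimes> (t \<otimes> b)) else (0::real)"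
  have est: "sqrt (\<Sum>(a, b)\<in>sph i \<times> sph j. (?F \<beta> N a b)\<^sup>2) \<le> sqrt (real prefix_bound) * L2_set \<beta> (sph N)"
    if "N = i + len t + j" for \<beta> :: "'a \<Rightarrow> real" and N i j
    unfolding L2_set_def real_sqrt_mult[symmetric]
    by (intro real_sqrt_le_mono factorisation_sum[OF tc that])
  have "?L \<le> sqrt (\<Sum>(a, b)\<in>sph i \<times> sph j. (?F \<alpha> k a b)\<^sup>2)
      * sqrt (\<Sum>(b, g)\<in>sph j \<times> sph l. (?F \<xi> n (inv b) g)\<^sup>2)
      * sqrt (\<Sum>(a, g)\<in>sph i \<times> sph l. (?F \<eta> r a g)\<^sup>2)"
    by (rule triple_Cauchy_Schwarz[OF finite_sph finite_sph finite_sph])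
  also have "(\<Sum>(b, g)\<in>sph j \<times> sph l. (?F \<xi> n (inv b) g)\<^sup>2)
      = (\<Sum>(b, g)\<in>sph j \<times> sph l. (?F \<xi> n b g)\<^sup>2)"
    by (rule sum_sph_inv)
  also have "sqrt (\<Sum>(a, b)\<in>sph i \<times> sph j. (?F \<alpha> k a b)\<^sup>2)
      * sqrt (\<Sum>(b, g)\<in>sph j \<times> sph l. (?F \<xi> n b g)\<^sup>2)
      * sqrt (\<Sum>(a, g)\<in>sph i \<times> sph l. (?F \<eta> r a g)\<^sup>2)
    \<le> (sqrt (real prefix_bound) * L2_set \<alpha> (sph k)) * (sqrt (real prefix_bound) * L2_set \<xi> (sph n))
      * (sqrt (real prefix_bound) * L2_set \<eta> (sph r))"
    by (intro mult_mono est k n r) (auto intro!: sum_nonneg mult_nonneg_nonneg)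
  also have "\<dots> = sqrt (real prefix_bound) ^ 3 * L2_set \<alpha> (sph k) * L2_set \<xi> (sph n) * L2_set \<eta> (sph r)"
    by (simp add: power3_eq_cube mult_ac)
  finally show ?thesis .
qed

text \<open>Routes are sorted by their middle factors, of which there are finitely many; a route is then
  determined by \<open>a\<close>, \<open>b\<close> and the remainder \<open>t b v\<close>.\<close>

theorem haagerup:
  fixes \<alpha> \<xi> \<eta> :: "'a \<Rightarrow> real"
  assumes nn: "\<And>w. 0 \<le> \<alpha> w" "\<And>w. 0 \<le> \<xi> w" "\<And>w. 0 \<le> \<eta> w"
  shows "(\<Sum>(w, v, x)\<in>sph k \<times> sph n \<times> sph r. \<alpha> w * \<xi> v * \<eta> x * route_weight w v x)
    \<le> haagerup_const * L2_set \<alpha> (sph k) * L2_set \<xi> (sph n) * L2_set \<eta> (sph r)"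
    (is "?L \<le> _")
proof -
  define X where "X = sph k \<times> sph n \<times> sph r"
  define R where "R = (\<lambda>(w, v, x). routes w v x)"
  let ?V = "\<lambda>(w, v, x). \<alpha> w * \<xi> v * \<eta> x"
  have finX: "finite X" by (simp add: X_def finite_sph)
  have finR: "finite (R z)" for z by (cases z) (simp add: R_def finite_routes)
  define Y where "Y t = {(a, b, g). a \<in> carrier W \<and> b \<in> carrier W \<and> g \<in> carrier W \<and>
     k = len a + len t + len b \<and> n = len b + len t + len g \<and> r = len a + len t + len g}" for t
  define F where "F t = (\<lambda>(a, b, g).
      \<bar>if len (a \<otimes> (t \<otimes> b)) = k then \<alpha> (a \<otimes> (t \<otimes> b)) else 0\<bar> *
      \<bar>if len (inv b \<otimes> (t \<otimes> g)) = n then \<xi> (inv b \<otimes> (t \<otimes> g)) else 0\<bar> *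
      \<bar>if len (a \<otimes> (t \<otimes> g)) = r then \<eta> (a \<otimes> (t \<otimes> g)) else 0\<bar>)" for t
  have finY: "finite (Y t)" for t
    by (rule finite_subset[of _ "{w \<in> carrier W. len w \<le> k} \<times> {w \<in> carrier W. len w \<le> k} \<times> {w \<in> carrier W. len w \<le> r}"])
       (auto simp: Y_def intro!: finite_cartesian_product finite_ball)
  define h :: "('a \<times> 'a \<times> 'a) \<times> ('a \<times> 'a \<times> 'a) \<Rightarrow> 'a \<times> 'a \<times> 'a \<times> 'a" where
    "h = (\<lambda>((w, v, x), (a, t, b)). (t, a, b, t \<otimes> (b \<otimes> v)))"
  have F0: "0 \<le> F t z" for t z by (auto simp: F_def split: prod.split)
  have "?L = (\<Sum>z\<in>X. \<Sum>r\<in>R z. ?V z * (case r of (a, t, b) \<Rightarrow> pmax ^ len t))"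
    by (simp add: X_def R_def route_weight_def sum_distrib_left case_prod_unfold)
  also have "\<dots> = (\<Sum>(z, r)\<in>Sigma X R. ?V z * (case r of (a, t, b) \<Rightarrow> pmax ^ len t))"
    by (rule sum.Sigma) (use finX finR in auto)
  also have "\<dots> \<le> (\<Sum>(t, y)\<in>Sigma cliques Y. pmax ^ card S * F t y)"
  proof (rule sum_le_image[where h = h])
    show "finite (Sigma cliques Y)" by (intro finite_SigmaI finite_cliques finY)
    have rt: "a \<in> carrier W" "b \<in> carrier W" "t \<in> carrier W" "clique t" "v \<in> carrier W"
      "w = a \<otimes> (t \<otimes> b)" "k = len a + len t + len b" "n = len b + len t + len (t \<otimes> (b \<otimes> v))"
      "r = len a + len t + len (t \<otimes> (b \<otimes> v))" "v = inv b \<otimes> (t \<otimes> (t \<otimes> (b \<otimes> v)))"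
      "x = a \<otimes> (t \<otimes> (t \<otimes> (b \<otimes> v)))" "len w = k" "len v = n" "len x = r"
      if "((w, v, x), (a, t, b)) \<in> Sigma X R" for w v x a t b
    proof -
      have r: "(a, t, b) \<in> routes w v x" and X: "w \<in> sph k" "v \<in> sph n" "x \<in> sph r"
        using that by (auto simp: X_def R_def)
      show c: "a \<in> carrier W" "b \<in> carrier W" "clique t" "v \<in> carrier W" "w = a \<otimes> (t \<otimes> b)"
        using r X by (auto simp: routes_def sph_def)
      show "t \<in> carrier W" using c clique_carrier by simp
      have tt: "t \<otimes> (t \<otimes> (b \<otimes> v)) = b \<otimes> v" using clique_cancel c by simp
      show "len w = k" "len v = n" "len x = r" "k = len a + len t + len b"
        "n = len b + len t + len (t \<otimes> (b \<otimes> v))" "r = len a + len t + len (t \<otimes> (b \<otimes> v))"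
        using r X by (auto simp: routes_def sph_def)
      show "v = inv b \<otimes> (t \<otimes> (t \<otimes> (b \<otimes> v)))" unfolding tt using c by (simp flip: m_assoc)
      show "x = a \<otimes> (t \<otimes> (t \<otimes> (b \<otimes> v)))" unfolding tt using r by (auto simp: routes_def)
    qed
    show "inj_on h (Sigma X R)"
    proof (rule inj_onI)
      fix z z' assume z: "z \<in> Sigma X R" "z' \<in> Sigma X R"
        and e: "h z
          = h z'"
      obtain w v x a t b where zz: "z = ((w, v, x), (a, t, b))" by (metis prod.exhaust)
      obtain w' v' x' a' t' b' where zz': "z' = ((w', v', x'), (a', t', b'))" by (metis prod.exhaust)
      have e': "a' = a" "t' = t" "b' = b" "t \<otimes> (b \<otimes> v') = t \<otimes> (b \<otimes> v)" using e zz zz' by (auto simp: h_def)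
      have "v' = v" using rt(10)[OF z(1)[unfolded zz]] rt(10)[OF z(2)[unfolded zz']] e' by metis
      moreover have "x' = x" using rt(11)[OF z(1)[unfolded zz]] rt(11)[OF z(2)[unfolded zz']] e' by metis
      moreover have "w' = w" using rt(6)[OF z(1)[unfolded zz]] rt(6)[OF z(2)[unfolded zz']] e' by metis
      ultimately show "z = z'" using e' zz zz' by simp
    qed
    show "h ` Sigma X R \<subseteq> Sigma cliques Y"
    proof
      fix y assume "y \<in> h ` Sigma X R"
      then obtain z where z: "z \<in> Sigma X R" "y = h z"
        by blast
      obtain w v x a t b where zz: "z = ((w, v, x), (a, t, b))" by (metis prod.exhaust)
      show "y \<in> Sigma cliques Y"
        using z(2) zz rt(1-5,7-9)[OF z(1)[unfolded zz]] by (simp add: cliques_def Y_def h_def)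
    qed
    fix z assume z: "z \<in> Sigma X R"
    obtain w v x a t b where zz: "z = ((w, v, x), (a, t, b))" by (metis prod.exhaust)
    note c = rt[OF z[unfolded zz]]
    have "pmax ^ len t \<le> pmax ^ card S"
      using clique_len[OF c(4)] pmax_ge(1) by (rule power_increasing)
    moreover have "F t (a, b, t \<otimes> (b \<otimes> v)) = \<alpha> w * \<xi> v * \<eta> x"
      unfolding F_def using c(6,12-14) nn by (simp add: c(10,11)[symmetric])
    ultimately show "(case z of (z, r) \<Rightarrow> ?V z * (case r of (a, t, b) \<Rightarrow> pmax ^ len t))
        \<le> (case h z of (t, y) \<Rightarrow> pmax ^ card S * F t y)"
      using mult_right_mono[of "pmax ^ len t" "pmax ^ card S" "\<alpha> w * \<xi> v * \<eta> x"] nn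
      by (simp add: zz h_def mult.commute)
  next
    fix y assume "y \<in> Sigma cliques Y"
    then show "0 \<le> (case y of (t, y) \<Rightarrow> pmax ^ card S * F t y)"
      using F0 pmax_ge(1) by (auto split: prod.split)
  qed
  also have "\<dots> = (\<Sum>t\<in>cliques. pmax ^ card S * (\<Sum>y\<in>Y t. F t y))"
    using sum.Sigma[OF finite_cliques, of Y "\<lambda>t y. pmax ^ card S * F t y"] finY
    by (simp add: sum_distrib_left)
  also have "\<dots> \<le> (\<Sum>t\<in>cliques. pmax ^ card S *
      (sqrt (real prefix_bound) ^ 3 * L2_set \<alpha> (sph k) * L2_set \<xi> (sph n) * L2_set \<eta> (sph r)))"
  proof (intro sum_mono mult_left_mono)
    fix t assume t: "t \<in> cliques"
    show "(\<Sum>y\<in>Y t. F t y) \<le> sqrt (real prefix_bound) ^ 3 * L2_set \<alpha> (sph k) * L2_set \<xi> (sph n) * L2_set \<eta> (sph r)"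
    proof (cases "Y t = {}")
      case True
      then show ?thesis by simp
    next
      case False
      then obtain a b g where abg: "(a, b, g) \<in> Y t" by (metis ex_in_conv prod.exhaust)
      define i j l where ijl: "i = len a" "j = len b" "l = len g"
      have e: "k = i + len t + j" "n = j + len t + l" "r = i + len t + l"
        using abg by (auto simp: Y_def ijl)
      have "Y t = sph i \<times> sph j \<times> sph l"
        using e by (auto simp: Y_def sph_def)
      then show ?thesis
        using routes_through_clique[OF _ e, of \<alpha> \<xi> \<eta>] t by (simp add: F_def cliques_def)
    qed
    show "0 \<le> pmax ^ card S" using pmax_ge(1) by simp
  qed
  also have "\<dots> = haagerup_const * L2_set \<alpha> (sph k) * L2_set \<xi> (sph n) * L2_set \<eta> (sph r)"
    by (simp add: haagerup_const_def mult_ac)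
  finally show ?thesis .
qed

end

section \<open>A Schur multiplier\<close>

lemma int_sum_bound:
  fixes u :: "int \<Rightarrow> real" and b :: "nat \<Rightarrow> real"
  assumes u: "\<And>j. u j \<le> b (nat \<bar>j\<bar>)" and b: "\<And>n. 0 \<le> b n" "summable b" and J: "finite J"
  shows "sum u J \<le> 2 * suminf b"
proof -
  have half: "sum u K \<le> suminf b" if K: "finite K" "inj_on (\<lambda>j. nat \<bar>j\<bar>) K" for K
  proof -
    have "sum u K \<le> (\<Sum>j\<in>K. b (nat \<bar>j\<bar>))" by (intro sum_mono u)
    also have "\<dots> = sum b ((\<lambda>j. nat \<bar>j\<bar>) ` K)" using sum.reindex[OF K(2), of b] by simp
    also have "\<dots> \<le> suminf b" using K(1) b by (intro sum_le_suminf) auto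
    finally show ?thesis .
  qed
  have J_eq: "J = {j \<in> J. 0 \<le> j} \<union> {j \<in> J. j < 0}" by auto
  have "sum u ({j \<in> J. 0 \<le> j} \<union> {j \<in> J. j < 0}) = sum u {j \<in> J. 0 \<le> j} + sum u {j \<in> J. j < 0}"
    using J by (intro sum.union_disjoint) auto
  then have "sum u J = sum u {j \<in> J. 0 \<le> j} + sum u {j \<in> J. j < 0}"
    by (simp only: J_eq[symmetric])
  also have "\<dots> \<le> suminf b + suminf b"
    using J by (intro add_mono half) (auto simp: inj_on_def)
  finally show ?thesis by simp
qed

text \<open>The value at \<open>0\<close> is \<open>0\<close>, by the convention for division.\<close>

definition recip :: "int \<Rightarrow> real" where "recip j = 1 / real_of_int j"

definition recip_const :: real where "recip_const = 2 * (\<Sum>n. 1 / real n ^ 2)"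

lemma recip_square_sum: "finite J \<Longrightarrow> (\<Sum>j\<in>J. (recip j)\<^sup>2) \<le> recip_const"
  unfolding recip_const_def
  by (rule int_sum_bound)
     (auto simp: recip_def power_divide inverse_power_summable[of 2, simplified] inverse_eq_divide
       intro!: summable_cong[THEN iffD1, OF _ inverse_power_summable[of 2, where 'a=real]])

lemma recip_const_nonneg: "0 \<le> recip_const"
  using recip_square_sum[of "{}"] by simp

text \<open>The average of the function \<open>1 / j\<close> over a window of radius \<open>N\<close>. On the one hand it is the
  convolution of two square summable functions, one of which has small norm. On the other hand it is
  so close to \<open>1 / j\<close> that its defect is summable.\<close>

definition avg_recip :: "nat \<Rightarrow> int \<Rightarrow> real" where
  "avg_recip N j = (\<Sum>i\<in>{- int N..int N}. recip (j - i)) / (2 * real N + 1)"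

definition defect :: "nat \<Rightarrow> int \<Rightarrow> real" where
  "defect N j = 1 - real_of_int j * avg_recip N j"

text \<open>Writing the defect as an average of \<open>i / (i - j)\<close> and combining the terms for \<open>i\<close> and \<open>-i\<close>, the
  contributions of order \<open>1 / j\<close> cancel.\<close>

lemma defect_bound:
  assumes j: "2 * int N < \<bar>j\<bar>"
  shows "\<bar>defect N j\<bar> \<le> 2 * real N ^ 2 / real_of_int j ^ 2"
proof -
  let ?I = "{- int N..int N}" and ?c = "2 * real N + 1" and ?j = "real_of_int j"
  have j2: "4 * real N ^ 2 \<le> ?j ^ 2"
  proof -
    have "(2 * real N) ^ 2 \<le> \<bar>?j\<bar> ^ 2" using j by (intro power_mono) linarith+
    then show ?thesis by (simp add: power_mult_distrib)
  qed
  have j0: "?j \<noteq> 0" using j by auto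
  have i2: "real_of_int i ^ 2 \<le> real N ^ 2" if "i \<in> ?I" for i
  proof -
    have "\<bar>real_of_int i\<bar> ^ 2 \<le> real N ^ 2" using that by (intro power_mono) auto
    then show ?thesis by simp
  qed
  have den: "?j - real_of_int i \<noteq> 0" "?j + real_of_int i \<noteq> 0" if "i \<in> ?I" for i
    using that j by auto
  have card: "(\<Sum>i\<in>?I. (1::real)) = ?c" by simp
  have c0: "0 < ?c" by simp
  have "?c * defect N j = ?c - ?j * (?c * avg_recip N j)"
    by (simp add: defect_def algebra_simps)
  also have "?c * avg_recip N j = (\<Sum>i\<in>?I. recip (j - i))"
    using c0 by (simp add: avg_recip_def)
  also have "?c - ?j * (\<Sum>i\<in>?I. recip (j - i)) = (\<Sum>i\<in>?I. 1 - ?j * recip (j - i))"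
    by (simp only: sum_subtractf card sum_distrib_left)
  also have "\<dots> = (\<Sum>i\<in>?I. - real_of_int i / (?j - real_of_int i))"
    using den by (intro sum.cong refl) (simp add: recip_def field_simps)
  finally have 1: "?c * defect N j = (\<Sum>i\<in>?I. - real_of_int i / (?j - real_of_int i))" .
  also have "\<dots> = (\<Sum>i\<in>?I. real_of_int i / (?j + real_of_int i))"
    by (rule sum.reindex_bij_witness[of _ uminus uminus]) auto
  finally have 2: "?c * defect N j = (\<Sum>i\<in>?I. real_of_int i / (?j + real_of_int i))" .
  have "2 * (?c * defect N j) = (\<Sum>i\<in>?I. - real_of_int i / (?j - real_of_int i) + real_of_int i / (?j + real_of_int i))"
    unfolding sum.distrib using 1 2 by linarith
  also have "\<dots> = (\<Sum>i\<in>?I. - 2 * (real_of_int i ^ 2 / (?j ^ 2 - real_of_int i ^ 2)))"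
  proof (intro sum.cong refl)
    fix i assume i: "i \<in> ?I"
    have "?j ^ 2 - real_of_int i ^ 2 = (?j - real_of_int i) * (?j + real_of_int i)"
      by (simp add: power2_eq_square algebra_simps)
    then show "- real_of_int i / (?j - real_of_int i) + real_of_int i / (?j + real_of_int i)
        = - 2 * (real_of_int i ^ 2 / (?j ^ 2 - real_of_int i ^ 2))"
      using den[OF i] by (simp add: divide_simps power2_eq_square) (simp add: algebra_simps)
  qed
  also have "\<dots> = - 2 * (\<Sum>i\<in>?I. real_of_int i ^ 2 / (?j ^ 2 - real_of_int i ^ 2))"
    by (simp only: sum_distrib_left)
  finally have "?c * defect N j = - (\<Sum>i\<in>?I. real_of_int i ^ 2 / (?j ^ 2 - real_of_int i ^ 2))"
    by linarith
  then have "\<bar>?c * defect N j\<bar> \<le> (\<Sum>i\<in>?I. \<bar>real_of_int i ^ 2 / (?j ^ 2 - real_of_int i ^ 2)\<bar>)"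
    by (simp only: abs_minus_cancel) (rule sum_abs)
  also have "\<dots> \<le> (\<Sum>i\<in>?I. 2 * real N ^ 2 / ?j ^ 2)"
  proof (rule sum_mono)
    fix i assume i: "i \<in> ?I"
    have p: "0 < ?j ^ 2" using j0 by simp
    have "?j ^ 2 / 2 \<le> ?j ^ 2 - real_of_int i ^ 2" using j2 i2[OF i] zero_le_power2[of "real N"] by linarith
    then have "real_of_int i ^ 2 / (?j ^ 2 - real_of_int i ^ 2) \<le> real N ^ 2 / (?j ^ 2 / 2)"
      using i2[OF i] p by (intro frac_le) auto
    moreover have "0 \<le> real_of_int i ^ 2 / (?j ^ 2 - real_of_int i ^ 2)"
      using \<open>?j ^ 2 / 2 \<le> _\<close> p by (intro divide_nonneg_nonneg) (auto intro: order_trans[of _ "?j ^ 2 / 2"])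
    moreover have "real N ^ 2 / (?j ^ 2 / 2) = 2 * real N ^ 2 / ?j ^ 2" by simp
    ultimately show "\<bar>real_of_int i ^ 2 / (?j ^ 2 - real_of_int i ^ 2)\<bar> \<le> 2 * real N ^ 2 / ?j ^ 2"
      by (simp only: abs_of_nonneg)
  qed
  also have "\<dots> = ?c * (2 * real N ^ 2 / ?j ^ 2)" by simp
  finally have "?c * \<bar>defect N j\<bar> \<le> ?c * (2 * real N ^ 2 / ?j ^ 2)" by (simp add: abs_mult)
  then show ?thesis by (rule mult_left_le_imp_le) simp
qed

lemma defect_summable: "\<exists>\<Phi>. \<forall>J. finite J \<longrightarrow> (\<Sum>j\<in>J. \<bar>defect N j\<bar>) \<le> \<Phi>"
proof -
  define b where "b n = \<bar>defect N (int n)\<bar> + \<bar>defect N (- int n)\<bar>" for n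
  have "summable b"
  proof (rule summable_comparison_test')
    show "summable (\<lambda>n. 4 * real N ^ 2 * (1 / real n ^ 2))"
      using inverse_power_summable[of 2, where 'a=real]
      by (intro summable_mult) (simp add: inverse_eq_divide power_divide)
    fix n assume n: "2 * N + 1 \<le> n"
    then have "2 * int N < \<bar>int n\<bar>" "2 * int N < \<bar>- int n\<bar>" by auto
    from defect_bound[OF this(1)] defect_bound[OF this(2)]
    show "norm (b n) \<le> 4 * real N ^ 2 * (1 / real n ^ 2)"
      by (simp add: b_def)
  qed
  moreover have "\<bar>defect N j\<bar> \<le> b (nat \<bar>j\<bar>)" for j
    by (cases "0 \<le> j") (auto simp: b_def)
  ultimately show ?thesis
    by (intro exI[of _ "2 * suminf b"] allI impI int_sum_bound) (auto simp: b_def)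
qed

text \<open>Young's inequality, by distributing the square root of the kernel to both functions.\<close>

lemma convolution_bound:
  fixes f :: "int \<Rightarrow> real" and u v :: "nat \<Rightarrow> real"
  assumes f: "\<And>J. finite J \<Longrightarrow> (\<Sum>j\<in>J. \<bar>f j\<bar>) \<le> \<Phi>" and fin: "finite A" "finite B"
  shows "(\<Sum>(m, n)\<in>A \<times> B. \<bar>f (int m - int n)\<bar> * \<bar>u m\<bar> * \<bar>v n\<bar>) \<le> \<Phi> * L2_set u A * L2_set v B"
proof -
  let ?s = "\<lambda>m n. sqrt \<bar>f (int m - int n)\<bar>"
  let ?x = "\<lambda>(m, n). ?s m n * u m" and ?y = "\<lambda>(m, n). ?s m n * v n"
  have \<Phi>: "0 \<le> \<Phi>" using f[of "{}"] by simp
  have r: "(\<Sum>n\<in>B. \<bar>f (int m - int n)\<bar>) \<le> \<Phi>" if "finite B" for m B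
  proof -
    have "(\<Sum>n\<in>B. \<bar>f (int m - int n)\<bar>) = (\<Sum>j\<in>(\<lambda>n. int m - int n) ` B. \<bar>f j\<bar>)"
      by (subst sum.reindex) (auto simp: inj_on_def)
    then show ?thesis using f[of "(\<lambda>n. int m - int n) ` B"] that by simp
  qed
  have c: "(\<Sum>m\<in>A. \<bar>f (int m - int n)\<bar>) \<le> \<Phi>" if "finite A" for n A
  proof -
    have "(\<Sum>m\<in>A. \<bar>f (int m - int n)\<bar>) = (\<Sum>j\<in>(\<lambda>m. int m - int n) ` A. \<bar>f j\<bar>)"
      by (subst sum.reindex) (auto simp: inj_on_def)
    then show ?thesis using f[of "(\<lambda>m. int m - int n) ` A"] that by simp
  qed
  have "w * \<bar>a\<bar> * \<bar>b\<bar> = \<bar>s * a\<bar> * \<bar>s * b\<bar>" if "0 \<le> s" "s * s = w" for s w a b :: real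
    using that by (auto simp: abs_mult mult_ac)
  then have sq: "\<bar>f z\<bar> * \<bar>a\<bar> * \<bar>b\<bar> = \<bar>sqrt \<bar>f z\<bar> * a\<bar> * \<bar>sqrt \<bar>f z\<bar> * b\<bar>" for z and a b :: real
    by simp
  have "(\<Sum>(m, n)\<in>A \<times> B. \<bar>f (int m - int n)\<bar> * \<bar>u m\<bar> * \<bar>v n\<bar>) = (\<Sum>z\<in>A \<times> B. \<bar>?x z\<bar> * \<bar>?y z\<bar>)"
    by (intro sum.cong refl) (auto intro!: sq)
  also have "\<dots> \<le> L2_set ?x (A \<times> B) * L2_set ?y (A \<times> B)" by (rule L2_set_mult_ineq)
  also have "\<dots> \<le> (sqrt \<Phi> * L2_set u A) * (sqrt \<Phi> * L2_set v B)"
  proof (intro mult_mono)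
    have "(\<Sum>z\<in>A \<times> B. (?x z)\<^sup>2) = (\<Sum>m\<in>A. (\<Sum>n\<in>B. \<bar>f (int m - int n)\<bar>) * (u m)\<^sup>2)"
      by (simp add: sum.cartesian_product' power_mult_distrib sum_distrib_right)
    also have "\<dots> \<le> (\<Sum>m\<in>A. \<Phi> * (u m)\<^sup>2)" by (intro sum_mono mult_right_mono r fin) auto
    finally show "L2_set ?x (A \<times> B) \<le> sqrt \<Phi> * L2_set u A"
      by (simp add: L2_set_def sum_distrib_left flip: real_sqrt_mult)
    have "(\<Sum>z\<in>A \<times> B. (?y z)\<^sup>2) = (\<Sum>n\<in>B. \<Sum>m\<in>A. \<bar>f (int m - int n)\<bar> * (v n)\<^sup>2)"
      by (simp add: sum.cartesian_product' power_mult_distrib sum.swap[of _ A B])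
    also have "\<dots> = (\<Sum>n\<in>B. (\<Sum>m\<in>A. \<bar>f (int m - int n)\<bar>) * (v n)\<^sup>2)"
      by (simp add: sum_distrib_right)
    also have "\<dots> \<le> (\<Sum>n\<in>B. \<Phi> * (v n)\<^sup>2)" by (intro sum_mono mult_right_mono c fin) auto
    finally show "L2_set ?y (A \<times> B) \<le> sqrt \<Phi> * L2_set v B"
      by (simp add: L2_set_def sum_distrib_left flip: real_sqrt_mult)
  qed (auto simp: \<Phi>)
  also have "\<dots> = \<Phi> * L2_set u A * L2_set v B" using \<Phi> by (simp add: mult_ac) 
  finally show ?thesis .
qed

lemma op_form_bound:
  assumes Y: "Y \<in> bounded_operators I" and F: "finite F" "F \<subseteq> I" and G: "finite G" "G \<subseteq> I"
  shows "cmod (\<Sum>x\<in>F. \<Sum>v\<in>G. cnj (\<eta> x) * \<xi> v * Y (delta v) x)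
    \<le> operator_norm I Y * L2c \<eta> F * L2c \<xi> G"
proof -
  have t: "trunc F \<eta> \<in> ell2 I" "trunc G \<xi> \<in> ell2 I" using trunc_in_ell2 F G by blast+
  have "(\<Sum>x\<in>F. \<Sum>v\<in>G. cnj (\<eta> x) * \<xi> v * Y (delta v) x) = ell2_inner I (trunc F \<eta>) (Y (trunc G \<xi>))"
    by (simp add: ell2_inner_trunc[OF F] op_trunc[OF Y G] sum_distrib_left mult.assoc)
  also have "cmod \<dots> \<le> ell2_norm I (trunc F \<eta>) * ell2_norm I (Y (trunc G \<xi>))"
    by (rule ell2_inner_summable(2)[OF t(1) op_closed[OF Y t(2)]])
  also have "\<dots> \<le> ell2_norm I (trunc F \<eta>) * (operator_norm I Y * ell2_norm I (trunc G \<xi>))"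
    by (intro mult_left_mono op_norm_bound(1)[OF Y t(2)]) simp
  finally show ?thesis by (simp add: ell2_norm_trunc[OF F] ell2_norm_trunc[OF G] mult_ac)
qed

text \<open>Multiplying the matrix of an operator by \<open>(f * g) (lh x - lh v)\<close> has norm at most the product of the
  square norms of \<open>f\<close> and \<open>g\<close>: the convolution is a sum of products, and each summand multiplies the
  vectors by functions.\<close>

lemma schur_avg_recip:
  fixes lh :: "'x \<Rightarrow> nat"
  assumes Y: "Y \<in> bounded_operators I" and F: "finite F" "F \<subseteq> I" and G: "finite G" "G \<subseteq> I"
  shows "cmod (\<Sum>x\<in>F. \<Sum>v\<in>G. cnj (\<eta> x) * \<xi> v *
      (complex_of_real (avg_recip N (int (lh x) - int (lh v))) * Y (delta v) x))
    \<le> sqrt (recip_const / (2 * real N + 1)) * operator_norm I Y * L2c \<eta> F * L2c \<xi> G"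
proof -
  define M where "M = Max (insert 0 (lh ` G))"
  have M: "lh v \<le> M" if "v \<in> G" for v unfolding M_def using G that by (intro Max_ge) auto
  define J where "J = {- int N..int M + int N}"
  define g where "g i = (if \<bar>i\<bar> \<le> int N then 1 / (2 * real N + 1) else 0)" for i
  let ?c = "2 * real N + 1"
  have conv: "avg_recip N (int (lh x) - int (lh v)) = (\<Sum>i\<in>J. recip (int (lh x) - i) * g (i - int (lh v)))"
    if v: "v \<in> G" for x v
  proof -
    have "(\<Sum>i\<in>J. recip (int (lh x) - i) * g (i - int (lh v)))
        = (\<Sum>i\<in>{int (lh v) - int N..int (lh v) + int N}. recip (int (lh x) - i) * (1 / ?c))"
      by (rule sum.mono_neutral_cong_right) (use M[OF v] in \<open>auto simp: J_def g_def\<close>)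
    also have "\<dots> = (\<Sum>i\<in>{- int N..int N}. recip (int (lh x) - int (lh v) - i) * (1 / ?c))"
      by (rule sum.reindex_bij_witness[of _ "\<lambda>i. i + int (lh v)" "\<lambda>i. i - int (lh v)"]) (auto simp: algebra_simps)
    finally show ?thesis by (simp add: avg_recip_def sum_divide_distrib)
  qed
  define a where "a i x = complex_of_real (recip (int (lh x) - i)) * \<eta> x" for i x
  define b where "b i v = complex_of_real (g (i - int (lh v))) * \<xi> v" for i v
  have "(\<Sum>x\<in>F. \<Sum>v\<in>G. cnj (\<eta> x) * \<xi> v *
      (complex_of_real (avg_recip N (int (lh x) - int (lh v))) * Y (delta v) x))
    = (\<Sum>x\<in>F. \<Sum>v\<in>G. \<Sum>i\<in>J. cnj (a i x) * b i v * Y (delta v) x)"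
    by (intro sum.cong refl)
       (simp add: conv a_def b_def sum_distrib_left sum_distrib_right mult_ac)
  also have "\<dots> = (\<Sum>x\<in>F. \<Sum>i\<in>J. \<Sum>v\<in>G. cnj (a i x) * b i v * Y (delta v) x)"
    by (intro sum.cong refl sum.swap)
  also have "\<dots> = (\<Sum>i\<in>J. \<Sum>x\<in>F. \<Sum>v\<in>G. cnj (a i x) * b i v * Y (delta v) x)"
    by (rule sum.swap)
  finally have "cmod (\<Sum>x\<in>F. \<Sum>v\<in>G. cnj (\<eta> x) * \<xi> v *
      (complex_of_real (avg_recip N (int (lh x) - int (lh v))) * Y (delta v) x))
    \<le> (\<Sum>i\<in>J. cmod (\<Sum>x\<in>F. \<Sum>v\<in>G. cnj (a i x) * b i v * Y (delta v) x))"
    by (simp only: norm_sum)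
  also have "\<dots> \<le> (\<Sum>i\<in>J. operator_norm I Y * L2c (a i) F * L2c (b i) G)"
    by (intro sum_mono op_form_bound Y F G)
  also have "\<dots> = operator_norm I Y * (\<Sum>i\<in>J. \<bar>L2c (a i) F\<bar> * \<bar>L2c (b i) G\<bar>)"
    by (simp add: sum_distrib_left mult.assoc)
  also have "\<dots> \<le> operator_norm I Y * (L2_set (\<lambda>i. L2c (a i) F) J * L2_set (\<lambda>i. L2c (b i) G) J)"
    by (intro mult_left_mono L2_set_mult_ineq op_norm_nonneg[OF Y])
  also have "\<dots> \<le> operator_norm I Y * ((sqrt recip_const * L2c \<eta> F) * (sqrt (1 / ?c) * L2c \<xi> G))"
  proof (intro mult_left_mono mult_mono op_norm_nonneg[OF Y])
    have "(\<Sum>i\<in>J. (L2c (a i) F)\<^sup>2) = (\<Sum>x\<in>F. (\<Sum>i\<in>J. (recip (int (lh x) - i))\<^sup>2) * (cmod (\<eta> x))\<^sup>2)"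
      by (simp add: L2_set_def sum_nonneg a_def norm_mult power_mult_distrib sum_distrib_right sum.swap[of _ F J])
    also have "\<dots> \<le> (\<Sum>x\<in>F. recip_const * (cmod (\<eta> x))\<^sup>2)"
    proof (intro sum_mono mult_right_mono)
      fix x
      have "(\<Sum>i\<in>J. (recip (int (lh x) - i))\<^sup>2) = (\<Sum>i\<in>(\<lambda>i. int (lh x) - i) ` J. (recip i)\<^sup>2)"
        by (subst sum.reindex) (auto simp: inj_on_def)
      also have "\<dots> \<le> recip_const" by (rule recip_square_sum) (simp add: J_def)
      finally show "(\<Sum>i\<in>J. (recip (int (lh x) - i))\<^sup>2) \<le> recip_const" .
    qed simp
    finally show "L2_set (\<lambda>i. L2c (a i) F) J \<le> sqrt recip_const * L2c \<eta> F"
      by (simp add: L2_set_def[of "\<lambda>i. L2c (a i) F"] L2_set_def[of "\<lambda>x. cmod (\<eta> x)"] sum_distrib_left flip: real_sqrt_mult)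
    have "(\<Sum>i\<in>J. (L2c (b i) G)\<^sup>2) = (\<Sum>v\<in>G. (\<Sum>i\<in>J. (g (i - int (lh v)))\<^sup>2) * (cmod (\<xi> v))\<^sup>2)"
      by (simp add: L2_set_def sum_nonneg b_def norm_mult power_mult_distrib sum_distrib_right sum.swap[of _ G J])
    also have "\<dots> \<le> (\<Sum>v\<in>G. (1 / ?c) * (cmod (\<xi> v))\<^sup>2)"
    proof (intro sum_mono mult_right_mono)
      fix v assume v: "v \<in> G"
      have "(\<Sum>i\<in>J. (g (i - int (lh v)))\<^sup>2) = (\<Sum>i\<in>{int (lh v) - int N..int (lh v) + int N}. (1 / ?c)\<^sup>2)"
        by (rule sum.mono_neutral_cong_right) (use M[OF v] in \<open>auto simp: J_def g_def\<close>)
      also have "\<dots> = ?c * (1 / ?c)\<^sup>2" by simp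
      also have "\<dots> = 1 / ?c" by (simp add: power2_eq_square)
      finally show "(\<Sum>i\<in>J. (g (i - int (lh v)))\<^sup>2) \<le> 1 / ?c" by simp
    qed simp
    finally show "L2_set (\<lambda>i. L2c (b i) G) J \<le> sqrt (1 / ?c) * L2c \<xi> G"
      by (simp add: L2_set_def[of "\<lambda>i. L2c (b i) G"] L2_set_def[of "\<lambda>x. cmod (\<xi> x)"] sum_distrib_left flip: real_sqrt_mult)
  qed (auto simp: recip_const_nonneg)
  also have "\<dots> = sqrt (recip_const / ?c) * operator_norm I Y * L2c \<eta> F * L2c \<xi> G"
    by (simp add: real_sqrt_divide)
  finally show ?thesis .
qed

section \<open>Commutators with the length operator\<close>

context hecke_system
begin

abbreviation dom :: "('a \<Rightarrow> complex) set" where "dom \<equiv> length_domain W S"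
abbreviation D :: "('a \<Rightarrow> complex) \<Rightarrow> ('a \<Rightarrow> complex)" where "D \<equiv> length_operator W S"
abbreviation opnorm :: "'a operator \<Rightarrow> real" where "opnorm \<equiv> operator_norm (carrier W)"

lemma Op_nrm: "nrm Op = opnorm" by (simp add: Op_def)

text \<open>The bounded operator \<open>y\<close> is the commutator of the length operator with \<open>x\<close>. That \<open>x\<close> preserves
  the domain is part of the notion, as it makes the Leibniz rule meaningful.\<close>

definition der :: "'a operator \<Rightarrow> 'a operator \<Rightarrow> bool" where
  "der x y \<longleftrightarrow> x \<in> carrier Op \<and> y \<in> carrier Op \<and>
     (\<forall>f\<in>dom. x f \<in> dom \<and> (\<forall>w. D (x f) w = y f w + x (D f) w))"

lemma dom_l2: "f \<in> dom \<Longrightarrow> f \<in> l2 \<and> D f \<in> l2"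
  by (simp add: length_domain_def)

lemma dom_add:
  assumes "f \<in> dom" "g \<in> dom"
  shows "(\<lambda>v. f v + g v) \<in> dom" "D (\<lambda>v. f v + g v) = (\<lambda>v. D f v + D g v)"
proof -
  show e: "D (\<lambda>v. f v + g v) = (\<lambda>v. D f v + D g v)" by (simp add: length_operator_def distrib_left)
  show "(\<lambda>v. f v + g v) \<in> dom"
    using assms e ell2_add(1)[of "D f" "carrier W" "D g"] ell2_add(1)[of f "carrier W" g]
    by (simp add: length_domain_def)
qed

lemma dom_scale:
  assumes "f \<in> dom"
  shows "(\<lambda>v. c * f v) \<in> dom" "D (\<lambda>v. c * f v) = (\<lambda>v. c * D f v)"
proof -
  show e: "D (\<lambda>v. c * f v) = (\<lambda>v. c * D f v)" by (simp add: length_operator_def mult_ac)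
  show "(\<lambda>v. c * f v) \<in> dom"
    using assms e ell2_scale[of "D f" "carrier W" c] ell2_scale[of f "carrier W" c]
    by (simp add: length_domain_def)
qed

lemma D_delta: "D (delta w) = (\<lambda>v. of_nat (len w) * delta w v)"
  by (auto simp: length_operator_def delta_def)

lemma delta_dom: "w \<in> carrier W \<Longrightarrow> delta w \<in> dom"
  using ell2_scale[OF delta_in_ell2[of w "carrier W"], of "of_nat (len w)"]
  by (simp add: length_domain_def D_delta delta_in_ell2)

lemma der_one: "der \<one>\<^bsub>Op\<^esub> \<zero>\<^bsub>Op\<^esub>"
  using dom_l2 by (auto simp: der_def B.A_one_closed B.A_zero_closed Op_one_apply Op_zero_apply)

lemma der_zero: "der \<zero>\<^bsub>Op\<^esub> \<zero>\<^bsub>Op\<^esub>"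
  using dom_l2
  by (auto simp: der_def B.A_zero_closed Op_zero_apply length_operator_def length_domain_def)

lemma der_add:
  assumes x: "der x y" and x': "der x' y'"
  shows "der (x \<oplus>\<^bsub>Op\<^esub> x') (y \<oplus>\<^bsub>Op\<^esub> y')"
  unfolding der_def
proof (intro conjI ballI allI)
  fix f w assume f: "f \<in> dom"
  show "(x \<oplus>\<^bsub>Op\<^esub> x') f \<in> dom" "D ((x \<oplus>\<^bsub>Op\<^esub> x') f) w = (y \<oplus>\<^bsub>Op\<^esub> y') f w + (x \<oplus>\<^bsub>Op\<^esub> x') (D f) w"
    using x x' f dom_l2[OF f] dom_add[of "x f" "x' f"] by (simp_all add: der_def Op_add_apply)
qed (use x x' in \<open>auto simp: der_def B.A_a_closed\<close>)

lemma der_smult: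
  assumes x: "der x y"
  shows "der (c \<odot>\<^bsub>Op\<^esub> x) (c \<odot>\<^bsub>Op\<^esub> y)"
  unfolding der_def
proof (intro conjI ballI allI)
  fix f w assume f: "f \<in> dom"
  show "(c \<odot>\<^bsub>Op\<^esub> x) f \<in> dom" "D ((c \<odot>\<^bsub>Op\<^esub> x) f) w = (c \<odot>\<^bsub>Op\<^esub> y) f w + (c \<odot>\<^bsub>Op\<^esub> x) (D f) w"
    using x f dom_l2[OF f] dom_scale[of "x f" c] by (simp_all add: der_def Op_smult_apply distrib_left)
qed (use x in \<open>auto simp: der_def\<close>)

lemma der_mult:
  assumes x: "der x y" and x': "der x' y'"
  shows "der (x \<otimes>\<^bsub>Op\<^esub> x') (y \<otimes>\<^bsub>Op\<^esub> x' \<oplus>\<^bsub>Op\<^esub> x \<otimes>\<^bsub>Op\<^esub> y')"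
  unfolding der_def
proof (intro conjI ballI allI)
  have c: "x \<in> carrier Op" "x' \<in> carrier Op" "y \<in> carrier Op" "y' \<in> carrier Op"
    using x x' by (auto simp: der_def)
  fix f w assume f: "f \<in> dom"
  note f2 = dom_l2[OF f]
  have x'f: "x' f \<in> dom" "D (x' f) = (\<lambda>w. y' f w + x' (D f) w)" using x' f by (auto simp: der_def)
  show "(x \<otimes>\<^bsub>Op\<^esub> x') f \<in> dom" using x x'f f2 by (simp add: der_def Op_mult_apply)
  have "x (D (x' f)) = (\<lambda>w. x (y' f) w + x (x' (D f)) w)"
    unfolding x'f(2)
    by (rule op_add[of x "carrier W"]) (use c f2 in \<open>auto simp: Op_carrier[symmetric] Op_apply_closed\<close>)
  moreover have "D (x (x' f)) w = y (x' f) w + x (D (x' f)) w" using x x'f by (simp add: der_def)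
  ultimately show "D ((x \<otimes>\<^bsub>Op\<^esub> x') f) w
      = (y \<otimes>\<^bsub>Op\<^esub> x' \<oplus>\<^bsub>Op\<^esub> x \<otimes>\<^bsub>Op\<^esub> y') f w + (x \<otimes>\<^bsub>Op\<^esub> x') (D f) w"
    using f2 by (simp add: Op_mult_apply Op_add_apply)
qed (use x x' in \<open>auto simp: der_def B.A_a_closed B.A_m_closed\<close>)

text \<open>For a generator the entries of the commutator are the lengths gained, \<open>1\<close> or \<open>-1\<close>. Its
  boundedness follows from that of generators for special parameters: for \<open>q = 1\<close> the generator is
  the translation by \<open>s\<close>, and for \<open>q = 4\<close> it differs from that by \<open>3/2\<close> times the projection onto the
  elements with descent \<open>s\<close>.\<close>

lemma der_gen:
  assumes s: "s \<in> S"
  obtains y where "der (gen s) y"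
proof -
  define l where "l = hecke_generator W S (\<lambda>_. 1) s"
  define g where "g = hecke_generator W S (\<lambda>_. 4) s"
  have c: "l \<in> carrier Op" "g \<in> carrier Op"
    unfolding l_def g_def Op_carrier by (intro hecke_generator_bounded s)+
  define P where "P = (2/3) \<odot>\<^bsub>Op\<^esub> (g \<oplus>\<^bsub>Op\<^esub> (-1) \<odot>\<^bsub>Op\<^esub> l)"
  define y where "y = (2 \<odot>\<^bsub>Op\<^esub> P \<oplus>\<^bsub>Op\<^esub> (-1) \<odot>\<^bsub>Op\<^esub> \<one>\<^bsub>Op\<^esub>) \<otimes>\<^bsub>Op\<^esub> l"
  have Pc: "P \<in> carrier Op" using c by (simp add: P_def B.A_a_closed)
  have yc: "y \<in> carrier Op" using c Pc by (simp add: y_def B.A_a_closed B.A_m_closed B.A_one_closed)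
  have lf: "l f w = f (s \<otimes> w)" if "f \<in> l2" "w \<in> carrier W" for f w
    using that by (simp add: l_def hecke_generator_def hecke_p_def)
  have hp: "complex_of_real (hecke_p (\<lambda>_. 4) s) = 3 / 2" by (simp add: hecke_p_def)
  have Pf: "P f w = (if desc s w then f w else 0)" if "f \<in> l2" "w \<in> carrier W" for f w
    using that lf[OF that] by (simp add: P_def g_def Op_smult_apply Op_add_apply hecke_generator_def hp)
  have yf: "y f w = (if desc s w then f (s \<otimes> w) else - f (s \<otimes> w))"
    if "f \<in> l2" "w \<in> carrier W" for f w
    using that lf[OF that] Pf[OF Op_apply_closed[OF c(1) that(1)] that(2)] Op_apply_closed[OF c(1) that(1)]
    by (simp add: y_def Op_mult_apply Op_add_apply Op_smult_apply Op_one_apply)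
  have "der (gen s) y"
    unfolding der_def
  proof (intro conjI ballI allI gen_carrier s yc)
    fix f assume f: "f \<in> dom"
    note f2 = dom_l2[OF f]
    have e: "D (gen s f) w = y f w + gen s (D f) w" for w
    proof (cases "w \<in> carrier W")
      case True
      consider "len (s \<otimes> w) = Suc (len w)" | "len w = Suc (len (s \<otimes> w))"
        using len_S_mult[OF s True] by linarith
      then have "of_nat (len w) = (of_nat (len (s \<otimes> w)) + (if desc s w then 1 else -1) :: complex)"
        by cases simp_all
      then show ?thesis
        using f2 True yf[of f w] by (simp add: gen_apply length_operator_def algebra_simps)
    next
      case False
      then show ?thesis
        using ell2_outside[OF Op_apply_closed[OF yc], of f] ell2_outside[OF Op_apply_closed[OF gen_carrier[OF s]], of f]
          ell2_outside[OF Op_apply_closed[OF gen_carrier[OF s]], of "D f"] f2 by (simp add: length_operator_def)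
    qed
    then show "\<And>w. D (gen s f) w = y f w + gen s (D f) w" .
    have "D (gen s f) = (\<lambda>w. y f w + gen s (D f) w)" by (rule ext) (rule e)
    moreover have "(\<lambda>w. y f w + gen s (D f) w) \<in> l2"
      by (rule ell2_add(1)[OF Op_apply_closed[OF yc] Op_apply_closed[OF gen_carrier[OF s]]]) (simp_all add: f2)
    ultimately have "D (gen s f) \<in> l2" by (simp only:)
    then show "gen s f \<in> dom"
      using f2 Op_apply_closed[OF gen_carrier[OF s]] by (simp add: length_domain_def)
  qed
  then show ?thesis by (rule that)
qed

lemma der_exists:
  assumes "x \<in> H" obtains y where "der x y"
proof -
  have T: "\<exists>y. der (T w) y" if w: "w \<in> carrier W" for w
  proof -
    obtain u where u: "set u \<subseteq> S" "red u" "list_mult W u = w" using red_exists w by blast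
    have "\<exists>y. der (Tword u) y"
      using u(1)
    proof (induction u)
      case Nil
      then show ?case using der_one by auto
    next
      case (Cons s u)
      obtain y where "der (gen s) y" using der_gen[of s] Cons.prems by auto
      then show ?case using Cons der_mult by fastforce
    qed
    then show ?thesis using T_eq[OF u] by simp
  qed
  have "\<exists>y. der x y"
    using assms
  proof (induction rule: H_induct)
    case zero
    then show ?case using der_zero by blast
  next
    case (add c w y)
    then show ?case using T[OF add(1)] der_add der_smult by metis
  qed
  then show ?thesis using that by blast
qed

abbreviation comm :: "'a operator \<Rightarrow> 'a operator" where "comm x \<equiv> length_commutator W S x"

lemma comm_eq:
  assumes "der x y" shows "comm x = y"
  unfolding length_commutator_def
proof (rule the_equality)
  have c: "x \<in> carrier Op" "y \<in> carrier Op" using assms by (auto simp: der_def)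
  show y: "y \<in> bounded_operators (carrier W) \<and>
    (\<forall>f\<in>dom. x f \<in> dom \<longrightarrow> y f = (\<lambda>w. D (x f) w - x (D f) w))"
    using assms by (auto simp: der_def Op_carrier)
  fix U assume U: "U \<in> bounded_operators (carrier W) \<and>
    (\<forall>f\<in>dom. x f \<in> dom \<longrightarrow> U f = (\<lambda>w. D (x f) w - x (D f) w))"
  show "U = y"
  proof (rule op_eqI_delta)
    fix w assume "w \<in> carrier W"
    then have "delta w \<in> dom" by (rule delta_dom)
    moreover from this have "x (delta w) \<in> dom" using assms by (simp add: der_def)
    ultimately show "U (delta w) = y (delta w)" using U y by simp
  qed (use U y in auto)
qed

lemma comm_carrier: "x \<in> H \<Longrightarrow> comm x \<in> carrier Op"
  using der_exists comm_eq der_def by metis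

lemma comm_add: "x \<in> H \<Longrightarrow> y \<in> H \<Longrightarrow> comm (x \<oplus>\<^bsub>Op\<^esub> y) = comm x \<oplus>\<^bsub>Op\<^esub> comm y"
  using der_exists comm_eq der_add by metis

lemma comm_smult: "x \<in> H \<Longrightarrow> comm (c \<odot>\<^bsub>Op\<^esub> x) = c \<odot>\<^bsub>Op\<^esub> comm x"
  using der_exists comm_eq der_smult by metis

lemma comm_one: "comm \<one>\<^bsub>Op\<^esub> = \<zero>\<^bsub>Op\<^esub>"
  using comm_eq[OF der_one] .

lemma comm_entry:
  assumes x: "x \<in> H" and v: "v \<in> carrier W"
  shows "comm x (delta v) w = (of_nat (len w) - of_nat (len v)) * x (delta v) w"
proof -
  obtain y where y: "der x y" using der_exists[OF x] by blast
  have "D (x (delta v)) w = y (delta v) w + x (D (delta v)) w"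
    using y delta_dom[OF v] by (simp add: der_def)
  moreover have "x (D (delta v)) w = of_nat (len v) * x (delta v) w"
    unfolding D_delta
    using op_scale[OF _ delta_in_ell2[OF v], of x] H_carrier[OF x] by (simp add: Op_carrier)
  ultimately show ?thesis
    by (simp add: comm_eq[OF y] length_operator_def algebra_simps)
qed

section \<open>The norm estimate\<close>

abbreviation coef :: "'a operator \<Rightarrow> 'a \<Rightarrow> complex" where "coef x \<equiv> x (delta \<one>)"

lemma entry_le:
  assumes x: "x \<in> H"
  obtains K where "finite K"
    "\<And>v y. v \<in> carrier W \<Longrightarrow> y \<in> carrier W \<Longrightarrow>
      cmod (x (delta v) y) \<le> (\<Sum>k\<in>K. \<Sum>w\<in>sph k. cmod (coef x w) * route_weight w v y)"
proof -
  obtain F where F: "finite F" "F \<subseteq> carrier W" "\<And>w. w \<notin> F \<Longrightarrow> coef x w = 0"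
    "\<And>f v. f \<in> l2 \<Longrightarrow> x f v = (\<Sum>w\<in>F. coef x w * T w f v)" by (rule H_expansion[OF x]) (rule that)
  have rw: "0 \<le> route_weight w v y" for w v y
    unfolding route_weight_def using pmax_ge(1) by (intro sum_nonneg) auto
  show ?thesis
  proof (rule that[of "len ` F"])
    fix v y assume vy: "v \<in> carrier W" "y \<in> carrier W"
    have "cmod (x (delta v) y) \<le> (\<Sum>w\<in>F. cmod (coef x w) * route_weight w v y)"
      unfolding F(4)[OF delta_in_ell2[OF vy(1)]]
      using entry_bound[OF _ vy] F(2)
      by (intro order_trans[OF norm_sum] sum_mono) (auto simp: norm_mult intro!: mult_left_mono)
    also have "\<dots> = (\<Sum>k\<in>len ` F. \<Sum>w\<in>{w \<in> F. len w = k}. cmod (coef x w) * route_weight w v y)"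
      by (rule sum.group[symmetric]) (use F in auto)
    also have "\<dots> \<le> (\<Sum>k\<in>len ` F. \<Sum>w\<in>sph k. cmod (coef x w) * route_weight w v y)"
      using F(2) by (intro sum_mono sum_mono2 finite_sph) (auto simp: sph_def rw)
    finally show "cmod (x (delta v) y) \<le> (\<Sum>k\<in>len ` F. \<Sum>w\<in>sph k. cmod (coef x w) * route_weight w v y)" .
  qed (use F in auto)
qed

text \<open>Vectors are cut into their parts on spheres, since the Haagerup inequality applies to one pair of
  spheres at a time.\<close>

lemma L2_spheres:
  fixes \<eta> :: "'a \<Rightarrow> real"
  assumes F: "finite F" "F \<subseteq> carrier W" and R: "\<And>x. x \<in> F \<Longrightarrow> len x \<le> R"
  shows "L2_set (\<lambda>n. L2_set (\<lambda>x. if x \<in> F then \<eta> x else 0) (sph n)) {..R} = L2_set \<eta> F"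
proof -
  have "(\<Sum>n\<le>R. (L2_set (\<lambda>x. if x \<in> F then \<eta> x else 0) (sph n))\<^sup>2)
      = (\<Sum>n\<le>R. \<Sum>x\<in>{x \<in> F. len x = n}. (\<eta> x)\<^sup>2)"
  proof (intro sum.cong refl)
    fix n
    have "(\<Sum>x\<in>sph n. (if x \<in> F then \<eta> x else 0)\<^sup>2) = (\<Sum>x\<in>{x \<in> F. len x = n}. (\<eta> x)\<^sup>2)"
      by (rule sum.mono_neutral_cong_right) (use F finite_sph in \<open>auto simp: sph_def\<close>)
    then show "(L2_set (\<lambda>x. if x \<in> F then \<eta> x else 0) (sph n))\<^sup>2 = (\<Sum>x\<in>{x \<in> F. len x = n}. (\<eta> x)\<^sup>2)"
      by (simp add: L2_set_def sum_nonneg)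
  qed
  also have "\<dots> = (\<Sum>x\<in>F. (\<eta> x)\<^sup>2)"
    by (rule sum.group) (use F R in auto)
  finally show ?thesis by (simp add: L2_set_def[of _ "{..R}"] L2_set_def[of \<eta>])
qed

text \<open>The part of the matrix near the diagonal is controlled by the Haagerup inequality.\<close>

lemma defect_part:
  assumes x: "x \<in> H" and K: "finite K"
    and le: "\<And>v y. v \<in> carrier W \<Longrightarrow> y \<in> carrier W \<Longrightarrow>
      cmod (x (delta v) y) \<le> (\<Sum>k\<in>K. \<Sum>w\<in>sph k. cmod (coef x w) * route_weight w v y)"
    and \<Phi>: "\<And>J. finite J \<Longrightarrow> (\<Sum>j\<in>J. \<bar>defect N j\<bar>) \<le> \<Phi>"
    and F: "finite F" "F \<subseteq> carrier W" and G: "finite G" "G \<subseteq> carrier W"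
  shows "(\<Sum>y\<in>F. \<Sum>v\<in>G. cmod (\<eta> y) * cmod (\<xi> v) * (\<bar>defect N (int (len y) - int (len v))\<bar> * cmod (x (delta v) y)))
    \<le> \<Phi> * (haagerup_const * (\<Sum>k\<in>K. L2c (coef x) (sph k))) * L2c \<eta> F * L2c \<xi> G"
proof -
  define R where "R = Max (insert 0 (len ` (F \<union> G)))"
  have R: "len y \<le> R" if "y \<in> F \<union> G" for y
    unfolding R_def using F G that by (intro Max_ge) auto
  define u where "u y = (if y \<in> F then cmod (\<eta> y) else 0)" for y
  define t where "t v = (if v \<in> G then cmod (\<xi> v) else 0)" for v
  let ?d = "\<lambda>i j. \<bar>defect N (int i - int j)\<bar>" and ?X = "\<lambda>v y. cmod (x (delta v) y)"
  let ?C = "haagerup_const * (\<Sum>k\<in>K. L2c (coef x) (sph k))"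
  have block: "(\<Sum>y\<in>sph i. \<Sum>v\<in>sph j. u y * t v * ?X v y) \<le> ?C * \<bar>L2_set u (sph i)\<bar> * \<bar>L2_set t (sph j)\<bar>" for i j
  proof -
    have "(\<Sum>y\<in>sph i. \<Sum>v\<in>sph j. u y * t v * ?X v y)
        \<le> (\<Sum>y\<in>sph i. \<Sum>v\<in>sph j. u y * t v * (\<Sum>k\<in>K. \<Sum>w\<in>sph k. cmod (coef x w) * route_weight w v y))"
      by (intro sum_mono mult_left_mono le) (auto simp: u_def t_def sph_def)
    also have "\<dots> = (\<Sum>y\<in>sph i. \<Sum>v\<in>sph j. \<Sum>k\<in>K. \<Sum>w\<in>sph k. cmod (coef x w) * t v * u y * route_weight w v y)"
      by (simp add: sum_distrib_left mult_ac)
    also have "\<dots> = (\<Sum>y\<in>sph i. \<Sum>k\<in>K. \<Sum>v\<in>sph j. \<Sum>w\<in>sph k. cmod (coef x w) * t v * u y * route_weight w v y)"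
      by (intro sum.cong[OF refl]) (rule sum.swap)
    also have "\<dots> = (\<Sum>k\<in>K. \<Sum>y\<in>sph i. \<Sum>v\<in>sph j. \<Sum>w\<in>sph k. cmod (coef x w) * t v * u y * route_weight w v y)"
      by (rule sum.swap)
    also have "\<dots> = (\<Sum>k\<in>K. \<Sum>y\<in>sph i. \<Sum>w\<in>sph k. \<Sum>v\<in>sph j. cmod (coef x w) * t v * u y * route_weight w v y)"
      by (intro sum.cong[OF refl]) (rule sum.swap)
    also have "\<dots> = (\<Sum>k\<in>K. \<Sum>w\<in>sph k. \<Sum>y\<in>sph i. \<Sum>v\<in>sph j. cmod (coef x w) * t v * u y * route_weight w v y)"
      by (intro sum.cong[OF refl]) (rule sum.swap)
    also have "\<dots> = (\<Sum>k\<in>K. \<Sum>w\<in>sph k. \<Sum>v\<in>sph j. \<Sum>y\<in>sph i. cmod (coef x w) * t v * u y * route_weight w v y)"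
      by (intro sum.cong[OF refl]) (rule sum.swap)
    also have "\<dots> = (\<Sum>k\<in>K. \<Sum>(w, v, y)\<in>sph k \<times> sph j \<times> sph i. cmod (coef x w) * t v * u y * route_weight w v y)"
      by (simp add: sum.cartesian_product')
    also have "\<dots> \<le> (\<Sum>k\<in>K. haagerup_const * L2c (coef x) (sph k) * L2_set t (sph j) * L2_set u (sph i))"
      by (intro sum_mono haagerup) (auto simp: u_def t_def)
    also have "\<dots> = ?C * \<bar>L2_set u (sph i)\<bar> * \<bar>L2_set t (sph j)\<bar>"
      by (simp add: sum_distrib_left sum_distrib_right mult_ac)
    finally show ?thesis .
  qed
  let ?h = "\<lambda>y v. u y * t v * (?d (len y) (len v) * ?X v y)"
  have "(\<Sum>y\<in>F. \<Sum>v\<in>G. cmod (\<eta> y) * cmod (\<xi> v) * (?d (len y) (len v) * ?X v y))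
      = (\<Sum>y\<in>F. \<Sum>v\<in>G. ?h y v)"
    by (intro sum.cong refl) (simp add: u_def t_def)
  also have "\<dots> = (\<Sum>i\<le>R. \<Sum>y\<in>{y \<in> F. len y = i}. \<Sum>v\<in>G. ?h y v)"
    by (rule sum.group[symmetric]) (use F R in auto)
  also have "\<dots> = (\<Sum>i\<le>R. \<Sum>y\<in>{y \<in> F. len y = i}. \<Sum>j\<le>R. \<Sum>v\<in>{v \<in> G. len v = j}. ?h y v)"
    by (intro sum.cong refl sum.group[symmetric]) (use G R in auto)
  also have "\<dots> \<le> (\<Sum>i\<le>R. \<Sum>y\<in>sph i. \<Sum>j\<le>R. \<Sum>v\<in>sph j. ?h y v)"
  proof (rule sum_mono)
    fix i
    have nn: "0 \<le> ?h y v" for y v by (auto simp: u_def t_def)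
    have "(\<Sum>y\<in>{y \<in> F. len y = i}. \<Sum>j\<le>R. \<Sum>v\<in>{v \<in> G. len v = j}. ?h y v)
        \<le> (\<Sum>y\<in>{y \<in> F. len y = i}. \<Sum>j\<le>R. \<Sum>v\<in>sph j. ?h y v)"
      using G by (intro sum_mono sum_mono2 finite_sph nn) (auto simp: sph_def)
    also have "\<dots> \<le> (\<Sum>y\<in>sph i. \<Sum>j\<le>R. \<Sum>v\<in>sph j. ?h y v)"
      using F by (intro sum_mono2 finite_sph sum_nonneg nn) (auto simp: sph_def)
    finally show "(\<Sum>y\<in>{y \<in> F. len y = i}. \<Sum>j\<le>R. \<Sum>v\<in>{v \<in> G. len v = j}. ?h y v)
        \<le> (\<Sum>y\<in>sph i. \<Sum>j\<le>R. \<Sum>v\<in>sph j. ?h y v)" .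
  qed
  also have "\<dots> = (\<Sum>i\<le>R. \<Sum>j\<le>R. \<Sum>y\<in>sph i. \<Sum>v\<in>sph j. ?h y v)"
    by (intro sum.cong[OF refl]) (rule sum.swap)
  also have "\<dots> = (\<Sum>i\<le>R. \<Sum>j\<le>R. ?d i j * (\<Sum>y\<in>sph i. \<Sum>v\<in>sph j. u y * t v * ?X v y))"
    by (intro sum.cong refl) (auto simp: sum_distrib_left sph_def mult_ac intro!: sum.cong)
  also have "\<dots> \<le> (\<Sum>i\<le>R. \<Sum>j\<le>R. ?d i j * (?C * \<bar>L2_set u (sph i)\<bar> * \<bar>L2_set t (sph j)\<bar>))"
    by (intro sum_mono mult_left_mono block) auto
  also have "\<dots> = ?C * (\<Sum>(i, j)\<in>{..R} \<times> {..R}. ?d i j * \<bar>L2_set u (sph i)\<bar> * \<bar>L2_set t (sph j)\<bar>)"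
    by (simp add: sum.cartesian_product' sum_distrib_left mult_ac)
  also have "\<dots> \<le> ?C * (\<Phi> * L2_set (\<lambda>i. L2_set u (sph i)) {..R} * L2_set (\<lambda>j. L2_set t (sph j)) {..R})"
  proof (rule mult_left_mono)
    show "0 \<le> ?C" using haagerup_const_nonneg by (intro mult_nonneg_nonneg sum_nonneg) auto
  qed (intro convolution_bound \<Phi>; simp)
  also have "L2_set (\<lambda>i. L2_set u (sph i)) {..R} = L2c \<eta> F"
    unfolding u_def by (rule L2_spheres[OF F]) (use R in auto)
  also have "L2_set (\<lambda>j. L2_set t (sph j)) {..R} = L2c \<xi> G"
    unfolding t_def by (rule L2_spheres[OF G]) (use R in auto)
  finally show ?thesis by (simp add: mult_ac)
qed

text \<open>The matrix of \<open>x\<close> is \<open>avg_recip\<close> times the matrix of the commutator plus \<open>defect\<close> times the matrix of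
  \<open>x\<close>, both depending on the difference of lengths. The first part is small since \<open>avg_recip\<close> is a
  multiplier of small norm.\<close>

lemma norm_estimate:
  assumes x: "x \<in> H" and K: "finite K"
    and le: "\<And>v y. v \<in> carrier W \<Longrightarrow> y \<in> carrier W \<Longrightarrow>
      cmod (x (delta v) y) \<le> (\<Sum>k\<in>K. \<Sum>w\<in>sph k. cmod (coef x w) * route_weight w v y)"
    and \<Phi>: "\<And>J. finite J \<Longrightarrow> (\<Sum>j\<in>J. \<bar>defect N j\<bar>) \<le> \<Phi>"
  shows "opnorm x \<le> sqrt (recip_const / (2 * real N + 1)) * opnorm (comm x)
    + \<Phi> * (haagerup_const * (\<Sum>k\<in>K. L2c (coef x) (sph k)))"
    (is "_ \<le> ?A * _ + ?B")
proof (rule op_norm_leI_form)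
  have xb: "x \<in> bounded_operators (carrier W)" and cb: "comm x \<in> bounded_operators (carrier W)"
    using H_carrier[OF x] comm_carrier[OF x] by (simp_all add: Op_carrier)
  then show "x \<in> bounded_operators (carrier W)" by simp
  have \<Phi>0: "0 \<le> \<Phi>" using \<Phi>[of "{}"] by simp
  have B0: "0 \<le> ?B"
    using haagerup_const_nonneg \<Phi>0 by (intro mult_nonneg_nonneg sum_nonneg) auto
  show "0 \<le> ?A * opnorm (comm x) + ?B"
    using B0 op_norm_nonneg[OF cb] recip_const_nonneg by simp
  fix F G and \<eta> \<xi> :: "'a \<Rightarrow> complex"
  assume F: "finite F" "F \<subseteq> carrier W" and G: "finite G" "G \<subseteq> carrier W"
  let ?j = "\<lambda>y v. int (len y) - int (len v)"
  have split: "x (delta v) y = complex_of_real (avg_recip N (?j y v)) * comm x (delta v) y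
      + complex_of_real (defect N (?j y v)) * x (delta v) y" if "v \<in> G" for y v
  proof -
    have c: "comm x (delta v) y = complex_of_real (real_of_int (?j y v)) * x (delta v) y"
      using comm_entry[OF x, of v y] G(2) that by auto
    show ?thesis unfolding c defect_def by (simp add: algebra_simps)
  qed
  define Far where "Far = (\<Sum>y\<in>F. \<Sum>v\<in>G. cnj (\<eta> y) * \<xi> v *
    (complex_of_real (avg_recip N (?j y v)) * comm x (delta v) y))"
  define Near where "Near = (\<Sum>y\<in>F. \<Sum>v\<in>G. cnj (\<eta> y) * \<xi> v *
    (complex_of_real (defect N (?j y v)) * x (delta v) y))"
  have "(\<Sum>y\<in>F. \<Sum>v\<in>G. cnj (\<eta> y) * \<xi> v * x (delta v) y)
      = (\<Sum>y\<in>F. \<Sum>v\<in>G. cnj (\<eta> y) * \<xi> v * (complex_of_real (avg_recip N (?j y v)) * comm x (delta v) y)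
          + cnj (\<eta> y) * \<xi> v * (complex_of_real (defect N (?j y v)) * x (delta v) y))"
  proof (intro sum.cong refl)
    fix y v assume "v \<in> G"
    from split[OF this, of y] show "cnj (\<eta> y) * \<xi> v * x (delta v) y
        = cnj (\<eta> y) * \<xi> v * (complex_of_real (avg_recip N (?j y v)) * comm x (delta v) y)
          + cnj (\<eta> y) * \<xi> v * (complex_of_real (defect N (?j y v)) * x (delta v) y)"
      by (metis distrib_left)
  qed
  then have eq: "(\<Sum>y\<in>F. \<Sum>v\<in>G. cnj (\<eta> y) * \<xi> v * x (delta v) y) = Far + Near"
    by (simp only: sum.distrib Far_def Near_def)
  have far: "cmod Far \<le> ?A * opnorm (comm x) * L2c \<eta> F * L2c \<xi> G"
    unfolding Far_def by (rule schur_avg_recip[where lh = len, OF cb F G])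
  have "cmod Near \<le> (\<Sum>y\<in>F. cmod (\<Sum>v\<in>G. cnj (\<eta> y) * \<xi> v *
      (complex_of_real (defect N (?j y v)) * x (delta v) y)))"
    unfolding Near_def by (rule norm_sum)
  also have "\<dots> \<le> (\<Sum>y\<in>F. \<Sum>v\<in>G. cmod (cnj (\<eta> y) * \<xi> v * (complex_of_real (defect N (?j y v)) * x (delta v) y)))"
    by (rule sum_mono) (rule norm_sum)
  also have "\<dots> = (\<Sum>y\<in>F. \<Sum>v\<in>G. cmod (\<eta> y) * cmod (\<xi> v) * (\<bar>defect N (?j y v)\<bar> * cmod (x (delta v) y)))"
    by (simp only: norm_mult complex_mod_cnj norm_of_real)
  also have "\<dots> \<le> ?B * L2c \<eta> F * L2c \<xi> G"
    by (rule defect_part[OF x K le \<Phi> F G])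
  finally have near: "cmod Near \<le> ?B * L2c \<eta> F * L2c \<xi> G" .
  have "cmod (Far + Near) \<le> cmod Far + cmod Near" by (rule norm_triangle_ineq)
  also have "\<dots> \<le> (?A * opnorm (comm x) + ?B) * L2c \<eta> F * L2c \<xi> G"
    using far near by (simp only: distrib_right)
  finally show "cmod (\<Sum>y\<in>F. \<Sum>v\<in>G. cnj (\<eta> y) * \<xi> v * x (delta v) y)
      \<le> (?A * opnorm (comm x) + ?B) * L2c \<eta> F * L2c \<xi> G"
    by (simp only: eq)
qed

text \<open>The commutator applied to the unit vector of the neutral element controls the coefficients,
  weighted by the length.\<close>

lemma weighted_coef_bound:
  assumes x: "x \<in> H" and F: "finite F" "F \<subseteq> carrier W"
  shows "L2_set (\<lambda>w. real (len w) * cmod (coef x w)) F \<le> opnorm (comm x)"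
proof -
  have cb: "comm x \<in> bounded_operators (carrier W)" using comm_carrier[OF x] by (simp add: Op_carrier)
  have d: "delta \<one> \<in> l2" by (simp add: delta_in_ell2)
  have nd: "ell2_norm (carrier W) (delta \<one>) = 1"
  proof -
    have "delta \<one> = trunc {\<one>} (\<lambda>_. 1)" by (auto simp: delta_def trunc_def)
    then show ?thesis using ell2_norm_trunc[of "{\<one>}" "carrier W" "\<lambda>_. 1"] by simp
  qed
  have "L2_set (\<lambda>w. real (len w) * cmod (coef x w)) F = L2c (comm x (delta \<one>)) F"
    by (intro L2_set_cong refl) (simp add: comm_entry[OF x] len_one norm_mult)
  also have "\<dots> \<le> ell2_norm (carrier W) (comm x (delta \<one>))"
    by (rule L2c_le_ell2_norm[OF op_closed[OF cb d] F])
  also have "\<dots> \<le> opnorm (comm x)" using op_norm_bound(1)[OF cb d] nd by simp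
  finally show ?thesis .
qed

lemma coef_sphere_sum:
  assumes x: "x \<in> H" and K: "finite K"
  shows "L2_set (\<lambda>k. real k * L2c (coef x) (sph k)) K \<le> opnorm (comm x)"
proof -
  let ?F = "\<Union>k\<in>K. sph k"
  have "(\<Sum>k\<in>K. (real k * L2c (coef x) (sph k))\<^sup>2)
      = (\<Sum>k\<in>K. \<Sum>w\<in>sph k. (real (len w) * cmod (coef x w))\<^sup>2)"
    by (intro sum.cong refl)
       (simp add: L2_set_def sum_nonneg power_mult_distrib sum_distrib_left, simp add: sph_def)
  also have "\<dots> = (\<Sum>w\<in>?F. (real (len w) * cmod (coef x w))\<^sup>2)"
    by (rule sum.UNION_disjoint[symmetric]) (use K finite_sph in \<open>auto simp: sph_def\<close>)
  finally have "L2_set (\<lambda>k. real k * L2c (coef x) (sph k)) K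
      = L2_set (\<lambda>w. real (len w) * cmod (coef x w)) ?F"
    by (simp only: L2_set_def)
  also have "\<dots> \<le> opnorm (comm x)"
    by (rule weighted_coef_bound[OF x]) (use K finite_sph in \<open>auto simp: sph_def\<close>)
  finally show ?thesis .
qed

text \<open>For the choice of the length beyond which coefficients are negligible.\<close>

lemma inverse_square_tail:
  assumes "0 < e"
  obtains M where "\<And>K. finite K \<Longrightarrow> K \<subseteq> {M<..} \<Longrightarrow> L2_set (\<lambda>k. 1 / real k) K \<le> e"
proof -
  have s: "summable (\<lambda>n. 1 / real n ^ 2)"
    using inverse_power_summable[of 2, where 'a=real] by (simp add: inverse_eq_divide power_divide)
  obtain M where M: "norm (suminf (\<lambda>i. 1 / real (i + n) ^ 2)) < e\<^sup>2" if "M \<le> n" for n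
    using suminf_exist_split[OF _ s, of "e\<^sup>2"] assms by auto
  have "L2_set (\<lambda>k. 1 / real k) K \<le> e" if K: "finite K" "K \<subseteq> {M<..}" for K
  proof -
    have inj: "inj_on (\<lambda>k. k - M) K" using K(2) by (auto simp: inj_on_def subset_iff)
    have "(\<Sum>k\<in>K. (1 / real k)\<^sup>2) = (\<Sum>k\<in>K. 1 / real (k - M + M) ^ 2)"
      using K(2) by (intro sum.cong refl) (auto simp: power_divide subset_iff)
    also have "\<dots> = (\<Sum>i\<in>(\<lambda>k. k - M) ` K. 1 / real (i + M) ^ 2)"
      using sum.reindex[OF inj, of "\<lambda>i. 1 / real (i + M) ^ 2"] by (simp only: comp_def)
    also have "\<dots> \<le> suminf (\<lambda>i. 1 / real (i + M) ^ 2)"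
      using K(1) s summable_ignore_initial_segment[OF s, of M] by (intro sum_le_suminf) auto
    also have "\<dots> \<le> e\<^sup>2" using M[of M] by simp
    finally show ?thesis unfolding L2_set_def using assms by (simp add: real_le_lsqrt)
  qed
  then show ?thesis by (rule that)
qed

text \<open>The elements with bounded commutator are, up to a small error, controlled by finitely many
  coefficients: first choose \<open>N\<close> to make the part far from the diagonal small, then the length \<open>M\<close>
  beyond which the coefficients do not matter near the diagonal.\<close>

theorem norm_by_coefficients:
  assumes e: "0 < e"
  obtains M C where "0 \<le> C" "\<And>x. x \<in> H \<Longrightarrow> coef x \<one> = 0 \<Longrightarrow> opnorm (comm x) \<le> 2 \<Longrightarrow>
    opnorm x \<le> e + C * (\<Sum>w\<in>{w \<in> carrier W. len w \<le> M}. cmod (coef x w))"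
proof -
  have "((\<lambda>N. sqrt (recip_const / (2 * real N + 1))) \<longlongrightarrow> sqrt 0) sequentially"
    by (intro tendsto_real_sqrt) real_asymp
  then have "eventually (\<lambda>N. sqrt (recip_const / (2 * real N + 1)) < e / 4) sequentially"
    using e by (intro order_tendstoD(2)) auto
  then obtain N where N: "sqrt (recip_const / (2 * real N + 1)) < e / 4"
    by (auto simp: eventually_sequentially)
  obtain \<Phi> where \<Phi>: "\<And>J. finite J \<Longrightarrow> (\<Sum>j\<in>J. \<bar>defect N j\<bar>) \<le> \<Phi>"
    using defect_summable[of N] by blast
  have \<Phi>0: "0 \<le> \<Phi>" using \<Phi>[of "{}"] by simp
  define C where "C = \<Phi> * haagerup_const"
  have C: "0 \<le> C" using \<Phi>0 haagerup_const_nonneg by (simp add: C_def)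
  have e': "0 < e / (4 * (C + 1))" using e C by simp
  obtain M where M: "\<And>K. finite K \<Longrightarrow> K \<subseteq> {M<..} \<Longrightarrow> L2_set (\<lambda>k. 1 / real k) K \<le> e / (4 * (C + 1))"
    using inverse_square_tail[OF e'] by blast
  have "opnorm x \<le> e + C * (\<Sum>w\<in>{w \<in> carrier W. len w \<le> M}. cmod (coef x w))"
    if x: "x \<in> H" and c: "opnorm (comm x) \<le> 2" for x
  proof -
    obtain K where K: "finite K"
      and le: "\<And>v y. v \<in> carrier W \<Longrightarrow> y \<in> carrier W \<Longrightarrow>
        cmod (x (delta v) y) \<le> (\<Sum>k\<in>K. \<Sum>w\<in>sph k. cmod (coef x w) * route_weight w v y)"
      by (rule entry_le[OF x]) (rule that)
    let ?c = "\<lambda>k. L2c (coef x) (sph k)"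
    have cb: "comm x \<in> bounded_operators (carrier W)" using comm_carrier[OF x] by (simp add: Op_carrier)
    have "sum ?c K = sum ?c {k \<in> K. k \<le> M} + sum ?c {k \<in> K. M < k}"
    proof -
      have eq: "{k \<in> K. k \<le> M} \<union> {k \<in> K. M < k} = K" by auto
      have dis: "{k \<in> K. k \<le> M} \<inter> {k \<in> K. M < k} = {}" by auto
      show ?thesis
        using sum.union_disjoint[OF _ _ dis, of ?c, unfolded eq] K by simp
    qed
    also have "sum ?c {k \<in> K. M < k} \<le> e / (2 * (C + 1))"
    proof -
      let ?K = "{k \<in> K. M < k}"
      have "sum ?c ?K = (\<Sum>k\<in>?K. \<bar>1 / real k\<bar> * \<bar>real k * ?c k\<bar>)"
        by (intro sum.cong) (auto simp: abs_mult)
      also have "\<dots> \<le> L2_set (\<lambda>k. 1 / real k) ?K * L2_set (\<lambda>k. real k * ?c k) ?K"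
        by (rule L2_set_mult_ineq)
      also have "\<dots> \<le> e / (4 * (C + 1)) * 2"
        using K coef_sphere_sum[OF x, of ?K] c e'
        by (intro mult_mono M) auto
      also have "e / (4 * (C + 1)) * 2 = e / (2 * (C + 1))" using C by (simp add: field_simps)
      finally show ?thesis .
    qed
    also have "sum ?c {k \<in> K. k \<le> M} \<le> (\<Sum>w\<in>{w \<in> carrier W. len w \<le> M}. cmod (coef x w))"
    proof -
      have "sum ?c {k \<in> K. k \<le> M} \<le> sum ?c {..M}" by (intro sum_mono2) auto
      also have "\<dots> \<le> (\<Sum>k\<le>M. \<Sum>w\<in>sph k. cmod (coef x w))"
        by (intro sum_mono L2_set_le_sum) simp
      also have "\<dots> = (\<Sum>w\<in>(\<Union>k\<in>{..M}. sph k). cmod (coef x w))"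
        by (rule sum.UNION_disjoint[symmetric]) (use finite_sph in \<open>auto simp: sph_def\<close>)
      also have "(\<Union>k\<in>{..M}. sph k) = {w \<in> carrier W. len w \<le> M}" by (auto simp: sph_def)
      finally show ?thesis .
    qed
    finally have sK: "sum ?c K \<le> (\<Sum>w\<in>{w \<in> carrier W. len w \<le> M}. cmod (coef x w)) + e / (2 * (C + 1))"
      by simp
    have "opnorm x \<le> sqrt (recip_const / (2 * real N + 1)) * opnorm (comm x) + C * sum ?c K"
      using norm_estimate[OF x K le \<Phi>] by (simp add: C_def mult.assoc)
    also have "\<dots> \<le> e / 4 * 2 + C * ((\<Sum>w\<in>{w \<in> carrier W. len w \<le> M}. cmod (coef x w)) + e / (2 * (C + 1)))"
      using N c C sK op_norm_nonneg[OF cb] e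
      by (intro add_mono mult_mono mult_left_mono[of "sum ?c K"]) (auto intro: sum_nonneg)
    also have "\<dots> = e / 2 + C * (\<Sum>w\<in>{w \<in> carrier W. len w \<le> M}. cmod (coef x w)) + C * (e / (2 * (C + 1)))"
      by (simp add: distrib_left)
    also have "\<dots> \<le> e / 2 + C * (\<Sum>w\<in>{w \<in> carrier W. len w \<le> M}. cmod (coef x w)) + e / 2"
      using C e by (intro add_left_mono) (simp add: field_simps)
    finally show ?thesis by simp
  qed
  then show ?thesis using C that by blast
qed

section \<open>The compact quantum metric space\<close>

lemma comm_minus_norm:
  assumes "x \<in> H" "y \<in> H"
  shows "x \<ominus>\<^bsub>Op\<^esub> y \<in> H" "opnorm (comm (x \<ominus>\<^bsub>Op\<^esub> y)) \<le> opnorm (comm x) + opnorm (comm y)"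
proof -
  have e: "x \<ominus>\<^bsub>Op\<^esub> y = x \<oplus>\<^bsub>Op\<^esub> (-1) \<odot>\<^bsub>Op\<^esub> y" using assms H_carrier B.minus_smult by simp
  show "x \<ominus>\<^bsub>Op\<^esub> y \<in> H" unfolding e using assms H_add H_smult by simp
  have "comm (x \<ominus>\<^bsub>Op\<^esub> y) = comm x \<ominus>\<^bsub>Op\<^esub> comm y"
    unfolding e using assms comm_carrier by (simp add: comm_add comm_smult H_smult B.minus_smult)
  then show "opnorm (comm (x \<ominus>\<^bsub>Op\<^esub> y)) \<le> opnorm (comm x) + opnorm (comm y)"
    using B.norm_minus_le[of "comm x" "comm y"] assms comm_carrier by (simp add: Op_nrm)
qed

lemma Op_minus_apply:
  "x \<in> carrier Op \<Longrightarrow> y \<in> carrier Op \<Longrightarrow> f \<in> l2 \<Longrightarrow> (x \<ominus>\<^bsub>Op\<^esub> y) f = (\<lambda>v. x f v - y f v)"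
  by (simp add: B.minus_smult Op_add_apply Op_smult_apply)

lemma coef_bound:
  assumes "x \<in> H" "opnorm (comm x) \<le> 1" "w \<in> carrier W" "w \<noteq> \<one>"
  shows "cmod (coef x w) \<le> 1"
proof -
  have l: "1 \<le> real (len w)" using len_eq_0[OF assms(3)] assms(4) by simp
  have "1 * cmod (coef x w) \<le> real (len w) * cmod (coef x w)" using l by (rule mult_right_mono) simp
  also have "\<dots> \<le> 1" using weighted_coef_bound[OF assms(1), of "{w}"] assms(2,3) by simp
  finally show ?thesis by simp
qed

text \<open>Total boundedness modulo scalars. Elements whose relevant coefficients lie in the same cells of a
  fine grid are close, and there are only finitely many cells to consider.\<close>

theorem totally_bounded:
  assumes e: "0 < e"
  obtains F where "finite F" "F \<subseteq> {x \<in> H. invol Op x = x \<and> opnorm (comm x) \<le> 1 \<and> coef x \<one> = 0}"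
    "\<And>x. x \<in> H \<Longrightarrow> invol Op x = x \<Longrightarrow> opnorm (comm x) \<le> 1 \<Longrightarrow> coef x \<one> = 0 \<Longrightarrow>
      \<exists>b\<in>F. opnorm (x \<ominus>\<^bsub>Op\<^esub> b) \<le> e"
proof -
  define E where "E = {x \<in> H. invol Op x = x \<and> opnorm (comm x) \<le> 1 \<and> coef x \<one> = 0}"
  obtain M C where C: "0 \<le> C" and est: "\<And>x. x \<in> H \<Longrightarrow> coef x \<one> = 0 \<Longrightarrow> opnorm (comm x) \<le> 2 \<Longrightarrow>
      opnorm x \<le> e / 2 + C * (\<Sum>w\<in>{w \<in> carrier W. len w \<le> M}. cmod (coef x w))"
    by (rule norm_by_coefficients[OF half_gt_zero[OF e]]) (rule that)
  define U where "U = {w \<in> carrier W. len w \<le> M}"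
  have U: "finite U" unfolding U_def by (rule finite_ball)
  define d where "d = e / (4 * (C * real (card U) + 1))"
  have p: "0 < C * real (card U) + 1" using C by (simp add: add_nonneg_pos)
  have d: "0 < d" using e p by (simp add: d_def)
  define g where "g x = (\<lambda>w\<in>U. (\<lfloor>Re (coef x w) / d\<rfloor>, \<lfloor>Im (coef x w) / d\<rfloor>))" for x
  \<comment> \<open>the floors of numbers of absolute value at most \<open>1 / d\<close> have absolute value at most \<open>R\<close>\<close>
  define R where "R = \<lceil>1 / d\<rceil> + 1"
  have range: "\<lfloor>r / d\<rfloor> \<in> {- R..R}" if "\<bar>r\<bar> \<le> 1" for r :: real
  proof -
    have "r / d \<le> 1 / d" "- (1 / d) \<le> r / d" using that d by (auto simp: divide_right_mono field_simps abs_le_iff)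
    then show ?thesis unfolding R_def by (simp add: floor_le_iff le_floor_iff) linarith
  qed
  have "g x \<in> U \<rightarrow>\<^sub>E {- R..R} \<times> {- R..R}" if x: "x \<in> E" for x
  proof -
    have "cmod (coef x w) \<le> 1" if "w \<in> U" for w
      using coef_bound[of x w] x that by (cases "w = \<one>") (auto simp: E_def U_def)
    then have "\<bar>Re (coef x w)\<bar> \<le> 1 \<and> \<bar>Im (coef x w)\<bar> \<le> 1" if "w \<in> U" for w
      using that abs_Re_le_cmod[of "coef x w"] abs_Im_le_cmod[of "coef x w"] order_trans by blast
    then show ?thesis using range by (auto simp: g_def simp del: atLeastAtMost_iff)
  qed
  then have fin: "finite (g ` E)"
    using U by (intro finite_subset[OF _ finite_PiE[of U "\<lambda>_. {- R..R} \<times> {- R..R}"]]) auto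
  define rep where "rep c = (SOME x. x \<in> E \<and> g x = c)" for c
  have rep: "rep c \<in> E \<and> g (rep c) = c" if "c \<in> g ` E" for c
    unfolding rep_def using that by (intro someI_ex[of "\<lambda>x. x \<in> E \<and> g x = c"]) auto
  have near: "\<exists>b\<in>rep ` g ` E. opnorm (x \<ominus>\<^bsub>Op\<^esub> b) \<le> e" if x: "x \<in> E" for x
  proof -
    let ?b = "rep (g x)"
    have b: "?b \<in> E" "g ?b = g x" using rep[of "g x"] x by auto
    have H: "x \<in> H" "?b \<in> H" using x b by (auto simp: E_def)
    have c: "coef (x \<ominus>\<^bsub>Op\<^esub> ?b) w = coef x w - coef ?b w" for w
      using H H_carrier by (simp add: Op_minus_apply delta_in_ell2)
    have "cmod (coef (x \<ominus>\<^bsub>Op\<^esub> ?b) w) \<le> 2 * d" if w: "w \<in> U" for w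
    proof -
      have fl: "\<bar>r - r'\<bar> \<le> d" if "\<lfloor>r / d\<rfloor> = \<lfloor>r' / d\<rfloor>" for r r' :: real
      proof -
        have "\<bar>r / d - r' / d\<bar> \<le> 1" using that by linarith
        then have "\<bar>r - r'\<bar> / d \<le> 1" using d by (simp add: abs_divide flip: diff_divide_distrib)
        then show ?thesis using d by simp
      qed
      have "g x w = g ?b w" using b by simp
      then have "\<lfloor>Re (coef x w) / d\<rfloor> = \<lfloor>Re (coef ?b w) / d\<rfloor>" "\<lfloor>Im (coef x w) / d\<rfloor> = \<lfloor>Im (coef ?b w) / d\<rfloor>"
        using w by (simp_all add: g_def)
      from fl[OF this(1)] fl[OF this(2)] show ?thesis
        unfolding c using cmod_le[of "coef x w - coef ?b w"] by simp
    qed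
    then have "(\<Sum>w\<in>U. cmod (coef (x \<ominus>\<^bsub>Op\<^esub> ?b) w)) \<le> (\<Sum>w\<in>U. 2 * d)" by (intro sum_mono)
    then have s: "(\<Sum>w\<in>U. cmod (coef (x \<ominus>\<^bsub>Op\<^esub> ?b) w)) \<le> real (card U) * (2 * d)" by simp
    have "opnorm (x \<ominus>\<^bsub>Op\<^esub> ?b) \<le> e / 2 + C * (\<Sum>w\<in>U. cmod (coef (x \<ominus>\<^bsub>Op\<^esub> ?b) w))"
      unfolding U_def
    proof (rule est)
      show "x \<ominus>\<^bsub>Op\<^esub> ?b \<in> H" by (rule comm_minus_norm(1)[OF H])
      show "coef (x \<ominus>\<^bsub>Op\<^esub> ?b) \<one> = 0" unfolding c using x b by (simp add: E_def)
      show "opnorm (comm (x \<ominus>\<^bsub>Op\<^esub> ?b)) \<le> 2"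
        using comm_minus_norm(2)[OF H] x b by (simp add: E_def)
    qed
    also have "\<dots> \<le> e / 2 + C * (real (card U) * (2 * d))"
      using s C by (intro add_left_mono mult_left_mono)
    also have "C * (real (card U) * (2 * d)) \<le> (C * real (card U) + 1) * (2 * d)"
      using d by (simp add: algebra_simps)
    also have "(C * real (card U) + 1) * (2 * d) = e / 2" using p by (simp add: d_def field_simps)
    finally show ?thesis using x by auto
  qed
  show ?thesis
  proof (rule that[of "rep ` g ` E"])
    show "finite (rep ` g ` E)" using fin by simp
    show "rep ` g ` E \<subseteq> {x \<in> H. invol Op x = x \<and> opnorm (comm x) \<le> 1 \<and> coef x \<one> = 0}"
      using rep by (auto simp: E_def)
  qed (use near in \<open>auto simp: E_def\<close>)
qed

lemma coef_one_real:
  assumes x: "x \<in> carrier Op" "invol Op x = x"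
  shows "coef x \<one> = complex_of_real (Re (coef x \<one>))"
proof -
  have b: "x \<in> bounded_operators (carrier W)" "adjoint_operator (carrier W) x = x"
    using x by (auto simp: Op_def)
  have d: "delta \<one> \<in> l2" by (simp add: delta_in_ell2)
  have "cnj (ell2_inner (carrier W) (delta \<one>) (x (delta \<one>))) = ell2_inner (carrier W) (delta \<one>) (x (delta \<one>))"
    using adjoint_inner[OF b(1) d d] b(2) by (simp add: ell2_inner_cnj)
  then have "cnj (coef x \<one>) = coef x \<one>" by (simp add: ell2_inner_delta)
  then show ?thesis by (simp add: complex_eq_iff)
qed

text \<open>It remains to verify the hypotheses of Rieffel's criterion. A vanishing commutator kills all
  coefficients except that of the neutral element; averaging with the adjoint gives density in the
  self-adjoint part; and subtracting the coefficient of the neutral element, which is real, reduces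
  total boundedness modulo scalars to the preceding theorem.\<close>

theorem compact_quantum_metric:
  "compact_quantum_metric_space (hecke_cstar_algebra W S q) (hecke_seminorm W S q)"
proof -
  define C where "C = nrm_topology Op closure_of H"
  define A where "A = Op\<lparr>carrier := C\<rparr>"
  have A_eq: "hecke_cstar_algebra W S q = A"
    by (simp add: hecke_cstar_algebra_def A_def C_def Op_def Let_def)
  have Hsub: "H \<subseteq> carrier Op" using H_carrier by auto
  interpret A: unital_cstar_algebra A
    unfolding A_def C_def
    by (rule B.cstar_closure[OF Hsub H_one H_add H_mult H_smult H_invol])
  have A_simps: "carrier A = C" "mult A = mult Op" "one A = one Op" "zero A = zero Op" "add A = add Op"
    "smult A = smult Op" "invol A = invol Op" "nrm A = opnorm"
    by (simp_all add: A_def Op_nrm)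
  have C_iff: "a \<in> C \<longleftrightarrow> a \<in> carrier Op \<and> (\<forall>e>0. \<exists>b\<in>H. opnorm (a \<ominus>\<^bsub>Op\<^esub> b) < e)" for a
    unfolding C_def B.topology_closure_of[OF Hsub] by (simp add: Op_nrm)
  have CO: "a \<in> carrier Op" if "a \<in> C" for a using that C_iff by blast
  have HC: "a \<in> C" if a: "a \<in> H" for a
    unfolding C_iff using H_carrier[OF a] a B.nrm_zero B.minus_eq_zero[of a a] by (metis Op_nrm)
  have minus: "a \<ominus>\<^bsub>A\<^esub> b = a \<ominus>\<^bsub>Op\<^esub> b" if "a \<in> C" "b \<in> C" for a b
    using A.minus_smult[of a b] B.minus_smult[of a b] that CO by (simp add: A_simps)
  have sa: "a \<in> self_adjoint_part A \<longleftrightarrow> a \<in> C \<and> invol Op a = a" for a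
    by (simp add: self_adjoint_part_iff A_simps)
  let ?L = "hecke_seminorm W S q"
  have L_H: "?L a = ennreal (opnorm (comm a))" if "a \<in> H" for a using that by (simp add: hecke_seminorm_def)
  have L_not: "?L a = \<infinity>" if "a \<notin> H" for a using that by (simp add: hecke_seminorm_def)
  have nn: "0 \<le> opnorm (comm a)" if "a \<in> H" for a
    using comm_carrier[OF that] op_norm_nonneg by (simp add: Op_carrier)
  show ?thesis
    unfolding A_eq
  proof (rule A.rieffel_criterion)
    fix a r assume a: "a \<in> self_adjoint_part A"
    have ac: "a \<in> carrier Op" using a sa CO by blast
    show "?L (complex_of_real r \<odot>\<^bsub>A\<^esub> a) = ennreal \<bar>r\<bar> * ?L a"
    proof (cases "a \<in> H")
      case True
      have "opnorm (comm (complex_of_real r \<odot>\<^bsub>Op\<^esub> a)) = \<bar>r\<bar> * opnorm (comm a)"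
        using B.norm_smult[OF comm_carrier[OF True], of "complex_of_real r"]
        by (simp add: comm_smult[OF True] Op_nrm)
      then show ?thesis
        using True H_smult[OF True] by (simp add: A_simps L_H ennreal_mult nn)
    next
      case False
      show ?thesis
      proof (cases "r = 0")
        case True
        then show ?thesis
          using ac H_zero comm_eq[OF der_zero] B.nrm_zero
          by (simp add: A_simps B.smult_zero_left L_H Op_nrm)
      next
        case r: False
        have "complex_of_real r \<odot>\<^bsub>Op\<^esub> a \<notin> H"
        proof
          assume "complex_of_real r \<odot>\<^bsub>Op\<^esub> a \<in> H"
          then have "complex_of_real (1 / r) \<odot>\<^bsub>Op\<^esub> (complex_of_real r \<odot>\<^bsub>Op\<^esub> a) \<in> H" by (rule H_smult)
          moreover have "complex_of_real (1 / r) \<odot>\<^bsub>Op\<^esub> (complex_of_real r \<odot>\<^bsub>Op\<^esub> a) = a"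
            using ac r B.smult_distr(3)[OF ac, of "complex_of_real (1 / r)" "complex_of_real r"] B.smult_distr(4)[OF ac]
            by simp
          ultimately show False using False by simp
        qed
        then show ?thesis
          using False r by (simp add: A_simps L_not infinity_ennreal_def ennreal_mult_top)
      qed
    qed
  next
    fix a b assume "a \<in> self_adjoint_part A" "b \<in> self_adjoint_part A"
    show "?L (a \<oplus>\<^bsub>A\<^esub> b) \<le> ?L a + ?L b"
    proof (cases "a \<in> H \<and> b \<in> H")
      case True
      then have "opnorm (comm (a \<oplus>\<^bsub>Op\<^esub> b)) \<le> opnorm (comm a) + opnorm (comm b)"
        using B.norm_triangle[of "comm a" "comm b"] comm_carrier by (simp add: comm_add Op_nrm)
      then show ?thesis
        using True H_add[of a b] nn
        by (simp only: A_simps L_H ennreal_plus[symmetric] ennreal_leI simp_thms)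
    next
      case False
      then have "?L a + ?L b = \<infinity>" using L_not by (auto simp: infinity_ennreal_def)
      then show ?thesis by (simp only: infinity_ennreal_def top_greatest)
    qed
  next
    fix a assume "a \<in> self_adjoint_part A"
    then have a: "a \<in> carrier Op" "invol Op a = a" using sa CO by auto
    show "?L a = 0 \<longleftrightarrow> (\<exists>r. a = complex_of_real r \<odot>\<^bsub>A\<^esub> \<one>\<^bsub>A\<^esub>)"
    proof
      assume L0: "?L a = 0"
      then have aH: "a \<in> H" using L_not by fastforce
      then have "opnorm (comm a) \<le> 0" using L0 by (simp only: L_H ennreal_eq_0_iff)
      then have c0: "comm a = \<zero>\<^bsub>Op\<^esub>"
        using B.norm_eq_0[OF comm_carrier[OF aH]] nn[OF aH] by (simp add: Op_nrm)
      have cf: "coef a w = 0" if "w \<noteq> \<one>" for w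
      proof (cases "w \<in> carrier W")
        case True
        have "of_nat (len w) * coef a w = 0"
          using comm_entry[OF aH one_closed, of w] c0 by (simp add: Op_zero_apply delta_in_ell2 len_one)
        then show ?thesis using len_eq_0[OF True] that by simp
      next
        case False
        then show ?thesis using ell2_outside[OF Op_apply_closed[OF a(1) delta_in_ell2[OF one_closed]]] by simp
      qed
      obtain F where F: "finite F" "F \<subseteq> carrier W" "\<And>w. w \<notin> F \<Longrightarrow> coef a w = 0"
        "\<And>f v. f \<in> l2 \<Longrightarrow> a f v = (\<Sum>w\<in>F. coef a w * T w f v)" by (rule H_expansion[OF aH]) (rule that)
      have "a = coef a \<one> \<odot>\<^bsub>Op\<^esub> \<one>\<^bsub>Op\<^esub>"
      proof (rule Op_eqI[OF a(1)])
        fix f v assume f: "f \<in> l2"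
        have "a f v = (\<Sum>w\<in>F \<inter> {\<one>}. coef a w * T w f v)"
          unfolding F(4)[OF f] by (rule sum.mono_neutral_right) (use F cf in auto)
        also have "\<dots> = coef a \<one> * T \<one> f v" using F(3)[of \<one>] by (cases "\<one> \<in> F") auto
        finally show "a f v = (coef a \<one> \<odot>\<^bsub>Op\<^esub> \<one>\<^bsub>Op\<^esub>) f v"
          using f by (simp add: T_one Op_smult_apply)
      qed (simp add: B.A_one_closed)
      then show "\<exists>r. a = complex_of_real r \<odot>\<^bsub>A\<^esub> \<one>\<^bsub>A\<^esub>"
        using coef_one_real[OF a] by (metis A_simps(3,6))
    next
      assume "\<exists>r. a = complex_of_real r \<odot>\<^bsub>A\<^esub> \<one>\<^bsub>A\<^esub>"
      then obtain r where r: "a = complex_of_real r \<odot>\<^bsub>Op\<^esub> \<one>\<^bsub>Op\<^esub>" by (auto simp: A_simps)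
      have "comm a = complex_of_real r \<odot>\<^bsub>Op\<^esub> \<zero>\<^bsub>Op\<^esub>" unfolding r by (simp add: comm_smult[OF H_one] comm_one)
      then have "opnorm (comm a) = 0"
        using B.norm_smult[OF B.A_zero_closed, of "complex_of_real r"] B.nrm_zero by (simp add: Op_nrm)
      then show "?L a = 0" using r H_smult[OF H_one] by (simp add: L_H)
    qed
  next
    show "self_adjoint_part A \<subseteq> nrm_topology A closure_of {a \<in> self_adjoint_part A. ?L a < \<infinity>}"
    proof
      fix a assume a: "a \<in> self_adjoint_part A"
      then have ac: "a \<in> C" "invol Op a = a" by (auto simp: sa)
      note aO = CO[OF ac(1)]
      have sub: "{a \<in> self_adjoint_part A. ?L a < \<infinity>} \<subseteq> carrier A" by (auto simp: self_adjoint_part_iff)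
      have "\<exists>b\<in>{a \<in> self_adjoint_part A. ?L a < \<infinity>}. nrm A (a \<ominus>\<^bsub>A\<^esub> b) < e" if e: "0 < e" for e
      proof -
        obtain b where b: "b \<in> H" "opnorm (a \<ominus>\<^bsub>Op\<^esub> b) < e" using ac(1) C_iff e by blast
        note bO = H_carrier[OF b(1)]
        have ib: "invol Op b \<in> carrier Op" by (rule B.invol_closed[OF bO])
        let ?b = "(1/2) \<odot>\<^bsub>Op\<^esub> (b \<oplus>\<^bsub>Op\<^esub> invol Op b)"
        have bH: "?b \<in> H" by (intro H_smult H_add b H_invol)
        have bsa: "invol Op ?b = ?b"
          using bO ib by (simp add: B.invol_smult B.invol_add B.invol_invol B.A_a_closed B.A_a_comm)
        have "?b \<in> self_adjoint_part A" using HC[OF bH] bsa by (simp add: sa)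
        moreover have "?L ?b < \<infinity>" by (simp only: L_H[OF bH] infinity_ennreal_def ennreal_less_top)
        moreover have "opnorm (a \<ominus>\<^bsub>Op\<^esub> ?b) < e"
        proof -
          let ?d = "a \<ominus>\<^bsub>Op\<^esub> b"
          have d: "?d \<in> carrier Op" by (rule B.A_minus_closed[OF aO bO])
          have id: "invol Op ?d = a \<ominus>\<^bsub>Op\<^esub> invol Op b" using B.invol_minus[OF aO bO] ac(2) by simp
          have "a \<ominus>\<^bsub>Op\<^esub> ?b = (1/2) \<odot>\<^bsub>Op\<^esub> (?d \<oplus>\<^bsub>Op\<^esub> invol Op ?d)"
          proof (rule Op_eqI)
            fix f v assume f: "f \<in> l2"
            show "(a \<ominus>\<^bsub>Op\<^esub> ?b) f v = ((1/2) \<odot>\<^bsub>Op\<^esub> (?d \<oplus>\<^bsub>Op\<^esub> invol Op ?d)) f v"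
              unfolding id using f aO bO ib
              by (simp add: Op_minus_apply Op_smult_apply Op_add_apply B.A_a_closed field_simps)
          qed (use aO bO ib d in \<open>auto intro!: B.A_minus_closed B.smult_cl B.A_a_closed B.invol_closed\<close>)
          then have "opnorm (a \<ominus>\<^bsub>Op\<^esub> ?b) = 1/2 * nrm Op (?d \<oplus>\<^bsub>Op\<^esub> invol Op ?d)"
            using B.norm_smult[of "?d \<oplus>\<^bsub>Op\<^esub> invol Op ?d" "1/2"] d B.invol_closed[OF d]
            by (simp add: Op_nrm[symmetric] B.A_a_closed norm_divide)
          also have "\<dots> \<le> 1/2 * (nrm Op ?d + nrm Op (invol Op ?d))"
            using B.norm_triangle[OF d B.invol_closed[OF d]] by simp
          also have "\<dots> < e" using b(2) B.norm_invol[OF d] by (simp add: Op_nrm)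
          finally show ?thesis .
        qed
        ultimately show ?thesis
          using minus[OF ac(1) HC[OF bH]] by (intro bexI[of _ ?b]) (auto simp: A_simps)
      qed
      then show "a \<in> nrm_topology A closure_of {a \<in> self_adjoint_part A. ?L a < \<infinity>}"
        unfolding A.topology_closure_of[OF sub] using ac by (simp add: A_simps)
    qed
  next
    fix e :: real assume e: "0 < e"
    obtain F where F: "finite F" "F \<subseteq> {x \<in> H. invol Op x = x \<and> opnorm (comm x) \<le> 1 \<and> coef x \<one> = 0}"
      and near: "\<And>x. x \<in> H \<Longrightarrow> invol Op x = x \<Longrightarrow> opnorm (comm x) \<le> 1 \<Longrightarrow> coef x \<one> = 0 \<Longrightarrow>
        \<exists>b\<in>F. opnorm (x \<ominus>\<^bsub>Op\<^esub> b) \<le> e"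
      by (rule totally_bounded[OF e]) (rule that)
    have Fsa: "F \<subseteq> self_adjoint_part A" using F(2) HC by (auto simp: sa)
    have "\<exists>r. \<exists>b\<in>F. nrm A (a \<ominus>\<^bsub>A\<^esub> (complex_of_real r \<odot>\<^bsub>A\<^esub> \<one>\<^bsub>A\<^esub> \<oplus>\<^bsub>A\<^esub> b)) \<le> e"
      if a: "a \<in> self_adjoint_part A" "?L a \<le> 1" for a
    proof -
      have aH: "a \<in> H"
        using a(2) L_not[of a] ennreal_one_less_top by (metis infinity_ennreal_def leD)
      note aO = H_carrier[OF aH]
      have asa: "invol Op a = a" using a(1) by (simp add: sa)
      have La: "opnorm (comm a) \<le> 1" using a(2) by (simp add: L_H[OF aH])
      define r where "r = Re (coef a \<one>)"
      let ?r = "complex_of_real r \<odot>\<^bsub>Op\<^esub> \<one>\<^bsub>Op\<^esub>"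
      have rH: "?r \<in> H" by (intro H_smult H_one)
      note rO = H_carrier[OF rH]
      let ?x = "a \<ominus>\<^bsub>Op\<^esub> ?r"
      have x: "?x \<in> H" by (rule comm_minus_norm(1)[OF aH rH])
      have "comm ?r = complex_of_real r \<odot>\<^bsub>Op\<^esub> \<zero>\<^bsub>Op\<^esub>" by (simp add: comm_smult[OF H_one] comm_one)
      then have "opnorm (comm ?r) = 0"
        using B.norm_smult[OF B.A_zero_closed, of "complex_of_real r"] B.nrm_zero by (simp add: Op_nrm)
      then have Lx: "opnorm (comm ?x) \<le> 1" using comm_minus_norm(2)[OF aH rH] La by simp
      have xsa: "invol Op ?x = ?x"
        using aO rO asa by (simp add: B.invol_minus B.invol_smult B.A_one_closed B.invol_one)
      have "coef ?x \<one> = coef a \<one> - complex_of_real r"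
        using aO rO by (simp add: Op_minus_apply delta_in_ell2 Op_smult_apply Op_one_apply) (simp add: delta_def)
      then have x1: "coef ?x \<one> = 0" using coef_one_real[OF aO asa] by (simp add: r_def)
      obtain b where b: "b \<in> F" "opnorm (?x \<ominus>\<^bsub>Op\<^esub> b) \<le> e" using near[OF x xsa Lx x1] by blast
      have bH: "b \<in> H" using b F by blast
      note bO = H_carrier[OF bH]
      have "a \<ominus>\<^bsub>Op\<^esub> (?r \<oplus>\<^bsub>Op\<^esub> b) = ?x \<ominus>\<^bsub>Op\<^esub> b"
        by (rule Op_eqI)
           (use aO rO bO in \<open>auto simp: Op_minus_apply Op_add_apply B.A_a_closed B.A_minus_closed\<close>)
      then have "nrm A (a \<ominus>\<^bsub>A\<^esub> (?r \<oplus>\<^bsub>Op\<^esub> b)) \<le> e"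
        using b(2) minus[OF HC[OF aH] HC[OF H_add[OF rH bH]]] by (simp add: A_simps)
      then show ?thesis using b(1) by (auto simp: A_simps)
    qed
    with F(1) Fsa show "\<exists>F. finite F \<and> F \<subseteq> self_adjoint_part A \<and>
      (\<forall>a\<in>self_adjoint_part A. ?L a \<le> 1 \<longrightarrow>
        (\<exists>r. \<exists>b\<in>F. nrm A (a \<ominus>\<^bsub>A\<^esub> (complex_of_real r \<odot>\<^bsub>A\<^esub> \<one>\<^bsub>A\<^esub> \<oplus>\<^bsub>A\<^esub> b)) \<le> e))" by blast
  qed
qed

end

theorem corollary2:
  fixes W :: "('w, 'r) monoid_scheme"
    and S :: "'w set"
    and m :: "'w \<Rightarrow> 'w \<Rightarrow> enat"
    and q :: "'w \<Rightarrow> real"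
  assumes "coxeter_system W S m"
    and "finite S"
    and "right_angled S m"
    and "\<not> has_induced_square S m"
    and "q \<in> multi_parameters W S"
  shows "compact_quantum_metric_space (hecke_cstar_algebra W S q) (hecke_seminorm W S q)"
proof -
  interpret hecke_system W S m q
    using assms(1-4)
    by (intro hecke_system.intro square_free_coxeter.intro right_angled_coxeter.intro
        right_angled_coxeter_axioms.intro square_free_coxeter_axioms.intro)
  show ?thesis by (rule compact_quantum_metric)
qed

end
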